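(* Let $\beta>0$, let $\Omega\subset\mathbf{R}^2\simeq\mathbf{C}$ be the interior of a convex polygon with vertices $z_1,\dots,z_n$ and sides $\Gamma_i=(z_i,z_{i+1})$, and let $q_i,\partial_{\mathbf n}q_i\in\mathcal{E}'[0,1]$ for $i=1,\dots,n$ be given distributions (here $\partial_{\mathbf n}q_i$ is merely the name of a distribution). For $\lambda\in\mathbf{C}\setminus\{0\}$ define \[ \rho_i(\lambda)=\mathrm{i}|\Gamma_i|\left[\left\langle \partial_{\mathbf n}q_i,\ \psi_i^*\!\left(e^{-\mathrm{i}\lambda z'+\mathrm{i}\beta^2\bar z'/\lambda}\right)\right\rangle+\left(\lambda e^{\mathrm{i}\alpha_i}+\frac{\beta^2}{\lambda e^{\mathrm{i}\alpha_i}}\right)\left\langle q_i,\ \psi_i^*\!\left(e^{-\mathrm{i}\lambda z'+\mathrm{i}\beta^2\bar z'/\lambda}\right)\right\rangle\right], \] and define $Q$ on $\Omega$ by \[ Q(z,\bar z)=\frac{1}{4\pi \mathrm{i}}\sum_{i=1}^n\int_{\ell_i}e^{\mathrm{i}\lambda z-\mathrm{i}\beta^2\bar z/\lambda}\rho_i(\lambda)\,\frac{\mathrm{d}\lambda}{\lambda}. \] If the global relation $\sum_{i=1}^n\rho_i(\lambda)=0$ holds for all $\lambda\in\mathbf{C}\setminus\{0\}$, then $Q$ solves the boundary value problem \[ -\Delta Q+4\beta^2Q=0\quad\text{in }\Omega,\qquad \lim_{z\to\Gamma_i}Q=q_i\quad\text{in }\mathcal{S}'(\Gamma_i)\text{ for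 } i=1,\dots,n. \]
   Context: The polygon is bounded and convex, its vertices $z_1,\dots,z_n$ are listed counterclockwise (indices modulo $n$), $\Gamma_i=(z_i,z_{i+1})$ is the open side, $\alpha_i=\arg(z_{i+1}-z_i)$, and $|\Gamma_i|$ is the length of $\Gamma_i$. The parametrisation is $\psi_i(\tau)=\tau z_{i+1}+(1-\tau)z_i$, $\tau\in[0,1]$, and $\psi_i^*(f)(\tau)=f(\psi_i(\tau))$. The ray $\ell_i=\{\lambda\in\mathbf C:\arg\lambda=-\alpha_i\}$ is oriented from $0$ to $\infty$. $\mathcal{E}[0,1]$ is the Fréchet space of smooth functions $[0,1]\to\mathbf{C}$ with semi-norms $\delta_n(\varphi)=\max_{[0,1]}|\varphi^{(n)}|$, $n\ge 0$; $\mathcal{E}'[0,1]$ is its topological dual, with pairing $\langle\cdot,\cdot\rangle$. $\mathcal{S}(0,1)$ is the Fréchet space of smooth $\varphi:(0,1)\to\mathbf{C}$ with $\sigma_{mn}(\varphi)=\sup_{\tau\in(0,1)}|\tau^{-m}(1-\tau)^{-m}\varphi^{(n)}(\tau)|<\infty$ for all $m,n\ge0$, and $\mathcal{S}'(0,1)$ is its topological dual; elements of $\mathcal{S}(0,1)$ extend by zero to $\mathcal{E}[0,1]$, so elements of $\mathcal{E}'[0,1]$ restrict to elements of $\mathcal{S}'(0,1)$. Boundary limits: for small $\epsilon>0$ let $\Omega_\epsilon=\{z\in\Omega:\mathrm{dist}(z,\partial\Omega)\ge\epsilon\}$, a polygon whose sides $\Gamma_i^\epsilon$ correspond to (are parallel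 to) the sides $\Gamma_i$; let $\psi_i^\epsilon:[0,1]\to \mathrm{cl}(\Gamma_i^\epsilon)$ be the affine parametrisation with the same direction as $\psi_i$, so that $\psi_i^\epsilon\to\psi_i$ as $\epsilon\to0$. For $Q\in C^\infty(\Omega)$ define $Q_i^\epsilon\in\mathcal{S}'(0,1)$ by $\langle Q_i^\epsilon,\varphi\rangle=\int_0^1Q(\psi_i^\epsilon(\tau))\varphi(\tau)\,\mathrm{d}\tau$. Then "$\lim_{z\to\Gamma_i}Q=q_i$ in $\mathcal{S}'(\Gamma_i)$" means $\lim_{\epsilon\downarrow0}\langle Q_i^\epsilon,\varphi\rangle=\langle q_i,\varphi\rangle$ for every $\varphi\in\mathcal{S}(0,1)$. *)

theory Defs
  imports "HOL-Analysis.Analysis"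
begin

section \<open>Test functions and distributions on the unit interval\<close>

text \<open>
  Derivatives are taken within \<open>S\<close>, hence they are one-sided at the end points of
  \<open>S = {0..1}\<close>.
\<close>

definition nth_deriv_on :: "real set \<Rightarrow> nat \<Rightarrow> (real \<Rightarrow> complex) \<Rightarrow> real \<Rightarrow> complex"
  where "nth_deriv_on S n = (\<lambda>f t. vector_derivative f (at t within S)) ^^ n"

definition smooth_on_real :: "real set \<Rightarrow> (real \<Rightarrow> complex) \<Rightarrow> bool"
  where "smooth_on_real S f \<longleftrightarrow> (\<forall>n. nth_deriv_on S n f differentiable_on S)"

text \<open>
  The topology on the function space \<open>V\<close> given by a family \<open>p\<close> of semi-norms, and the space of
  continuous linear functionals on \<open>V\<close>.
\<close>

definition seminorm_topology ::
    "('a \<Rightarrow> complex) set \<Rightarrow> ('i \<Rightarrow> ('a \<Rightarrow> complex) \<Rightarrow> real) \<Rightarrow> ('a \<Rightarrow> complex) topology"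
  where "seminorm_topology V p = topology (\<lambda>U. U \<subseteq> V \<and>
    (\<forall>f\<in>U. \<exists>F e. finite F \<and> e > 0 \<and>
      {g \<in> V. \<forall>i\<in>F. p i (\<lambda>t. g t - f t) < e} \<subseteq> U))"

lemma istopology_seminorm:
  fixes V :: "('a \<Rightarrow> complex) set" and p :: "'i \<Rightarrow> ('a \<Rightarrow> complex) \<Rightarrow> real"
  shows "istopology (\<lambda>U. U \<subseteq> V \<and>
    (\<forall>f\<in>U. \<exists>F e. finite F \<and> e > 0 \<and>
      {g \<in> V. \<forall>i\<in>F. p i (\<lambda>t. g t - f t) < e} \<subseteq> U))"
    (is "istopology ?L")
proof -
  have "?L (A \<inter> B)" if A: "?L A" and B: "?L B" for A B
  proof (intro conjI ballI)
    show "A \<inter> B \<subseteq> V" using A by blast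
    fix f assume "f \<in> A \<inter> B"
    obtain F e where F: "finite F" "e > 0" "{g \<in> V. \<forall>i\<in>F. p i (\<lambda>t. g t - f t) < e} \<subseteq> A"
      using A \<open>f \<in> A \<inter> B\<close> by blast
    obtain G d where G: "finite G" "d > 0" "{g \<in> V. \<forall>i\<in>G. p i (\<lambda>t. g t - f t) < d} \<subseteq> B"
      using B \<open>f \<in> A \<inter> B\<close> by blast
    have "{g \<in> V. \<forall>i\<in>F \<union> G. p i (\<lambda>t. g t - f t) < min e d} \<subseteq> A \<inter> B"
      using F(3) G(3) by auto
    then show "\<exists>F e. finite F \<and> e > 0 \<and> {g \<in> V. \<forall>i\<in>F. p i (\<lambda>t. g t - f t) < e} \<subseteq> A \<inter> B"
      using F(1,2) G(1,2) by (intro exI[of _ "F \<union> G"] exI[of _ "min e d"]) simp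
  qed
  moreover have "?L (\<Union>K)" if K: "\<forall>U\<in>K. ?L U" for K
  proof (intro conjI ballI)
    show "\<Union>K \<subseteq> V" using K by blast
    fix f assume "f \<in> \<Union>K"
    then obtain U where "U \<in> K" "f \<in> U" by blast
    then obtain F e where F: "finite F" "e > 0" "{g \<in> V. \<forall>i\<in>F. p i (\<lambda>t. g t - f t) < e} \<subseteq> U"
      using bspec[OF K \<open>U \<in> K\<close>] by blast
    then have "{g \<in> V. \<forall>i\<in>F. p i (\<lambda>t. g t - f t) < e} \<subseteq> \<Union>K"
      using \<open>U \<in> K\<close> by blast
    then show "\<exists>F e. finite F \<and> e > 0 \<and> {g \<in> V. \<forall>i\<in>F. p i (\<lambda>t. g t - f t) < e} \<subseteq> \<Union>K"
      using F by blast
  qed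
  ultimately show ?thesis unfolding istopology_def by blast
qed

lemma openin_seminorm_topology:
  "openin (seminorm_topology V p) U \<longleftrightarrow> U \<subseteq> V \<and>
    (\<forall>f\<in>U. \<exists>F e. finite F \<and> e > 0 \<and>
      {g \<in> V. \<forall>i\<in>F. p i (\<lambda>t. g t - f t) < e} \<subseteq> U)"
  unfolding seminorm_topology_def
  by (subst topology_inverse'[OF istopology_seminorm]) (rule refl)

lemma topspace_seminorm_topology [simp]: "topspace (seminorm_topology V p) = V"
proof
  show "topspace (seminorm_topology V p) \<subseteq> V"
    using openin_topspace[of "seminorm_topology V p"]
    unfolding openin_seminorm_topology by (rule conjunct1)
  have "openin (seminorm_topology V p) V"
    unfolding openin_seminorm_topology
    by (auto intro!: exI[of _ "{}"] exI[of _ 1])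
  then show "V \<subseteq> topspace (seminorm_topology V p)"
    by (rule openin_subset)
qed

definition topological_dual ::
    "('a \<Rightarrow> complex) set \<Rightarrow> ('i \<Rightarrow> ('a \<Rightarrow> complex) \<Rightarrow> real) \<Rightarrow> (('a \<Rightarrow> complex) \<Rightarrow> complex) set"
  where "topological_dual V p = {T.
    (\<forall>f\<in>V. \<forall>g\<in>V. T (\<lambda>t. f t + g t) = T f + T g) \<and>
    (\<forall>c. \<forall>f\<in>V. T (\<lambda>t. c * f t) = c * T f) \<and>
    continuous_map (seminorm_topology V p) euclidean T}"

text \<open>
  Elements of \<open>E01\<close> are total functions with arbitrary values outside \<open>[0,1]\<close>. This is harmless:
  functions agreeing on \<open>[0,1]\<close> are not separated by the semi-norms, so a member of \<open>E01_dual\<close>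
  takes the same value at both.
\<close>

definition E01 :: "(real \<Rightarrow> complex) set"
  where "E01 = {\<phi>. smooth_on_real {0..1} \<phi>}"

definition E01_seminorm :: "nat \<Rightarrow> (real \<Rightarrow> complex) \<Rightarrow> real"
  where "E01_seminorm n \<phi> = (SUP t\<in>{0..1}. norm (nth_deriv_on {0..1} n \<phi> t))"

definition E01_dual :: "((real \<Rightarrow> complex) \<Rightarrow> complex) set"
  where "E01_dual = topological_dual E01 E01_seminorm"

text \<open>
  Likewise only the values on \<open>(0,1)\<close> of an element of \<open>S01\<close> matter; \<open>restrict_S01\<close> turns a
  functional on \<open>E01\<close> into one on \<open>S01\<close> via extension by zero.
\<close>

definition S01 :: "(real \<Rightarrow> complex) set"
  where "S01 = {\<phi>. smooth_on_real {0<..<1} \<phi> \<and>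
    (\<forall>m n. bdd_above ((\<lambda>\<tau>. norm (nth_deriv_on {0<..<1} n \<phi> \<tau>) / (\<tau> ^ m * (1 - \<tau>) ^ m)) ` {0<..<1}))}"

definition zero_extension :: "(real \<Rightarrow> complex) \<Rightarrow> real \<Rightarrow> complex"
  where "zero_extension \<phi> \<tau> = (if \<tau> \<in> {0<..<1} then \<phi> \<tau> else 0)"

definition restrict_S01 :: "((real \<Rightarrow> complex) \<Rightarrow> complex) \<Rightarrow> (real \<Rightarrow> complex) \<Rightarrow> complex"
  where "restrict_S01 T \<phi> = T (zero_extension \<phi>)"


section \<open>Smooth functions of two real variables\<close>

definition partial_x :: "(complex \<Rightarrow> complex) \<Rightarrow> complex \<Rightarrow> complex"
  where "partial_x f z = vector_derivative (\<lambda>t::real. f (z + of_real t)) (at 0)"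

definition partial_y :: "(complex \<Rightarrow> complex) \<Rightarrow> complex \<Rightarrow> complex"
  where "partial_y f z = vector_derivative (\<lambda>t::real. f (z + \<i> * of_real t)) (at 0)"

definition laplacian :: "(complex \<Rightarrow> complex) \<Rightarrow> complex \<Rightarrow> complex"
  where "laplacian f z = partial_x (partial_x f) z + partial_y (partial_y f) z"

text \<open>
  Real differentiability is meant here (\<open>differentiable_on\<close> is Frechet differentiability over the
  reals); \<open>S\<close> is supposed to be open.
\<close>

primrec Ck_on :: "nat \<Rightarrow> complex set \<Rightarrow> (complex \<Rightarrow> complex) \<Rightarrow> bool" where
  "Ck_on 0 S f \<longleftrightarrow> continuous_on S f"
| "Ck_on (Suc k) S f \<longleftrightarrow> f differentiable_on S \<and> Ck_on k S (partial_x f) \<and> Ck_on k S (partial_y f)"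

definition Cinf_on :: "complex set \<Rightarrow> (complex \<Rightarrow> complex) \<Rightarrow> bool"
  where "Cinf_on S f \<longleftrightarrow> (\<forall>k. Ck_on k S f)"


section \<open>Convex polygons\<close>

text \<open>
  The vertices are \<open>z 0, \<dots>, z (n - 1)\<close>, with indices modulo \<open>n\<close>.
\<close>

definition side_vec :: "nat \<Rightarrow> (nat \<Rightarrow> complex) \<Rightarrow> nat \<Rightarrow> complex"
  where "side_vec n z i = z (Suc i mod n) - z i"

text \<open>
  \<open>Im (cnj v * w) > 0\<close> says that \<open>w\<close> points strictly to the left of \<open>v\<close>. So the definition requires
  all vertices other than \<open>z i\<close> and \<open>z (i + 1)\<close> to lie strictly to the left of the line from
  \<open>z i\<close> to \<open>z (i + 1)\<close>; this is convexity together with the counterclockwise listing, and every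
  \<open>z i\<close> is a genuine corner.
\<close>

definition convex_polygon_ccw :: "nat \<Rightarrow> (nat \<Rightarrow> complex) \<Rightarrow> bool"
  where "convex_polygon_ccw n z \<longleftrightarrow> n \<ge> 3 \<and>
    (\<forall>i<n. \<forall>j<n. j \<noteq> i \<longrightarrow> j \<noteq> Suc i mod n \<longrightarrow> Im (cnj (side_vec n z i) * (z j - z i)) > 0)"

definition polygon_interior :: "nat \<Rightarrow> (nat \<Rightarrow> complex) \<Rightarrow> complex set"
  where "polygon_interior n z = interior (convex hull (z ` {..<n}))"

definition side_angle :: "nat \<Rightarrow> (nat \<Rightarrow> complex) \<Rightarrow> nat \<Rightarrow> real"
  where "side_angle n z i = Arg (side_vec n z i)"

definition side_param :: "nat \<Rightarrow> (nat \<Rightarrow> complex) \<Rightarrow> nat \<Rightarrow> real \<Rightarrow> complex"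
  where "side_param n z i \<tau> = of_real \<tau> * z (Suc i mod n) + of_real (1 - \<tau>) * z i"


section \<open>Limits at the sides\<close>

definition inner_polygon :: "complex set \<Rightarrow> real \<Rightarrow> complex set"
  where "inner_polygon \<Omega> \<epsilon> = {z \<in> \<Omega>. infdist z (frontier \<Omega>) \<ge> \<epsilon>}"

text \<open>
  \<open>a\<close> and \<open>b\<close> are the initial and terminal point of the side of the inner polygon corresponding to
  the side \<open>i\<close>: the segment is an edge, it has the direction of side \<open>i\<close>, and the inner polygon lies
  to its left, which excludes a parallel edge on the opposite side.
\<close>

definition is_inner_side ::
    "nat \<Rightarrow> (nat \<Rightarrow> complex) \<Rightarrow> nat \<Rightarrow> real \<Rightarrow> complex \<Rightarrow> complex \<Rightarrow> bool"
  where "is_inner_side n z i \<epsilon> a b \<longleftrightarrow>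
    (let P = inner_polygon (polygon_interior n z) \<epsilon> in
      closed_segment a b edge_of P \<and>
      (\<exists>c::real. c > 0 \<and> b - a = of_real c * side_vec n z i) \<and>
      (\<forall>w\<in>P. Im (cnj (side_vec n z i) * (w - a)) \<ge> 0))"

text \<open>
  For small positive \<open>\<epsilon>\<close> the end points \<open>a\<close> and \<open>b\<close> exist and are unique.
\<close>

definition inner_side_param ::
    "nat \<Rightarrow> (nat \<Rightarrow> complex) \<Rightarrow> nat \<Rightarrow> real \<Rightarrow> real \<Rightarrow> complex"
  where "inner_side_param n z i \<epsilon> \<tau> =
    (let (a, b) = (THE (a, b). is_inner_side n z i \<epsilon> a b)
     in of_real \<tau> * b + of_real (1 - \<tau>) * a)"

definition inner_trace ::
    "nat \<Rightarrow> (nat \<Rightarrow> complex) \<Rightarrow> (complex \<Rightarrow> complex) \<Rightarrow> nat \<Rightarrow> real \<Rightarrow> (real \<Rightarrow> complex) \<Rightarrow> complex"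
  where "inner_trace n z Q i \<epsilon> \<phi> =
    (LINT \<tau>:{0<..<1}|lborel. Q (inner_side_param n z i \<epsilon> \<tau>) * \<phi> \<tau>)"

definition has_boundary_limit ::
    "nat \<Rightarrow> (nat \<Rightarrow> complex) \<Rightarrow> (complex \<Rightarrow> complex) \<Rightarrow> nat \<Rightarrow> ((real \<Rightarrow> complex) \<Rightarrow> complex) \<Rightarrow> bool"
  where "has_boundary_limit n z Q i q \<longleftrightarrow>
    (\<forall>\<phi>\<in>S01. ((\<lambda>\<epsilon>. inner_trace n z Q i \<epsilon> \<phi>) \<longlongrightarrow> restrict_S01 q \<phi>) (at_right 0))"


section \<open>The spectral functions and the integral over a ray\<close>

definition exp_kernel :: "real \<Rightarrow> complex \<Rightarrow> complex \<Rightarrow> complex"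
  where "exp_kernel \<beta> k w = exp (- \<i> * k * w + \<i> * of_real (\<beta>\<^sup>2) * cnj w / k)"

definition spectral_fun ::
    "real \<Rightarrow> nat \<Rightarrow> (nat \<Rightarrow> complex) \<Rightarrow> (nat \<Rightarrow> (real \<Rightarrow> complex) \<Rightarrow> complex) \<Rightarrow>
     (nat \<Rightarrow> (real \<Rightarrow> complex) \<Rightarrow> complex) \<Rightarrow> nat \<Rightarrow> complex \<Rightarrow> complex"
  where "spectral_fun \<beta> n z q dq i k =
    (let u = cis (side_angle n z i);
         e = (\<lambda>\<tau>. exp_kernel \<beta> k (side_param n z i \<tau>))
     in \<i> * of_real (norm (side_vec n z i)) *
        (dq i e + (k * u + of_real (\<beta>\<^sup>2) / (k * u)) * q i e))"

text \<open>
  The integral of \<open>f\<close> over the ray \<open>{k. arg k = \<theta>}\<close> oriented from \<open>0\<close> to infinity, parametrised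
  by \<open>k = t * cis \<theta>\<close>.
\<close>

definition ray_integral :: "real \<Rightarrow> (complex \<Rightarrow> complex) \<Rightarrow> complex"
  where "ray_integral \<theta> f = (LINT t:{0<..}|lborel. f (of_real t * cis \<theta>) * cis \<theta>)"

end

theory Submission
  imports Defs "HOL-Complex_Analysis.Cauchy_Integral_Theorem" "HOL-Probability.Sinc_Integral"
begin

text \<open>
  Put \<open>k = \<beta> exp (x + \<i>\<theta>)\<close>. Along the ray of side \<open>j\<close>, where \<open>\<theta> = - \<alpha>\<^sub>j\<close>, the exponential
  \<open>exp (\<i>kz - \<i>\<beta>\<^sup>2 cnj z / k)\<close> based at a point of the side has modulus \<open>exp (- 2\<beta> cosh x h\<^sub>j(z))\<close>, where
  \<open>h\<^sub>j\<close> is the distance from the line of side \<open>j\<close>, measured towards the polygon. A distribution of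
  finite order, paired with the exponential, grows at most like a power of \<open>cosh x\<close>. So inside the
  polygon \<open>Q\<close> is a superposition of plane waves, each of which solves the equation, with weights that
  decay so fast that all derivatives may be taken under the integral (\<open>superposition_Ck_on\<close>,
  \<open>superposition_laplacian\<close>).

  For the trace on side \<open>i\<close>, test \<open>Q\<close> with \<open>\<phi>\<close> along the \<open>i\<close>-th side of the inner polygon and carry out
  the integration along that side first (\<open>wave_integral_trace\<close>). This replaces a wave by the
  Fourier-Laplace transform of \<open>\<phi>\<close> at the phase of the wave along the side, which decays faster than
  any power of \<open>cosh x\<close>. The resulting integrands, called \<open>trace_density\<close>, are therefore dominated
  uniformly in \<open>\<epsilon>\<close>, and the limit \<open>\<epsilon> \<rightarrow> 0\<close> can be taken under the integral
  (\<open>inner_trace_tendsto\<close>).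

  In the limit the density of side \<open>j\<close> is an entire function of \<open>x + \<i>\<theta>\<close>. It stays integrable as long
  as the exponential is bounded for all base points on side \<open>j\<close> and all targets on side \<open>i\<close>
  (\<open>trace_density_bound\<close>). For \<open>j \<noteq> i\<close> convexity guarantees this in the whole sector from
  \<open>\<theta> = - \<alpha>\<^sub>j\<close> to \<open>\<theta> = \<pi> - \<alpha>\<^sub>i\<close>: at its two borders the condition says that side \<open>i\<close> lies on the inner side
  of line \<open>j\<close>, and side \<open>j\<close> on the inner side of line \<open>i\<close>. So the integral for side \<open>j\<close> can be rotated to
  the ray \<open>\<theta> = \<pi> - \<alpha>\<^sub>i\<close> (\<open>rotate_to_side\<close>). On that ray the global relation turns the sum over
  \<open>j \<noteq> i\<close> into minus the density of side \<open>i\<close> itself.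

  What remains is the integral of the density of side \<open>i\<close> over its own ray minus that over the opposite
  ray. The reflection \<open>x \<mapsto> - x\<close>, which is \<open>k \<mapsto> - \<beta>\<^sup>2 / k\<close> when the side is real, leaves the
  exponentials on the side unchanged, fixes the coefficient of \<open>\<partial>\<^sub>n q\<^sub>i\<close> and changes the sign of that of
  \<open>q\<^sub>i\<close>. Hence \<open>\<partial>\<^sub>n q\<^sub>i\<close> cancels and \<open>q\<^sub>i\<close> is doubled (\<open>trace_jump\<close>). In the variable
  \<open>2\<beta>\<bar>\<Gamma>\<^sub>i\<bar> sinh x\<close> the outcome is the Fourier inversion formula for \<open>\<phi>\<close>, to which \<open>q\<^sub>i\<close> is applied
  (\<open>finite_order_fourier\<close>).
\<close>

section \<open>Integrals over the line\<close>

text \<open>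
  The function \<open>1 / (1 + x\<^sup>2)\<close> serves as majorant for the integrals over the line, and the
  value of its integral normalises the Poisson kernel in the proof of Fourier inversion.
\<close>

lemma integrable_inverse_one_plus_square:
    "integrable lborel (\<lambda>x::real. 1 / (1 + x\<^sup>2))"
  and integral_inverse_one_plus_square:
    "(LINT x|lborel. 1 / (1 + x\<^sup>2)) = pi"
proof -
  let ?f = "\<lambda>x::real. 1 / (1 + x\<^sup>2)"
  have *: "set_integrable lborel {0<..} ?f" "(LINT x:{0<..}|lborel. ?f x) = pi / 2"
    using integrable_I0i_1_div_plus_square LBINT_I0i_1_div_plus_square
    by (simp_all add: einterval_eq_Ici[of 0, folded zero_ereal_def] interval_lebesgue_integrable_def interval_lebesgue_integral_def)
  have hb: "has_bochner_integral lborel (\<lambda>x. indicator {0<..} x * ?f x) (pi / 2)"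
    using * by (simp add: set_integrable_def set_lebesgue_integral_def has_bochner_integral_iff)
  have hb': "has_bochner_integral lborel (\<lambda>x. indicator {0<..} (- x) * ?f (- x)) (pi / 2)"
    using lborel_has_bochner_integral_real_affine_iff[of "-1" "\<lambda>x. indicator {0<..} x * ?f x" "pi/2" 0] hb
    by simp
  have "has_bochner_integral lborel ?f (pi / 2 + pi / 2)"
  proof (subst has_bochner_integral_cong_AE)
    show "AE x in lborel. ?f x = indicator {0<..} x * ?f x + indicator {0<..} (- x) * ?f (- x)"
      using AE_lborel_singleton[of "0::real"]
    proof eventually_elim
      case (elim x) then show ?case by (cases "x > 0") (auto simp: indicator_def)
    qed
    show "has_bochner_integral lborel
      (\<lambda>x. indicator {0<..} x * ?f x + indicator {0<..} (- x) * ?f (- x)) (pi / 2 + pi / 2)"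
      by (intro has_bochner_integral_add hb hb')
  qed simp_all
  then show "integrable lborel ?f" "(LINT x|lborel. ?f x) = pi"
    by (simp_all add: has_bochner_integral_iff)
qed

lemma integrable_majorant: "integrable lborel (\<lambda>x::real. C * (1 / (1 + x\<^sup>2)))"
  by (intro integrable_mult_right integrable_inverse_one_plus_square)

lemma integrable_over_one_plus_square:
  fixes f :: "real \<Rightarrow> complex"
  assumes "f \<in> borel_measurable borel" and "\<And>x. norm (f x) \<le> C / (1 + x\<^sup>2)"
  shows "integrable lborel f"
proof (rule Bochner_Integration.integrable_bound)
  show "integrable lborel (\<lambda>x. C * (1 / (1 + x\<^sup>2)))" by (rule integrable_majorant)
  show "AE x in lborel. norm (f x) \<le> norm (C * (1 / (1 + x\<^sup>2)))"
    using order_trans[OF assms(2) abs_ge_self] by simp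
qed (use assms in auto)

lemma lborel_integral_substitution:
  fixes f :: "real \<Rightarrow> complex" and g h :: "real \<Rightarrow> real"
  assumes g: "\<And>x. (g has_field_derivative h x) (at x)" and "inj g" and S: "range g \<in> sets borel"
    and f: "f \<in> borel_measurable borel"
    and int: "integrable lborel (\<lambda>x. \<bar>h x\<bar> *\<^sub>R f (g x))"
  shows "(LINT t:range g|lborel. f t) = (LINT x|lborel. \<bar>h x\<bar> *\<^sub>R f (g x))"
proof -
  have meas: "(\<lambda>x. \<bar>h x\<bar> *\<^sub>R f (g x)) \<in> borel_measurable borel"
    using borel_measurable_integrable[OF int] by simp
  have "(\<lambda>x. \<bar>h x\<bar> *\<^sub>R f (g x)) absolutely_integrable_on UNIV"
    using int meas by (simp add: set_integrable_def integrable_completion)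
  moreover have "integral UNIV (\<lambda>x. \<bar>h x\<bar> *\<^sub>R f (g x)) = (LINT x|lborel. \<bar>h x\<bar> *\<^sub>R f (g x))"
    by (rule integral_lborel[OF int])
  ultimately have *: "f absolutely_integrable_on range g"
      "integral (range g) f = (LINT x|lborel. \<bar>h x\<bar> *\<^sub>R f (g x))"
    using has_absolute_integral_change_of_variables_real[of UNIV g h f
        "LINT x|lborel. \<bar>h x\<bar> *\<^sub>R f (g x)"] g \<open>inj g\<close> by auto
  have "(LINT t:range g|lborel. f t) = (LINT t:range g|lebesgue. f t)"
    unfolding set_lebesgue_integral_def using f S by (intro integral_completion[symmetric]) auto
  also have "\<dots> = integral (range g) f"
    using *(1) by (rule set_lebesgue_integral_eq_integral(2))
  finally show ?thesis using *(2) by simp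
qed

lemma Fubini_lborel_product_bound:
  fixes f :: "real \<Rightarrow> real \<Rightarrow> complex"
  assumes meas: "(\<lambda>(s, x). f s x) \<in> borel_measurable (lborel \<Otimes>\<^sub>M lborel)"
    and bound: "\<And>s x. norm (f s x) \<le> A s * B x"
    and A: "integrable lborel A" and B: "integrable lborel B"
  shows "(LINT s|lborel. LINT x|lborel. f s x) = (LINT x|lborel. LINT s|lborel. f s x)"
proof -
  have meas2: "f s \<in> borel_measurable lborel" for s
    using measurable_compose_Pair1[of s lborel "\<lambda>(s, x). f s x"] meas by simp
  have int2: "integrable lborel (f s)" for s
    by (rule Bochner_Integration.integrable_bound[of _ "\<lambda>x. A s * B x"])
      (use B meas2 order_trans[OF bound abs_ge_self] in auto)
  have "integrable (lborel \<Otimes>\<^sub>M lborel) (\<lambda>(s, x). f s x)"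
  proof (rule lborel_pair.Fubini_integrable[OF meas])
    show "AE s in lborel. integrable lborel (\<lambda>x. (\<lambda>(s, x). f s x) (s, x))"
      using int2 by simp
    show "integrable lborel (\<lambda>s. LINT x|lborel. norm ((\<lambda>(s, x). f s x) (s, x)))"
    proof (rule Bochner_Integration.integrable_bound[of _ "\<lambda>s. A s * (LINT x|lborel. B x)"])
      show "(\<lambda>s. LINT x|lborel. norm ((\<lambda>(s, x). f s x) (s, x))) \<in> borel_measurable lborel"
        using meas by measurable
      have "norm (LINT x|lborel. norm (f s x)) \<le> norm (A s * (LINT x|lborel. B x))" for s
      proof -
        have "(LINT x|lborel. norm (f s x)) \<le> (LINT x|lborel. A s * B x)"
          by (rule integral_mono) (use int2 B bound in auto)
        then show ?thesis by (simp add: integral_nonneg_AE)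
      qed
      then show "AE s in lborel. norm (LINT x|lborel. norm ((\<lambda>(s, x). f s x) (s, x)))
          \<le> norm (A s * (LINT x|lborel. B x))" by simp
    qed (use A in auto)
  qed
  from lborel_pair.Fubini_integral[of f, OF this] show ?thesis by simp
qed

lemma dominated_convergence_at_right_0:
  fixes s :: "real \<Rightarrow> real \<Rightarrow> complex"
  assumes meas: "f \<in> borel_measurable lborel" "\<And>e. s e \<in> borel_measurable lborel"
    and w: "integrable lborel w"
    and lim: "\<And>x. ((\<lambda>e. s e x) \<longlongrightarrow> f x) (at_right 0)"
    and bound: "\<forall>\<^sub>F e in at_right 0. \<forall>x. norm (s e x) \<le> w x"
  shows "((\<lambda>e. LINT x|lborel. s e x) \<longlongrightarrow> (LINT x|lborel. f x)) (at_right 0)"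
  unfolding filterlim_at_right_to_top
proof (rule integral_dominated_convergence_at_top[OF _ _ w])
  show "AE x in lborel. ((\<lambda>e. s (inverse e) x) \<longlongrightarrow> f x) at_top"
    using lim unfolding filterlim_at_right_to_top by simp
  show "\<forall>\<^sub>F e in at_top. AE x in lborel. norm (s (inverse e) x) \<le> w x"
    using bound unfolding eventually_at_right_to_top by (rule eventually_mono) simp
qed (use meas in auto)

lemma integral_Icc_eq_lborel:
  fixes f :: "real \<Rightarrow> 'a::euclidean_space"
  assumes "integrable lborel f"
  shows "integral {a..b} f = (LINT x|lborel. indicator {a..b} x *\<^sub>R f x)"
  using set_borel_integral_eq_integral(2)[of "{a..b}" f] integrable_mult_indicator[OF _ assms, of "{a..b}"]
  by (simp add: set_lebesgue_integral_def set_integrable_def)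

lemma integral_symmetric_interval_tendsto:
  fixes f :: "real \<Rightarrow> 'a::euclidean_space"
  assumes f: "integrable lborel f"
  shows "((\<lambda>r. integral {-r..r} f) \<longlongrightarrow> (LINT x|lborel. f x)) at_top"
proof -
  have [measurable]: "f \<in> borel_measurable lborel" by (rule borel_measurable_integrable[OF f])
  have "((\<lambda>r. LINT x|lborel. indicator {-r..r} x *\<^sub>R f x) \<longlongrightarrow> (LINT x|lborel. f x)) at_top"
  proof (rule integral_dominated_convergence_at_top[where w = "\<lambda>x. norm (f x)"])
    show "AE x in lborel. ((\<lambda>r. indicator {-r..r} x *\<^sub>R f x) \<longlongrightarrow> f x) at_top"
    proof (intro AE_I2 tendsto_eventually)
      fix x :: real
      show "\<forall>\<^sub>F r in at_top. indicator {-r..r} x *\<^sub>R f x = f x"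
        using eventually_ge_at_top[of "\<bar>x\<bar>"] by eventually_elim (auto simp: indicator_def)
    qed
    show "\<forall>\<^sub>F r in at_top. AE x in lborel. norm (indicator {-r..r} x *\<^sub>R f x) \<le> norm (f x)"
      by (intro always_eventually allI AE_I2) (auto simp: indicator_def)
    show "integrable lborel (\<lambda>x. norm (f x))" by (rule integrable_norm[OF f])
  qed measurable
  then show ?thesis by (simp only: integral_Icc_eq_lborel[OF f])
qed

text \<open>
  The tail of an integral is at most the tail of the integral of a majorant. For a family with a common
  majorant the truncation error is therefore uniform.
\<close>

lemma integral_outside_Icc_le:
  fixes f :: "real \<Rightarrow> complex"
  assumes f: "integrable lborel f" and w: "integrable lborel w" and le: "\<And>x. norm (f x) \<le> w x"
  shows "norm ((LINT x|lborel. f x) - integral {a..b} f) \<le> (LINT x|lborel. w x) - integral {a..b} w"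
proof -
  have ind: "integrable lborel (\<lambda>x. indicator {a..b} x *\<^sub>R h x)" if "integrable lborel h"
    for h :: "real \<Rightarrow> 'a::euclidean_space"
    by (rule integrable_mult_indicator[OF _ that]) simp
  have eqf: "(LINT x|lborel. f x) - integral {a..b} f = (LINT x|lborel. f x - indicator {a..b} x *\<^sub>R f x)"
    unfolding integral_Icc_eq_lborel[OF f]
    by (rule Bochner_Integration.integral_diff[symmetric, OF f ind[OF f]])
  have eqw: "(LINT x|lborel. w x) - integral {a..b} w = (LINT x|lborel. w x - indicator {a..b} x *\<^sub>R w x)"
    unfolding integral_Icc_eq_lborel[OF w]
    by (rule Bochner_Integration.integral_diff[symmetric, OF w ind[OF w]])
  have "(LINT x|lborel. norm (f x - indicator {a..b} x *\<^sub>R f x))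
      \<le> (LINT x|lborel. w x - indicator {a..b} x *\<^sub>R w x)"
    by (intro Bochner_Integration.integral_mono integrable_norm Bochner_Integration.integrable_diff f w ind)
      (use le in \<open>auto simp: indicator_def\<close>)
  then show ?thesis unfolding eqf eqw by (rule order_trans[OF integral_norm_bound])
qed

section \<open>Distributions on the unit interval\<close>

text \<open>
  A smooth function is carried along with the sequence of its derivatives. For concrete functions the
  derivatives are known in closed form, so that estimates of semi-norms do not require any computation with
  \<open>nth_deriv_on\<close>.
\<close>

definition deriv_chain :: "real set \<Rightarrow> (nat \<Rightarrow> real \<Rightarrow> complex) \<Rightarrow> bool"
  where "deriv_chain S g \<longleftrightarrow>
    (\<forall>n. \<forall>t\<in>S. (g n has_vector_derivative g (Suc n) t) (at t within S))"

lemma deriv_chain_subset: "deriv_chain S g \<Longrightarrow> R \<subseteq> S \<Longrightarrow> deriv_chain R g"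
  unfolding deriv_chain_def by (meson has_vector_derivative_within_subset subsetD)

lemma deriv_chain_cmult: "deriv_chain S g \<Longrightarrow> deriv_chain S (\<lambda>n t. c * g n t)"
  unfolding deriv_chain_def by (auto intro: has_vector_derivative_mult_right)

lemma deriv_chain_add:
  "deriv_chain S f \<Longrightarrow> deriv_chain S g \<Longrightarrow> deriv_chain S (\<lambda>n t. f n t + g n t)"
  unfolding deriv_chain_def by (auto intro: has_vector_derivative_add)

lemma nth_deriv_on_chain:
  assumes g: "deriv_chain S g" and S: "\<And>t. t \<in> S \<Longrightarrow> t islimpt S" and "t \<in> S"
  shows "nth_deriv_on S n (g 0) t = g n t"
  using \<open>t \<in> S\<close>
proof (induction n arbitrary: t)
  case 0
  then show ?case by (simp add: nth_deriv_on_def)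
next
  case (Suc n)
  have "(nth_deriv_on S n (g 0) has_vector_derivative g (Suc n) t) (at t within S)"
    using g Suc.prems Suc.IH by (metis (lifting) deriv_chain_def has_vector_derivative_transform)
  then have "vector_derivative (nth_deriv_on S n (g 0)) (at t within S) = g (Suc n) t"
    using S[OF Suc.prems] by (intro vector_derivative_within) (auto simp: trivial_limit_within)
  then show ?case by (simp add: nth_deriv_on_def)
qed

lemma deriv_chain_imp_smooth:
  assumes g: "deriv_chain S g" and S: "\<And>t. t \<in> S \<Longrightarrow> t islimpt S"
  shows "smooth_on_real S (g 0)"
  unfolding smooth_on_real_def
proof (intro allI)
  fix n
  have "(nth_deriv_on S n (g 0) has_vector_derivative g (Suc n) t) (at t within S)" if "t \<in> S" for t
    using g that nth_deriv_on_chain[OF assms]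
    by (metis (lifting) deriv_chain_def has_vector_derivative_transform)
  then show "nth_deriv_on S n (g 0) differentiable_on S"
    unfolding differentiable_on_def using differentiableI_vector by blast
qed

lemma smooth_imp_deriv_chain:
  assumes "smooth_on_real S f"
  shows "deriv_chain S (\<lambda>n. nth_deriv_on S n f)"
  using assms unfolding deriv_chain_def smooth_on_real_def differentiable_on_def
  by (simp add: nth_deriv_on_def vector_derivative_works)

lemma unit_interval_islimpt: "t \<in> {0..1} \<Longrightarrow> t islimpt {0..1::real}"
  by (simp add: islimpt_Icc)

lemma deriv_chain_in_E01: "deriv_chain {0..1} g \<Longrightarrow> g 0 \<in> E01"
  unfolding E01_def using deriv_chain_imp_smooth unit_interval_islimpt by blast

text \<open>
  This is the form in which continuity of a distribution is used. Integration against a test function also has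
  this property, so that what is shown below for Laplace transforms of distributions applies to test
  functions, too.
\<close>

definition finite_order :: "((real \<Rightarrow> complex) \<Rightarrow> complex) \<Rightarrow> nat \<Rightarrow> real \<Rightarrow> bool"
  where "finite_order T N C \<longleftrightarrow> 0 \<le> C \<and>
    (\<forall>f\<in>E01. \<forall>g\<in>E01. T (\<lambda>t. f t + g t) = T f + T g) \<and>
    (\<forall>c. \<forall>f\<in>E01. T (\<lambda>t. c * f t) = c * T f) \<and>
    (\<forall>g B. deriv_chain {0..1} g \<longrightarrow> (\<forall>m\<le>N. \<forall>t\<in>{0..1}. norm (g m t) \<le> B) \<longrightarrow> norm (T (g 0)) \<le> C * B)"

text \<open>
  The preimage of the open unit disc contains a basic neighbourhood of \<open>0\<close>, which restricts only
  finitely many semi-norms. Scaling a function into this neighbourhood gives the bound.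
\<close>

lemma E01_dual_finite_order:
  assumes T: "T \<in> E01_dual"
  obtains N C where "finite_order T N C"
proof -
  from T have add: "\<forall>f\<in>E01. \<forall>g\<in>E01. T (\<lambda>t. f t + g t) = T f + T g"
    and scale: "\<forall>c. \<forall>f\<in>E01. T (\<lambda>t. c * f t) = c * T f"
    and cont: "continuous_map (seminorm_topology E01 E01_seminorm) euclidean T"
    unfolding E01_dual_def topological_dual_def by blast+
  have z: "(\<lambda>t. 0) \<in> E01"
    using deriv_chain_in_E01[of "\<lambda>n t. 0"] by (simp add: deriv_chain_def)
  have T0: "T (\<lambda>t. 0) = 0" using bspec[OF spec[OF scale, of 0] z] by simp
  have openU: "openin (seminorm_topology E01 E01_seminorm) {f \<in> E01. T f \<in> ball 0 1}"
    using openin_continuous_map_preimage[OF cont, of "ball 0 1"] by simp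
  obtain F e where F: "finite F" "e > 0"
    "{g \<in> E01. \<forall>i\<in>F. E01_seminorm i (\<lambda>t. g t - 0) < e} \<subseteq> {f \<in> E01. T f \<in> ball 0 1}"
  proof -
    have 0: "(\<lambda>t. 0) \<in> {f \<in> E01. T f \<in> ball 0 1}" using z T0 by simp
    from bspec[OF conjunct2[OF openU[unfolded openin_seminorm_topology]] 0]
    show thesis by (elim exE conjE) (rule that)
  qed
  obtain N where N: "\<And>i. i \<in> F \<Longrightarrow> i \<le> N"
    using F(1) by (meson finite_nat_set_iff_bounded_le)
  have pos: "norm (T (g 0)) \<le> 2 / e * B"
    if g: "deriv_chain {0..1} g" and B: "\<forall>m\<le>N. \<forall>t\<in>{0..1}. norm (g m t) \<le> B" and "B > 0" for g B
  proof -
    define c where "c = e / (2 * B)"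
    have c: "c > 0" using F(2) \<open>B > 0\<close> by (simp add: c_def)
    have cB: "c * B = e / 2" using \<open>B > 0\<close> by (simp add: c_def)
    let ?g = "\<lambda>n t. of_real c * g n t"
    have ch: "deriv_chain {0..1} ?g" by (rule deriv_chain_cmult[OF g])
    have "E01_seminorm i (?g 0) < e" if "i \<in> F" for i
    proof -
      have "E01_seminorm i (?g 0) \<le> e / 2"
        unfolding E01_seminorm_def
      proof (rule cSUP_least)
        fix t :: real assume t: "t \<in> {0..1}"
        have "c * norm (g i t) \<le> c * B" using B N[OF \<open>i \<in> F\<close>] t c by simp
        then show "norm (nth_deriv_on {0..1} i (?g 0) t) \<le> e / 2"
          using nth_deriv_on_chain[OF ch unit_interval_islimpt t, of i] c cB by (simp add: norm_mult)
      qed simp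
      then show ?thesis using F(2) by simp
    qed
    then have "norm (T (?g 0)) < 1"
      using F(3) deriv_chain_in_E01[OF ch] by auto
    moreover have "T (?g 0) = of_real c * T (g 0)"
      using scale deriv_chain_in_E01[OF g] by blast
    ultimately have "c * norm (T (g 0)) < 1" using c by (simp add: norm_mult)
    then show ?thesis using F(2) \<open>B > 0\<close> by (simp add: c_def field_simps)
  qed
  have "norm (T (g 0)) \<le> 2 / e * B"
    if g: "deriv_chain {0..1} g" and B: "\<forall>m\<le>N. \<forall>t\<in>{0..1}. norm (g m t) \<le> B" for g B
  proof (rule field_le_epsilon)
    fix d :: real assume "d > 0"
    have "B \<ge> 0" using B[rule_format, of 0 0] order_trans[OF norm_ge_zero] by auto
    have "d * e / 2 > 0" using \<open>d > 0\<close> F(2) by simp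
    have "norm (T (g 0)) \<le> 2 / e * (B + d * e / 2)"
      using g B \<open>d * e / 2 > 0\<close> \<open>B \<ge> 0\<close> by (intro pos) fastforce+
    also have "\<dots> = 2 / e * B + d" using F(2) by (simp add: field_simps)
    finally show "norm (T (g 0)) \<le> 2 / e * B + d" .
  qed
  then have "finite_order T N (2 / e)"
    unfolding finite_order_def using add scale F(2) by simp
  then show thesis by (rule that)
qed

context
  fixes T :: "(real \<Rightarrow> complex) \<Rightarrow> complex" and N :: nat and C :: real
  assumes T: "finite_order T N C"
begin

lemma finite_order_nonneg: "C \<ge> 0" using T by (simp add: finite_order_def)

lemma finite_order_add:
  "f \<in> E01 \<Longrightarrow> g \<in> E01 \<Longrightarrow> T (\<lambda>t. f t + g t) = T f + T g"
  using T by (simp add: finite_order_def)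

lemma finite_order_scale: "f \<in> E01 \<Longrightarrow> T (\<lambda>t. c * f t) = c * T f"
  using T by (simp add: finite_order_def)

lemma finite_order_bound:
  assumes "deriv_chain {0..1} g" "\<And>m t. m \<le> N \<Longrightarrow> t \<in> {0..1} \<Longrightarrow> norm (g m t) \<le> B"
  shows "norm (T (g 0)) \<le> C * B"
  using T assms unfolding finite_order_def by blast

end

lemma poly_in_E01: "(\<lambda>t. poly p (of_real t)) \<in> E01"
proof -
  have "((\<lambda>x. poly ((pderiv ^^ n) p) (of_real x)) has_vector_derivative
      poly ((pderiv ^^ Suc n) p) (of_real t)) (at t within {0..1})" for n and t :: real
    using has_vector_derivative_real_field[OF poly_DERIV[of "(pderiv ^^ n) p" "of_real t"]] by simp
  then have "deriv_chain {0..1} (\<lambda>n t. poly ((pderiv ^^ n) p) (of_real t))"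
    by (simp add: deriv_chain_def)
  from deriv_chain_in_E01[OF this] show ?thesis by simp
qed

lemma finite_order_poly:
  assumes T: "finite_order T N C"
  shows "T (\<lambda>t. \<Sum>k<K. c k * of_real t ^ k) = (\<Sum>k<K. c k * T (\<lambda>t. of_real t ^ k))"
proof (induction K)
  case 0
  have "(\<lambda>t. 0) \<in> E01" using poly_in_E01[of 0] by simp
  from finite_order_scale[OF T this, of 0] show ?case by simp
next
  case (Suc K)
  have p: "(\<lambda>t. of_real t ^ K) \<in> E01" for K
    using poly_in_E01[of "monom 1 K"] by (simp add: poly_monom)
  have cp: "(\<lambda>t. c K * of_real t ^ K) \<in> E01" for K
    using poly_in_E01[of "monom (c K) K"] by (simp add: poly_monom)
  have s: "(\<lambda>t. \<Sum>k<K. c k * of_real t ^ k) \<in> E01"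
    using poly_in_E01[of "\<Sum>k<K. monom (c k) k"] by (simp add: poly_sum poly_monom)
  show ?case using finite_order_add[OF T s cp] finite_order_scale[OF T p, of "c K" K] Suc by simp
qed

subsection \<open>Remainder of the exponential series\<close>

definition exp_rem :: "nat \<Rightarrow> 'a::{real_normed_field,banach} \<Rightarrow> 'a"
  where "exp_rem K z = exp z - (\<Sum>k<K. z ^ k / fact k)"

lemma exp_sums: "(\<lambda>k. z ^ k / fact k) sums exp (z::'a::{real_normed_field,banach})"
  using exp_converges[of z] by (simp add: scaleR_conv_of_real field_simps)

lemma exp_rem_suminf: "exp_rem K z = (\<Sum>k. z ^ (k + K) / fact (k + K))"
  using suminf_minus_initial_segment[OF sums_summable[OF exp_sums[of z]], of K]
    sums_unique[OF exp_sums[of z]] by (simp add: exp_rem_def)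

lemma norm_exp_rem_le:
  fixes z :: complex and R :: real
  assumes "norm z \<le> R"
  shows "norm (exp_rem K z) \<le> exp_rem K R"
  unfolding exp_rem_suminf
proof (rule norm_suminf_le)
  show "summable (\<lambda>k. R ^ (k + K) / fact (k + K))"
    using summable_ignore_initial_segment[OF sums_summable[OF exp_sums[of R]], of K] .
  show "norm (z ^ (k + K) / fact (k + K)) \<le> R ^ (k + K) / fact (k + K)" for k
    using power_mono[OF assms norm_ge_zero, of "k + K"]
    by (simp add: norm_divide norm_power divide_right_mono)
qed

lemma exp_rem_antimono:
  fixes R :: real
  assumes "K \<le> L" "R \<ge> 0" shows "exp_rem L R \<le> exp_rem K R"
proof -
  have "(\<Sum>k<K. R ^ k / fact k) \<le> (\<Sum>k<L. R ^ k / fact k)"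
    using assms by (intro sum_mono2) auto
  then show ?thesis by (simp add: exp_rem_def)
qed

lemma exp_rem_tendsto_0: "(\<lambda>K. exp_rem (K - N) (R::real)) \<longlonglongrightarrow> 0"
proof -
  have "(\<lambda>K. exp_rem K R) \<longlonglongrightarrow> exp R - exp R"
    unfolding exp_rem_def using exp_sums[of R] by (intro tendsto_intros) (simp add: sums_def)
  then have "(\<lambda>K. exp_rem (K + N - N) R) \<longlonglongrightarrow> 0" by simp
  then show ?thesis by (rule LIMSEQ_offset)
qed

lemma exp_rem_has_field_derivative:
  "(exp_rem K has_field_derivative exp_rem (K - 1) z) (at (z::complex))"
proof (cases K)
  case 0
  moreover have "exp_rem 0 = (exp :: complex \<Rightarrow> complex)" by (simp add: exp_rem_def fun_eq_iff)
  ultimately show ?thesis by simp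
next
  case (Suc L)
  have "((\<lambda>z. \<Sum>k<Suc L. z ^ k / fact k) has_field_derivative (\<Sum>k<L. z ^ k / fact k)) (at z)"
  proof (induction L)
    case (Suc L)
    have "(of_nat (Suc L) :: complex) \<noteq> 0" by (rule of_nat_neq_0)
    then have "((\<lambda>z. z ^ Suc L / fact (Suc L)) has_field_derivative z ^ L / fact L) (at z)"
      by (auto intro!: derivative_eq_intros simp del: power_Suc)
    from DERIV_add[OF Suc this] show ?case by simp
  qed simp
  moreover have "exp_rem (Suc L) = (\<lambda>z::complex. exp z - (\<Sum>k<Suc L. z ^ k / fact k))"
    by (simp only: exp_rem_def fun_eq_iff simp_thms)
  ultimately show ?thesis
    using DERIV_diff[OF DERIV_exp, of "\<lambda>z. \<Sum>k<Suc L. z ^ k / fact k" _ z]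
    by (simp only: Suc exp_rem_def diff_Suc_1)
qed

text \<open>
  Each differentiation multiplies by \<open>a\<close> and removes one term from the Taylor polynomial. So the
  derivatives of the remainder are remainders again, and the exponential series converges on the unit interval
  together with all derivatives.
\<close>

lemma exp_rem_chain: "deriv_chain S (\<lambda>m t. a ^ m * exp_rem (K - m) (a * of_real t))"
  unfolding deriv_chain_def
proof (intro allI ballI)
  fix m t
  have "((\<lambda>x. exp_rem (K - m) (a * x)) has_field_derivative exp_rem (K - Suc m) (a * of_real t) * a)
      (at (of_real t))"
    by (rule DERIV_chain2[OF exp_rem_has_field_derivative[of "K - m", simplified]])
      (auto intro!: derivative_eq_intros)
  from has_vector_derivative_real_field[OF DERIV_cmult[OF this, of "a ^ m"]]
  show "((\<lambda>t. a ^ m * exp_rem (K - m) (a * of_real t)) has_vector_derivative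
      a ^ Suc m * exp_rem (K - Suc m) (a * of_real t)) (at t within S)"
    by (simp add: algebra_simps)
qed

lemma exp_chain: "deriv_chain S (\<lambda>m t. a ^ m * exp (a * of_real t))"
  using exp_rem_chain[of S a 0] by (simp add: exp_rem_def)

lemma norm_exp_rem_unit_interval:
  fixes a :: complex
  assumes "norm a \<le> R" "t \<in> {0..1}"
  shows "norm (exp_rem K (a * of_real t)) \<le> exp_rem K R"
proof (rule norm_exp_rem_le)
  have "norm a * \<bar>t\<bar> \<le> R * 1" using assms order_trans[OF norm_ge_zero assms(1)] by (intro mult_mono) auto
  then show "norm (a * complex_of_real t) \<le> R" by (simp add: norm_mult)
qed

lemma exp_rem_bound:
  fixes a :: complex
  assumes "norm a \<le> R" "t \<in> {0..1}" "m \<le> N"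
  shows "norm (a ^ m * exp_rem (K - m) (a * of_real t)) \<le> (1 + R) ^ N * exp_rem (K - N) R"
proof -
  have R: "R \<ge> 0" using assms(1) norm_ge_zero[of a] by linarith
  have "norm a ^ m \<le> (1 + R) ^ m" using assms R by (intro power_mono) auto
  also have "\<dots> \<le> (1 + R) ^ N" using assms R by (intro power_increasing) auto
  finally have 1: "norm a ^ m \<le> (1 + R) ^ N" .
  have 2: "norm (exp_rem (K - m) (a * of_real t)) \<le> exp_rem (K - N) R"
    using norm_exp_rem_unit_interval[OF assms(1,2)] exp_rem_antimono[of "K - N" "K - m" R] assms(3) R
    by (meson diff_le_mono2 order_trans)
  show ?thesis using mult_mono[OF 1 2] R by (simp add: norm_mult norm_power)
qed

subsection \<open>The Laplace transform of a distribution\<close>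

definition laplace :: "((real \<Rightarrow> complex) \<Rightarrow> complex) \<Rightarrow> complex \<Rightarrow> complex"
  where "laplace T a = T (\<lambda>t. exp (a * of_real t))"

lemma exp_in_E01: "(\<lambda>t. exp (a * of_real t)) \<in> E01"
  using deriv_chain_in_E01[OF exp_chain[of _ a]] by simp

text \<open>
  The bound tends to \<open>0\<close> as \<open>K\<close> grows and is uniform for \<open>a\<close> in a disc.
  It makes \<open>laplace T\<close> a convergent power series, and it allows exchanging \<open>T\<close> with
  integrals over \<open>a\<close>, because polynomials pose no problem there.
\<close>

lemma laplace_remainder:
  assumes T: "finite_order T N C" and "norm a \<le> R"
  shows "norm (laplace T a - (\<Sum>k<K. a ^ k / fact k * T (\<lambda>t. of_real t ^ k)))
    \<le> C * ((1 + R) ^ N * exp_rem (K - N) R)"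
proof -
  let ?p = "\<lambda>t. \<Sum>k<K. a ^ k / fact k * of_real t ^ k"
  have p: "?p \<in> E01"
    using poly_in_E01[of "\<Sum>k<K. monom (a ^ k / fact k) k"] by (simp add: poly_sum poly_monom)
  have mp: "(\<lambda>t. -1 * ?p t) \<in> E01"
    using poly_in_E01[of "- (\<Sum>k<K. monom (a ^ k / fact k) k)"] by (simp add: poly_sum poly_monom)
  have "T (\<lambda>t. exp (a * of_real t) + -1 * ?p t) = laplace T a - T ?p"
    using finite_order_add[OF T exp_in_E01 mp] finite_order_scale[OF T p, of "-1"]
    by (simp add: laplace_def)
  moreover have "(\<lambda>t. exp (a * of_real t) + -1 * ?p t) = (\<lambda>t. exp_rem K (a * of_real t))"
    by (simp add: exp_rem_def power_mult_distrib)
  moreover have "norm (T (\<lambda>t. exp_rem K (a * of_real t))) \<le> C * ((1 + R) ^ N * exp_rem (K - N) R)"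
    using finite_order_bound[OF T exp_rem_chain[of _ a K] exp_rem_bound[OF \<open>norm a \<le> R\<close>]] by simp
  moreover have "T ?p = (\<Sum>k<K. a ^ k / fact k * T (\<lambda>t. of_real t ^ k))"
    by (rule finite_order_poly[OF T])
  ultimately show ?thesis by simp
qed

lemma laplace_sums:
  assumes T: "finite_order T N C"
  shows "(\<lambda>k. T (\<lambda>t. of_real t ^ k) / fact k * a ^ k) sums laplace T a"
proof -
  have "(\<lambda>K. C * ((1 + norm a) ^ N * exp_rem (K - N) (norm a))) \<longlonglongrightarrow> C * ((1 + norm a) ^ N * 0)"
    by (intro tendsto_intros exp_rem_tendsto_0)
  then have lim: "(\<lambda>K. C * ((1 + norm a) ^ N * exp_rem (K - N) (norm a))) \<longlonglongrightarrow> 0" by simp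
  have "(\<lambda>K. laplace T a - (\<Sum>k<K. a ^ k / fact k * T (\<lambda>t. of_real t ^ k))) \<longlonglongrightarrow> 0"
    by (rule Lim_null_comparison[OF always_eventually[OF allI[OF laplace_remainder[OF T order_refl]]] lim])
  from tendsto_diff[OF tendsto_const[of "laplace T a"] this]
  show ?thesis by (simp add: sums_def field_simps)
qed

lemma laplace_entire:
  assumes T: "finite_order T N C"
  shows "laplace T field_differentiable at a"
proof -
  have eq: "laplace T = (\<lambda>a. \<Sum>k. T (\<lambda>t. of_real t ^ k) / fact k * a ^ k)"
    using sums_unique[OF laplace_sums[OF T]] by auto
  have "(laplace T has_field_derivative
      (\<Sum>n. diffs (\<lambda>k. T (\<lambda>t. of_real t ^ k) / fact k) n * a ^ n)) (at a)"
    unfolding eq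
    by (rule termdiffs_strong_converges_everywhere) (rule sums_summable[OF laplace_sums[OF T]])
  then show ?thesis unfolding field_differentiable_def by (rule exI)
qed

lemma laplace_holomorphic:
  assumes T: "finite_order T N C"
  shows "laplace T holomorphic_on S"
  unfolding holomorphic_on_def using field_differentiable_at_within[OF laplace_entire[OF T]] by simp

lemma laplace_bound:
  assumes T: "finite_order T N C"
  shows "norm (laplace T a) \<le> C * ((1 + norm a) ^ N * max 1 (exp (Re a)))"
proof -
  have "norm (a ^ m * exp (a * of_real t)) \<le> (1 + norm a) ^ N * max 1 (exp (Re a))"
    if "m \<le> N" "t \<in> {0..1}" for m t
  proof -
    have "norm a ^ m \<le> (1 + norm a) ^ m" by (intro power_mono) auto
    also have "\<dots> \<le> (1 + norm a) ^ N" using that by (intro power_increasing) auto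
    finally have 1: "norm a ^ m \<le> (1 + norm a) ^ N" .
    have "Re a * t \<le> max 0 (Re a)"
    proof (cases "Re a \<ge> 0")
      case True
      then show ?thesis using that mult_left_mono[of t 1 "Re a"] by simp
    next
      case False
      then show ?thesis using that by (simp add: mult_nonpos_nonneg)
    qed
    then have 2: "exp (Re a * t) \<le> max 1 (exp (Re a))"
      by (simp add: le_max_iff_disj max_def split: if_splits)
    show ?thesis using mult_mono[OF 1 2] by (simp add: norm_mult norm_power)
  qed
  from finite_order_bound[OF T exp_chain this] show ?thesis by (simp add: laplace_def)
qed

section \<open>Test functions and Fourier inversion\<close>

text \<open>
  The extensions by zero of the functions in \<open>S01\<close>, together with their derivatives.
\<close>

definition test_chain :: "(nat \<Rightarrow> real \<Rightarrow> complex) \<Rightarrow> bool"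
  where "test_chain g \<longleftrightarrow> deriv_chain UNIV g \<and> (\<forall>n. \<forall>t. t \<notin> {0<..<1} \<longrightarrow> g n t = 0)"

lemma test_chain_continuous: "test_chain g \<Longrightarrow> continuous_on S (g n)"
  unfolding test_chain_def deriv_chain_def
  by (meson UNIV_I continuous_at_imp_continuous_on has_vector_derivative_continuous)

lemma test_chain_bounded:
  assumes "test_chain g"
  shows "\<exists>B. \<forall>t. norm (g n t) \<le> B"
proof -
  have "compact (g n ` {0..1})"
    by (intro compact_continuous_image test_chain_continuous[OF assms]) simp
  then obtain B where B: "\<And>t. t \<in> {0..1} \<Longrightarrow> norm (g n t) \<le> B"
    using compact_imp_bounded bounded_iff by (metis (no_types, lifting) imageI)
  have "norm (g n t) \<le> max B 0" for t
  proof (cases "t \<in> {0..1}")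
    case True then show ?thesis using B[of t] by simp
  next
    case False
    then have "t \<notin> {0<..<1}" by auto
    then have "g n t = 0" using assms unfolding test_chain_def by blast
    then show ?thesis by simp
  qed
  then show ?thesis by blast
qed

lemma has_vector_derivative_zero_quadratic:
  fixes f :: "real \<Rightarrow> complex"
  assumes "\<And>s. norm (f s - f t) \<le> K * (s - t)\<^sup>2"
  shows "(f has_vector_derivative 0) (at t)"
  unfolding has_vector_derivative_def
proof (rule has_derivativeI_sandwich[where e = 1 and H = "\<lambda>s. K * \<bar>s - t\<bar>"])
  show "((\<lambda>s. K * \<bar>s - t\<bar>) \<longlongrightarrow> 0) (at t)"
    by (auto intro!: tendsto_eq_intros)
  show "norm (f s - f t - (s - t) *\<^sub>R 0) / norm (s - t) \<le> K * \<bar>s - t\<bar>" if "s \<noteq> t" for s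
    using assms[of s] that by (simp add: field_simps power2_eq_square)
qed (auto simp: bounded_linear_zero)

text \<open>
  Only the end points need an argument. Each derivative is bounded by a multiple of \<open>\<tau>\<^sup>2 (1 -
  \<tau>)\<^sup>2\<close>, so the extension by zero vanishes there to second order.
\<close>

lemma S01_test_chain:
  assumes "\<phi> \<in> S01"
  obtains g where "test_chain g" "g 0 = zero_extension \<phi>"
proof -
  define d where "d n = nth_deriv_on {0<..<1} n \<phi>" for n
  define g where "g n = zero_extension (d n)" for n
  from assms have sm: "smooth_on_real {0<..<1} \<phi>" and
    bd: "\<And>m n. bdd_above ((\<lambda>\<tau>. norm (d n \<tau>) / (\<tau> ^ m * (1 - \<tau>) ^ m)) ` {0<..<1})"
    by (auto simp: S01_def d_def)
  have ch: "deriv_chain {0<..<1} d"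
    using smooth_imp_deriv_chain[OF sm] by (simp add: d_def[abs_def])
  have out: "g n t = 0" if "t \<notin> {0<..<1}" for n t
    using that by (auto simp: g_def zero_extension_def)
  have quad: "\<exists>K\<ge>0. \<forall>s. norm (g n s) \<le> K * s\<^sup>2 \<and> norm (g n s) \<le> K * (s - 1)\<^sup>2" for n
  proof -
    obtain K where K: "\<And>s. s \<in> {0<..<1} \<Longrightarrow> norm (d n s) / (s ^ 2 * (1 - s) ^ 2) \<le> K"
      using bd[of n 2] unfolding bdd_above_def by blast
    have "0 \<le> norm (d n (1/2)) / ((1/2) ^ 2 * (1 - 1/2) ^ 2)" by simp
    also have "\<dots> \<le> K" by (rule K) simp
    finally have K0: "K \<ge> 0" .
    have "norm (g n s) \<le> K * s\<^sup>2 \<and> norm (g n s) \<le> K * (s - 1)\<^sup>2" for s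
    proof (cases "s \<in> {0<..<1}")
      case True
      then have "s ^ 2 * (1 - s) ^ 2 > 0" by simp
      then have *: "norm (d n s) \<le> K * (s ^ 2 * (1 - s) ^ 2)"
        using K[OF True] by (simp add: pos_divide_le_eq)
      have "s\<^sup>2 \<le> 1" "(1 - s)\<^sup>2 \<le> 1" using True by (simp_all add: power_le_one)
      then have "s ^ 2 * (1 - s) ^ 2 \<le> s ^ 2" "s ^ 2 * (1 - s) ^ 2 \<le> (1 - s) ^ 2"
        by (simp_all add: mult_left_le mult_left_le_one_le)
      then have "K * (s ^ 2 * (1 - s) ^ 2) \<le> K * s ^ 2" "K * (s ^ 2 * (1 - s) ^ 2) \<le> K * (1 - s) ^ 2"
        using K0 by (simp_all only: mult_left_mono)
      with * True show ?thesis
        by (auto simp: g_def zero_extension_def power2_commute[of 1 s])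
    next
      case False
      then show ?thesis using out K0 by simp
    qed
    then show ?thesis using K0 by blast
  qed
  have "(g n has_vector_derivative g (Suc n) t) (at t)" for n t
  proof -
    consider "t \<in> {0<..<1}" | "t < 0 \<or> t > 1" | "t = 0 \<or> t = 1" by fastforce
    then show ?thesis
    proof cases
      case 1
      then have "(d n has_vector_derivative d (Suc n) t) (at t)"
        using ch unfolding deriv_chain_def by (metis at_within_open open_greaterThanLessThan)
      then have "(d n has_vector_derivative g (Suc n) t) (at t)"
        using 1 by (simp add: g_def zero_extension_def)
      then show ?thesis
        by (rule has_vector_derivative_transform_within_open[where S = "{0<..<1}"])
          (use 1 in \<open>auto simp: g_def zero_extension_def\<close>)
    next
      case 2
      have "((\<lambda>_. 0) has_vector_derivative g (Suc n) t) (at t)"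
        using out[of t "Suc n"] 2 by fastforce
      then show ?thesis
        by (rule has_vector_derivative_transform_within_open[where S = "- {0..1}"])
          (use 2 out in \<open>auto simp: open_Compl\<close>)
    next
      case 3
      obtain K where K: "\<forall>s. norm (g n s) \<le> K * s\<^sup>2 \<and> norm (g n s) \<le> K * (s - 1)\<^sup>2"
        using quad by blast
      have "(g n has_vector_derivative 0) (at t)"
        by (rule has_vector_derivative_zero_quadratic[where K = K]) (use 3 K out in auto)
      then show ?thesis using 3 out by auto
    qed
  qed
  then have "test_chain g"
    using out by (simp add: test_chain_def deriv_chain_def)
  moreover have "g 0 = zero_extension \<phi>" by (simp add: g_def d_def nth_deriv_on_def)
  ultimately show thesis by (rule that)
qed

lemma lborel_integral_eq_unit_interval:
  fixes f :: "real \<Rightarrow> complex"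
  assumes "continuous_on {0..1} f" and "\<And>t. t \<notin> {0..1} \<Longrightarrow> f t = 0"
  shows "integrable lborel f" "(LINT t|lborel. f t) = integral {0..1} f"
proof -
  have eq: "(\<lambda>t. indicator {0..1} t *\<^sub>R f t) = f"
    using assms(2) by (auto simp: fun_eq_iff indicator_def)
  have s: "set_integrable lborel {0..1} f" by (rule borel_integrable_atLeastAtMost'[OF assms(1)])
  then show "integrable lborel f" by (simp add: set_integrable_def eq)
  show "(LINT t|lborel. f t) = integral {0..1} f"
    using set_borel_integral_eq_integral(2)[OF s] by (simp add: set_lebesgue_integral_def eq)
qed

definition integral_functional :: "(real \<Rightarrow> complex) \<Rightarrow> (real \<Rightarrow> complex) \<Rightarrow> complex"
  where "integral_functional f h = (LINT t|lborel. f t * h t)"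

lemma E01_continuous: "h \<in> E01 \<Longrightarrow> continuous_on {0..1} h"
proof -
  assume "h \<in> E01"
  then have "nth_deriv_on {0..1} 0 h differentiable_on {0..1}"
    unfolding E01_def smooth_on_real_def by blast
  then show ?thesis by (simp add: nth_deriv_on_def differentiable_imp_continuous_on)
qed

lemma integral_functional_finite_order:
  assumes f: "continuous_on UNIV f" and out: "\<And>t. t \<notin> {0<..<1} \<Longrightarrow> f t = 0"
    and C: "\<And>t. norm (f t) \<le> C"
  shows "finite_order (integral_functional f) 0 C"
proof -
  have C0: "C \<ge> 0" using C[of 0] order_trans[OF norm_ge_zero] by blast
  have int: "integrable lborel (\<lambda>t. f t * h t)" if "h \<in> E01" for h
    by (rule lborel_integral_eq_unit_interval(1))
      (auto intro!: continuous_intros E01_continuous[OF that] continuous_on_subset[OF f] simp: out)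
  have bound: "norm (integral_functional f (g 0)) \<le> C * B"
    if g: "deriv_chain {0..1} g" and B: "\<forall>m\<le>0. \<forall>t\<in>{0..1}. norm (g m t) \<le> B" for g B
  proof -
    have B0: "B \<ge> 0" using B[rule_format, of 0 0] order_trans[OF norm_ge_zero] by auto
    have "norm (integral_functional f (g 0)) \<le> (LINT t|lborel. norm (f t * g 0 t))"
      unfolding integral_functional_def by (rule integral_norm_bound)
    also have "\<dots> \<le> (LINT t::real|lborel. indicator {0..1} t * (C * B))"
    proof (rule Bochner_Integration.integral_mono)
      show "integrable lborel (\<lambda>t. norm (f t * g 0 t))"
        by (intro integrable_norm int[OF deriv_chain_in_E01[OF g]])
      show "norm (f t * g 0 t) \<le> indicator {0..1} t * (C * B)" for t
        using B out[of t] C0 mult_mono[OF C[of t], of "norm (g 0 t)" B]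
        by (auto simp: norm_mult indicator_def)
    qed simp
    finally show ?thesis by simp
  qed
  show ?thesis
    unfolding finite_order_def
  proof (intro conjI ballI allI impI)
    show "integral_functional f (\<lambda>t. h t + k t) = integral_functional f h + integral_functional f k"
      if "h \<in> E01" "k \<in> E01" for h k
      using int[OF that(1)] int[OF that(2)] by (simp add: integral_functional_def distrib_left)
    show "integral_functional f (\<lambda>t. c * h t) = c * integral_functional f h" for c h
    proof -
      have "(\<lambda>t. f t * (c * h t)) = (\<lambda>t. c * (f t * h t))" by (simp add: mult.left_commute)
      then show ?thesis by (simp add: integral_functional_def)
    qed
  qed (use C0 bound in auto)
qed

text \<open>
  For imaginary \<open>a\<close> this is the Fourier transform. Complex values of \<open>a\<close> occur when
  contours are rotated.
\<close>

definition hat :: "(real \<Rightarrow> complex) \<Rightarrow> complex \<Rightarrow> complex"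
  where "hat f a = (LINT t|lborel. f t * exp (a * of_real t))"

lemma hat_eq_laplace: "hat f = laplace (integral_functional f)"
  by (simp add: hat_def[abs_def] laplace_def[abs_def] integral_functional_def)

lemma test_chain_finite_order:
  assumes "test_chain g"
  obtains C where "finite_order (integral_functional (g n)) 0 C"
proof -
  obtain B where "\<And>t. norm (g n t) \<le> B" using test_chain_bounded[OF assms, of n] by blast
  from integral_functional_finite_order[OF test_chain_continuous[OF assms] _ this] assms
  show thesis by (intro that) (simp add: test_chain_def)
qed

lemma hat_holomorphic:
  assumes "test_chain g" shows "hat (g n) holomorphic_on S"
proof -
  obtain C where "finite_order (integral_functional (g n)) 0 C"
    using test_chain_finite_order[OF assms] .
  from laplace_holomorphic[OF this] show ?thesis by (simp add: hat_eq_laplace)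
qed

lemma hat_continuous: "test_chain g \<Longrightarrow> continuous_on S (hat (g n))"
  by (rule holomorphic_on_imp_continuous_on) (rule hat_holomorphic)

text \<open>
  Integration by parts; there are no boundary terms, as \<open>g n\<close> vanishes at both end points.
\<close>

lemma hat_deriv:
  assumes g: "test_chain g"
  shows "a * hat (g n) a = - hat (g (Suc n)) a"
proof -
  let ?F = "\<lambda>t. g n t * exp (a * of_real t)"
  let ?G = "\<lambda>t. g (Suc n) t * exp (a * of_real t)"
  have out: "g m t = 0" if "t \<notin> {0<..<1}" for m t using g that by (auto simp: test_chain_def)
  note [continuous_intros] = test_chain_continuous[OF g]
  have 1: "(\<integral>t. ?F t \<partial>lborel) = integral {0..1} ?F" "(\<integral>t. ?G t \<partial>lborel) = integral {0..1} ?G"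
    by (rule lborel_integral_eq_unit_interval(2); auto intro!: continuous_intros simp: out)+
  have "(?F has_vector_derivative (a * ?F t + ?G t)) (at t within {0..1})" for t
  proof -
    have "(g n has_vector_derivative g (Suc n) t) (at t)"
      using g unfolding test_chain_def deriv_chain_def by simp
    moreover have "((\<lambda>t. exp (a * of_real t)) has_vector_derivative a * exp (a * of_real t)) (at t)"
      using exp_chain[of UNIV a, unfolded deriv_chain_def, THEN spec[of _ 0]] by simp
    ultimately have "(?F has_vector_derivative
        (g n t * (a * exp (a * of_real t)) + g (Suc n) t * exp (a * of_real t))) (at t)"
      by (rule has_vector_derivative_mult)
    then have "(?F has_vector_derivative (a * ?F t + ?G t)) (at t)" by (simp add: algebra_simps)
    then show ?thesis by (rule has_vector_derivative_at_within)
  qed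
  from fundamental_theorem_of_calculus[OF _ this]
  have "((\<lambda>t. a * ?F t + ?G t) has_integral 0) {0..1}"
    by (simp add: out)
  then have "integral {0..1} (\<lambda>t. a * ?F t + ?G t) = 0" by (rule integral_unique)
  moreover have "integral {0..1} (\<lambda>t. a * ?F t + ?G t) = a * integral {0..1} ?F + integral {0..1} ?G"
    by (subst Henstock_Kurzweil_Integration.integral_add)
      (auto intro!: integrable_continuous_real continuous_intros)
  ultimately show ?thesis by (simp add: hat_def 1 eq_neg_iff_add_eq_0)
qed

lemma hat_power: "test_chain g \<Longrightarrow> (- a) ^ m * hat (g 0) a = hat (g m) a"
proof (induction m)
  case (Suc m)
  then show ?case using hat_deriv[of g a m] by (simp add: mult.assoc minus_equation_iff)
qed simp

lemma hat_decay:
  assumes g: "test_chain g"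
  shows "\<exists>K\<ge>0. \<forall>a. norm a ^ m * norm (hat (g 0) a) \<le> K * max 1 (exp (Re a))"
proof -
  obtain C where C: "finite_order (integral_functional (g m)) 0 C"
    using test_chain_finite_order[OF g] .
  have "norm a ^ m * norm (hat (g 0) a) \<le> C * max 1 (exp (Re a))" for a
  proof -
    have "norm a ^ m * norm (hat (g 0) a) = norm (hat (g m) a)"
      by (simp add: hat_power[OF g, of a m, symmetric] norm_mult norm_power)
    also have "\<dots> \<le> C * max 1 (exp (Re a))"
      using laplace_bound[OF C, of a] by (simp add: hat_eq_laplace)
    finally show ?thesis .
  qed
  then show ?thesis using finite_order_nonneg[OF C] by blast
qed

lemma exp_decay_bound:
  fixes d :: real
  assumes "d > 0"
  obtains C where "C > 0" "\<And>k. exp (- (d * \<bar>k\<bar>)) \<le> C / (1 + k\<^sup>2)"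
proof -
  define C where "C = max 1 (2 / d\<^sup>2)"
  have C: "C \<ge> 1" "C * (d\<^sup>2 / 2) \<ge> 1"
  proof -
    have "2 / d\<^sup>2 * (d\<^sup>2 / 2) \<le> C * (d\<^sup>2 / 2)" unfolding C_def by (intro mult_right_mono) auto
    then show "C * (d\<^sup>2 / 2) \<ge> 1" using assms by simp
  qed (simp add: C_def)
  have "exp (- (d * \<bar>k\<bar>)) \<le> C / (1 + k\<^sup>2)" for k
  proof -
    have "1 + k\<^sup>2 \<le> C * 1 + C * (d\<^sup>2 / 2) * k\<^sup>2"
      using C mult_right_mono[OF C(2), of "k\<^sup>2"] by (intro add_mono) auto
    also have "\<dots> = C * (1 + (d * \<bar>k\<bar>)\<^sup>2 / 2)" by (simp add: algebra_simps power_mult_distrib)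
    also have "\<dots> \<le> C * exp (d * \<bar>k\<bar>)"
    proof (rule mult_left_mono)
      have "1 + d * \<bar>k\<bar> + (d * \<bar>k\<bar>)\<^sup>2 / 2 \<le> exp (d * \<bar>k\<bar>)"
        by (rule exp_lower_Taylor_quadratic) (use assms in simp)
      then show "1 + (d * \<bar>k\<bar>)\<^sup>2 / 2 \<le> exp (d * \<bar>k\<bar>)"
        using assms mult_nonneg_nonneg[of d "\<bar>k\<bar>"] by linarith
    qed (use C in simp)
    finally have "1 + k\<^sup>2 \<le> C * exp (d * \<bar>k\<bar>)" .
    moreover have "1 + k\<^sup>2 > 0" by (simp add: add_pos_nonneg)
    ultimately show ?thesis by (simp add: exp_minus field_simps)
  qed
  then show thesis using that[of C] C by simp
qed

lemma half_line_exp_integral: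
  assumes "Re c > 0"
  shows "has_bochner_integral lborel (\<lambda>k. indicator {0<..} k *\<^sub>R exp (- c * of_real k)) (1 / c)"
proof -
  obtain C where C: "C > 0" "\<And>k. exp (- (Re c * \<bar>k\<bar>)) \<le> C / (1 + k\<^sup>2)"
    using exp_decay_bound[OF assms] by blast
  have int: "integrable lborel (\<lambda>k. indicator {0<..} k *\<^sub>R exp (- c * of_real k))"
  proof (rule integrable_over_one_plus_square)
    show "norm (indicator {0<..} k *\<^sub>R exp (- c * of_real k)) \<le> C / (1 + k\<^sup>2)" for k
      using C(2)[of k] C(1) by (auto simp: indicator_def add_nonneg_nonneg)
  qed measurable
  have "c \<noteq> 0" using assms by auto
  have "(LBINT k=0..\<infinity>. exp (- c * of_real k)) = 0 - (- 1 / c)"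
  proof (rule interval_integral_FTC_integrable)
    show "((\<lambda>k. - exp (- c * of_real k) / c) has_vector_derivative exp (- c * of_real k)) (at k)" for k
    proof -
      have "((\<lambda>z. - exp (- c * z) / c) has_field_derivative exp (- c * of_real k)) (at (of_real k))"
        using \<open>c \<noteq> 0\<close> by (auto intro!: derivative_eq_intros)
      then show ?thesis by (rule has_vector_derivative_real_field)
    qed
    show "set_integrable lborel (einterval 0 \<infinity>) (\<lambda>k. exp (- c * of_real k))"
      using int by (simp add: set_integrable_def einterval_eq_Ici[of 0, folded zero_ereal_def])
    show "(((\<lambda>k. - exp (- c * of_real k) / c) \<circ> real_of_ereal) \<longlongrightarrow> - 1 / c) (at_right 0)"
      unfolding zero_ereal_def ereal_tendsto_simps
      using \<open>c \<noteq> 0\<close> by (auto intro!: tendsto_eq_intros)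
    have "((\<lambda>k. C / (1 + k\<^sup>2)) \<longlongrightarrow> 0) at_top"
      by (rule real_tendsto_divide_at_top[OF tendsto_const])
        (intro filterlim_tendsto_add_at_top[OF tendsto_const] filterlim_pow_at_top filterlim_ident; simp)
    then have "((\<lambda>k. exp (- c * of_real k)) \<longlongrightarrow> 0) at_top"
    proof (rule Lim_null_comparison[rotated])
      show "\<forall>\<^sub>F k in at_top. norm (exp (- c * of_real k)) \<le> C / (1 + k\<^sup>2)"
        using eventually_ge_at_top[of 0]
      proof eventually_elim
        case (elim k) then show ?case using C(2)[of k] by simp
      qed
    qed
    then have "((\<lambda>k. - exp (- c * of_real k) / c) \<longlongrightarrow> - 0 / c) at_top"
      using \<open>c \<noteq> 0\<close> by (intro tendsto_intros)
    then show "(((\<lambda>k. - exp (- c * of_real k) / c) \<circ> real_of_ereal) \<longlongrightarrow> 0) (at_left \<infinity>)"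
      unfolding ereal_tendsto_simps by simp
  qed (auto intro!: continuous_intros)
  then have "(LINT k|lborel. indicator {0<..} k *\<^sub>R exp (- c * of_real k)) = 1 / c"
    by (simp add: interval_lebesgue_integral_def set_lebesgue_integral_def
        einterval_eq_Ici[of 0, folded zero_ereal_def])
  with int show ?thesis by (simp add: has_bochner_integral_iff)
qed

lemma poisson_kernel:
  assumes "d > 0"
  shows "has_bochner_integral lborel (\<lambda>k. exp (\<i> * of_real k * of_real u) * of_real (exp (- (d * \<bar>k\<bar>))))
    (of_real (2 * d / (d\<^sup>2 + u\<^sup>2)))"
proof -
  let ?h = "\<lambda>c k. indicator {0<..} k *\<^sub>R exp (- c * complex_of_real k)"
  let ?c = "Complex d (- u)" and ?c' = "Complex d u"
  have 1: "has_bochner_integral lborel (?h ?c) (1 / ?c)"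
    by (rule half_line_exp_integral) (use assms in simp)
  have "has_bochner_integral lborel (?h ?c') (1 / ?c')"
    by (rule half_line_exp_integral) (use assms in simp)
  then have 2: "has_bochner_integral lborel (\<lambda>k. ?h ?c' (- k)) (1 / ?c')"
    using lborel_has_bochner_integral_real_affine_iff[of "-1" "?h ?c'" "1 / ?c'" 0] by simp
  have "has_bochner_integral lborel (\<lambda>k. exp (\<i> * of_real k * of_real u) * of_real (exp (- (d * \<bar>k\<bar>))))
      (1 / ?c + 1 / ?c')"
  proof (subst has_bochner_integral_cong_AE)
    show "has_bochner_integral lborel (\<lambda>k. ?h ?c k + ?h ?c' (- k)) (1 / ?c + 1 / ?c')"
      by (rule has_bochner_integral_add[OF 1 2])
    show "AE k in lborel. exp (\<i> * of_real k * of_real u) * of_real (exp (- (d * \<bar>k\<bar>)))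
        = ?h ?c k + ?h ?c' (- k)"
      using AE_lborel_singleton[of "0::real"]
    proof eventually_elim
      case (elim k)
      have "exp (\<i> * of_real k * of_real u) * of_real (exp (- (d * \<bar>k\<bar>)))
          = exp (\<i> * of_real k * of_real u - of_real (d * \<bar>k\<bar>))"
        by (simp add: exp_of_real[symmetric] exp_add[symmetric])
      moreover have "\<i> * of_real k * of_real u - of_real (d * \<bar>k\<bar>)
          = (if k > 0 then - ?c * of_real k else - ?c' * of_real (- k))"
        by (auto simp: complex_eq_iff)
      ultimately show ?case using elim by (simp add: indicator_def)
    qed
  qed simp_all
  moreover have "1 / ?c + 1 / ?c' = of_real (2 * d / (d\<^sup>2 + u\<^sup>2))"
  proof -
    have "d\<^sup>2 + u\<^sup>2 \<noteq> 0" using assms by (simp add: add_pos_nonneg less_imp_neq[symmetric])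
    moreover have "?c \<noteq> 0" "?c' \<noteq> 0" using assms by (auto simp: complex_eq_iff)
    moreover have "?c * ?c' = of_real (d\<^sup>2 + u\<^sup>2)" by (simp add: complex_eq_iff power2_eq_square)
    moreover have "?c + ?c' = of_real (2 * d)" by (simp add: complex_eq_iff)
    moreover have "1 / ?c + 1 / ?c' = (?c' + ?c) / (?c * ?c')"
      using calculation(2,3) by (simp only: add_frac_eq mult_1_left mult_1_right not_False_eq_True)
    ultimately show ?thesis by (simp only: add.commute of_real_divide)
  qed
  ultimately show ?thesis by simp
qed

text \<open>
  With the convergence factor \<open>exp (- d\<bar>k\<bar>)\<close> the inversion integral becomes the
  convolution of \<open>f\<close> with the Poisson kernel, which after scaling is the integral of \<open>2 f
  (x + dr) / (1 + r\<^sup>2)\<close>. Both expressions converge as \<open>d\<close> tends to \<open>0\<close>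
  by domination.
\<close>

theorem fourier_inversion:
  fixes f :: "real \<Rightarrow> complex"
  assumes cont: "continuous_on UNIV f" and out: "\<And>t. t \<notin> {0<..<1} \<Longrightarrow> f t = 0"
    and B: "\<And>t. norm (f t) \<le> B"
    and K: "\<And>k. norm (hat f (\<i> * of_real k)) \<le> K / (1 + k\<^sup>2)"
    and hat_meas: "(\<lambda>k. hat f (\<i> * of_real k)) \<in> borel_measurable borel"
  shows "(LINT k|lborel. hat f (\<i> * of_real k) * exp (- \<i> * of_real k * of_real x)) = 2 * of_real pi * f x"
proof -
  have [measurable]: "f \<in> borel_measurable borel" using cont by (rule borel_measurable_continuous_onI)
  note hat_meas[measurable]
  have B0: "B \<ge> 0" using B[of 0] order_trans[OF norm_ge_zero] by blast
  define I where "I d = (LINT k|lborel. hat f (\<i> * of_real k) * exp (- \<i> * of_real k * of_real x)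
      * of_real (exp (- (d * \<bar>k\<bar>))))" for d
  have "(I \<longlongrightarrow> (LINT k|lborel. hat f (\<i> * of_real k) * exp (- \<i> * of_real k * of_real x))) (at_right 0)"
    unfolding I_def[abs_def]
  proof (rule dominated_convergence_at_right_0[where w = "\<lambda>k. K * (1 / (1 + k\<^sup>2))"])
    show "integrable lborel (\<lambda>k. K * (1 / (1 + k\<^sup>2)))"
      by (rule integrable_majorant)
    show "((\<lambda>d. hat f (\<i> * of_real k) * exp (- \<i> * of_real k * of_real x) * of_real (exp (- (d * \<bar>k\<bar>))))
        \<longlongrightarrow> hat f (\<i> * of_real k) * exp (- \<i> * of_real k * of_real x)) (at_right 0)" for k
      by (auto intro!: tendsto_eq_intros)
    show "\<forall>\<^sub>F d in at_right 0. \<forall>k. norm (hat f (\<i> * of_real k) * exp (- \<i> * of_real k * of_real x)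
        * of_real (exp (- (d * \<bar>k\<bar>)))) \<le> K * (1 / (1 + k\<^sup>2))"
      unfolding eventually_at_right_field
    proof (intro exI[of _ 1] conjI allI impI)
      fix d k :: real assume "0 < d"
      have "norm (hat f (\<i> * of_real k)) * exp (- (d * \<bar>k\<bar>)) \<le> K / (1 + k\<^sup>2) * 1"
        using K \<open>0 < d\<close> order_trans[OF norm_ge_zero K] by (intro mult_mono) auto
      then show "norm (hat f (\<i> * of_real k) * exp (- \<i> * of_real k * of_real x)
          * of_real (exp (- (d * \<bar>k\<bar>)))) \<le> K * (1 / (1 + k\<^sup>2))"
        by (simp add: norm_mult)
    qed simp
  qed measurable
  moreover have "(I \<longlongrightarrow> (LINT r|lborel. f x * of_real (2 * (1 / (1 + r\<^sup>2))))) (at_right 0)"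
  proof (rule Lim_transform_eventually)
    show "((\<lambda>d. LINT r|lborel. f (x + d * r) * of_real (2 * (1 / (1 + r\<^sup>2))))
        \<longlongrightarrow> (LINT r|lborel. f x * of_real (2 * (1 / (1 + r\<^sup>2))))) (at_right 0)"
    proof (rule dominated_convergence_at_right_0[where w = "\<lambda>r. B * 2 * (1 / (1 + r\<^sup>2))"])
      show "integrable lborel (\<lambda>r. B * 2 * (1 / (1 + r\<^sup>2)))"
        by (rule integrable_majorant)
      have "isCont f x" using cont by (simp add: continuous_on_eq_continuous_at)
      then show "((\<lambda>d. f (x + d * r) * of_real (2 * (1 / (1 + r\<^sup>2))))
          \<longlongrightarrow> f x * of_real (2 * (1 / (1 + r\<^sup>2)))) (at_right 0)" for r
        by (intro tendsto_mult tendsto_const isCont_tendsto_compose[of x f])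
          (auto intro!: tendsto_eq_intros)
      show "\<forall>\<^sub>F d in at_right 0. \<forall>r. norm (f (x + d * r) * of_real (2 * (1 / (1 + r\<^sup>2))))
          \<le> B * 2 * (1 / (1 + r\<^sup>2))"
      proof (intro always_eventually allI)
        fix d r
        have "norm (f (x + d * r)) * (2 / (1 + r\<^sup>2)) \<le> B * (2 / (1 + r\<^sup>2))"
          by (intro mult_right_mono B) simp
        moreover have "norm (complex_of_real (2 * (1 / (1 + r\<^sup>2)))) = 2 / (1 + r\<^sup>2)"
          unfolding norm_of_real by simp
        ultimately show "norm (f (x + d * r) * of_real (2 * (1 / (1 + r\<^sup>2)))) \<le> B * 2 * (1 / (1 + r\<^sup>2))"
          unfolding norm_mult by simp
      qed
    qed measurable
    show "\<forall>\<^sub>F d in at_right 0. (LINT r|lborel. f (x + d * r) * of_real (2 * (1 / (1 + r\<^sup>2)))) = I d"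
      unfolding eventually_at_right_field
    proof (intro exI[of _ 1] conjI allI impI)
      fix d :: real assume d: "0 < d"
      obtain C where C: "C > 0" "\<And>k. exp (- (d * \<bar>k\<bar>)) \<le> C / (1 + k\<^sup>2)"
        using exp_decay_bound[OF d] by blast
      have "I d = (LINT k|lborel. LINT s|lborel. f s * (exp (\<i> * of_real k * of_real (s - x))
          * of_real (exp (- (d * \<bar>k\<bar>)))))"
        unfolding I_def hat_def integral_mult_left_zero[symmetric]
        by (intro Bochner_Integration.integral_cong refl) (simp add: exp_add[symmetric] algebra_simps exp_diff exp_minus divide_inverse)
      also have "\<dots> = (LINT s|lborel. LINT k|lborel. f s * (exp (\<i> * of_real k * of_real (s - x))
          * of_real (exp (- (d * \<bar>k\<bar>)))))"
      proof (rule Fubini_lborel_product_bound[symmetric])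
        show "integrable lborel (\<lambda>s. norm (f s))"
          by (intro integrable_norm lborel_integral_eq_unit_interval(1) continuous_on_subset[OF cont])
            (auto simp: out)
        show "integrable lborel (\<lambda>k. C * (1 / (1 + k\<^sup>2)))"
          by (rule integrable_majorant)
        show "norm (f s * (exp (\<i> * of_real k * of_real (s - x)) * of_real (exp (- (d * \<bar>k\<bar>)))))
          \<le> norm (f s) * (C * (1 / (1 + k\<^sup>2)))" for s k
          using mult_left_mono[OF C(2)[of k] norm_ge_zero[of "f s"]] by (simp add: norm_mult)
      qed measurable
      also have "\<dots> = (LINT s|lborel. f s * of_real (2 * d / (d\<^sup>2 + (s - x)\<^sup>2)))"
        unfolding integral_mult_right_zero has_bochner_integral_integral_eq[OF poisson_kernel[OF d]] ..
      also have "\<dots> = \<bar>d\<bar> *\<^sub>R (LINT r|lborel. f (x + d * r) * of_real (2 * d / (d\<^sup>2 + (x + d * r - x)\<^sup>2)))"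
        by (rule lborel_integral_real_affine) (use d in simp)
      also have "\<dots> = (LINT r|lborel. f (x + d * r) * of_real (2 * (1 / (1 + r\<^sup>2))))"
      proof -
        have "d *\<^sub>R (f (x + d * r) * of_real (2 * d / (d\<^sup>2 + (x + d * r - x)\<^sup>2)))
            = f (x + d * r) * of_real (2 * (1 / (1 + r\<^sup>2)))" for r
        proof -
          have "d\<^sup>2 + (x + d * r - x)\<^sup>2 = d\<^sup>2 * (1 + r\<^sup>2)" by (simp add: algebra_simps power_mult_distrib)
          moreover have "1 + r\<^sup>2 > 0" by (simp add: add_pos_nonneg)
          ultimately have "d * (2 * d / (d\<^sup>2 + (x + d * r - x)\<^sup>2)) = 2 * (1 / (1 + r\<^sup>2))"
            using d by (simp add: power2_eq_square)
          then show ?thesis by (metis mult.left_commute of_real_mult scaleR_conv_of_real)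
        qed
        then show ?thesis using d by (simp flip: integral_scaleR_right)
      qed
      finally show "(LINT r|lborel. f (x + d * r) * of_real (2 * (1 / (1 + r\<^sup>2)))) = I d" ..
    qed simp
  qed
  ultimately have "(LINT k|lborel. hat f (\<i> * of_real k) * exp (- \<i> * of_real k * of_real x))
      = (LINT r|lborel. f x * of_real (2 * (1 / (1 + r\<^sup>2))))"
    by (intro tendsto_unique[of "at_right (0::real)" I]) auto
  also have "\<dots> = f x * (LINT r|lborel. of_real (2 * (1 / (1 + r\<^sup>2))))"
    by (rule integral_mult_right_zero)
  also have "\<dots> = f x * of_real (LINT r|lborel. 2 * (1 / (1 + r\<^sup>2)))"
    by (simp only: integral_complex_of_real)
  also have "\<dots> = 2 * of_real pi * f x"
    unfolding integral_mult_right_zero integral_inverse_one_plus_square by simp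
  finally show ?thesis .
qed

subsection \<open>Distributions commute with superposition of exponentials\<close>

lemma deriv_chain_integral:
  fixes G :: "nat \<Rightarrow> real \<Rightarrow> real \<Rightarrow> complex"
  assumes ch: "\<And>k. deriv_chain UNIV (\<lambda>m. G m k)"
    and cont: "\<And>m. continuous_on UNIV (\<lambda>(k, t). G m k t)"
  shows "deriv_chain UNIV (\<lambda>m t. integral {a..b} (\<lambda>k. G m k t))"
  unfolding deriv_chain_def
proof (intro allI ballI)
  fix m t
  have c: "continuous_on S (\<lambda>p. G n (f p) (g p))" if "continuous_on S f" "continuous_on S g"
    for n and f g :: "'a::topological_space \<Rightarrow> real" and S
    using continuous_on_compose2[OF cont[of n], of S "\<lambda>p. (f p, g p)"] that
    by (auto intro!: continuous_intros)
  have "((\<lambda>t. integral (cbox a b) (\<lambda>k. G m k t)) has_vector_derivative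
      integral (cbox a b) (\<lambda>k. G (Suc m) k t)) (at t within UNIV)"
  proof (rule leibniz_rule_vector_derivative)
    show "((\<lambda>t. G m k t) has_vector_derivative G (Suc m) k t) (at t within UNIV)" for k t
      using ch unfolding deriv_chain_def by blast
    show "(\<lambda>k. G m k t) integrable_on cbox a b" for t
      unfolding cbox_interval
      by (intro integrable_continuous_real c continuous_on_id continuous_on_const)
    show "continuous_on (UNIV \<times> cbox a b) (\<lambda>(t, k). G (Suc m) k t)"
      unfolding split_beta by (intro c continuous_on_fst continuous_on_snd continuous_on_id)
  qed auto
  then show "((\<lambda>t. integral {a..b} (\<lambda>k. G m k t)) has_vector_derivative
      integral {a..b} (\<lambda>k. G (Suc m) k t)) (at t within UNIV)" by simp
qed

lemma continuous_on_exp_rem: "continuous_on S (exp_rem K :: complex \<Rightarrow> complex)"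
  using exp_rem_has_field_derivative DERIV_isCont continuous_at_imp_continuous_on by blast

text \<open>
  If the exponential is replaced by a Taylor polynomial, \<open>T\<close> acts on a polynomial with integrals
  as coefficients, and the two sides agree. The errors made on both sides tend to \<open>0\<close>.
\<close>

lemma finite_order_exp_integral:
  fixes c :: "real \<Rightarrow> complex"
  assumes T: "finite_order T N C" and c: "continuous_on UNIV c" and "a \<le> b"
  shows "T (\<lambda>t. integral {a..b} (\<lambda>k. c k * exp (- \<i> * of_real k * of_real t)))
    = integral {a..b} (\<lambda>k. c k * laplace T (- \<i> * of_real k))"
proof -
  define e where "e k = - \<i> * complex_of_real k" for k
  define R where "R = max \<bar>a\<bar> \<bar>b\<bar>"
  have e: "norm (e k) \<le> R" if "k \<in> {a..b}" for k
    using that by (auto simp: e_def R_def norm_mult)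
  have R0: "R \<ge> 0" by (simp add: R_def)
  have ce: "continuous_on S e" for S unfolding e_def by (intro continuous_intros)
  obtain M where M: "\<And>k. k \<in> {a..b} \<Longrightarrow> norm (c k) \<le> M" and M0: "M \<ge> 0"
  proof -
    have "compact (c ` {a..b})"
      by (intro compact_continuous_image continuous_on_subset[OF c]) auto
    then obtain M where "\<And>k. k \<in> {a..b} \<Longrightarrow> norm (c k) \<le> M"
      using compact_imp_bounded bounded_iff by (metis (no_types, lifting) imageI)
    then show thesis using that[of "max M 0"] by (simp add: le_max_iff_disj)
  qed
  let ?W = "\<lambda>K m t. integral {a..b} (\<lambda>k. c k * (e k ^ m * exp_rem (K - m) (e k * of_real t)))"
  let ?E = "\<lambda>K. (1 + R) ^ N * exp_rem (K - N) R"
  have chW: "deriv_chain UNIV (?W K)" for K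
  proof (rule deriv_chain_integral)
    show "deriv_chain UNIV (\<lambda>m t. c k * (e k ^ m * exp_rem (K - m) (e k * of_real t)))" for k
      by (intro deriv_chain_cmult exp_rem_chain)
    show "continuous_on UNIV (\<lambda>(k, t). c k * (e k ^ m * exp_rem (K - m) (e k * of_real t)))" for m
      unfolding split_beta
      by (intro continuous_on_mult continuous_on_power continuous_on_compose2[OF c]
          continuous_on_compose2[OF ce[of UNIV]] continuous_on_compose2[OF continuous_on_exp_rem[of UNIV]]
          continuous_intros) auto
  qed
  have WE: "norm (T (?W K 0)) \<le> C * ((b - a) * (M * ?E K))" for K
  proof (rule finite_order_bound[OF T])
    show "deriv_chain {0..1} (?W K)" using chW deriv_chain_subset by blast
    fix m t assume mt: "m \<le> N" "t \<in> {0..1::real}"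
    have "norm (?W K m t) \<le> M * ?E K * (b - a)"
    proof (rule integral_bound[OF \<open>a \<le> b\<close>])
      show "continuous_on {a..b} (\<lambda>k. c k * (e k ^ m * exp_rem (K - m) (e k * of_real t)))"
        by (intro continuous_on_mult continuous_on_power continuous_on_subset[OF c] ce
            continuous_on_compose2[OF continuous_on_exp_rem[of UNIV]] continuous_intros) auto
      show "norm (c k * (e k ^ m * exp_rem (K - m) (e k * of_real t))) \<le> M * ?E K" if "k \<in> {a..b}" for k
        using mult_mono[OF M[OF that] exp_rem_bound[OF e[OF that] mt(2,1), of K] M0 norm_ge_zero]
        by (simp add: norm_mult)
    qed
    then show "norm (?W K m t) \<le> (b - a) * (M * ?E K)" by (simp add: mult.commute)
  qed
  define A where "A l = integral {a..b} (\<lambda>k. c k * (e k ^ l / fact l))" for l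
  let ?U = "\<lambda>t. integral {a..b} (\<lambda>k. c k * exp (e k * of_real t))"
  have intA: "(\<lambda>k. c k * (e k ^ l / fact l)) integrable_on {a..b}" for l
    by (intro integrable_continuous_real continuous_on_mult continuous_on_divide continuous_on_power
        continuous_on_subset[OF c] ce continuous_intros) auto
  have sumint: "integral {a..b} (\<lambda>k. \<Sum>l<K. c k * (e k ^ l / fact l) * d l) = (\<Sum>l<K. A l * d l)" for K d
    unfolding A_def
    by (subst Henstock_Kurzweil_Integration.integral_sum[OF finite_lessThan integrable_on_mult_left[OF intA]])
      (simp only: integral_mult_left)
  have W0: "?W K 0 = (\<lambda>t. ?U t + (\<Sum>l<K. - A l * of_real t ^ l))" for K
  proof
    fix t :: real
    have "(\<Sum>l<K. - A l * of_real t ^ l) = - integral {a..b} (\<lambda>k. \<Sum>l<K. c k * (e k ^ l / fact l) * of_real t ^ l)"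
      unfolding sumint by (simp add: sum_negf)
    moreover have "integral {a..b} (\<lambda>k. c k * (e k ^ 0 * exp_rem (K - 0) (e k * of_real t)))
       = integral {a..b} (\<lambda>k. c k * exp (e k * of_real t) - (\<Sum>l<K. c k * (e k ^ l / fact l) * of_real t ^ l))"
      by (intro integral_cong)
        (simp add: exp_rem_def right_diff_distrib sum_distrib_left power_mult_distrib mult.assoc)
    moreover have "\<dots> = ?U t - integral {a..b} (\<lambda>k. \<Sum>l<K. c k * (e k ^ l / fact l) * of_real t ^ l)"
      by (intro Henstock_Kurzweil_Integration.integral_diff integrable_sum integrable_on_mult_left intA
          integrable_continuous_real continuous_on_mult continuous_on_subset[OF c] continuous_on_exp ce
          continuous_intros) auto
    ultimately show "?W K 0 t = ?U t + (\<Sum>l<K. - A l * of_real t ^ l)" by simp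
  qed
  have UE: "?U \<in> E01"
    using deriv_chain_in_E01[OF deriv_chain_subset[OF chW[of 0]]] by (simp add: exp_rem_def)
  have TW: "T (?W K 0) = T ?U - (\<Sum>l<K. A l * T (\<lambda>t. of_real t ^ l))" for K
  proof -
    have "(\<lambda>t. \<Sum>l<K. - A l * of_real t ^ l) \<in> E01"
      using poly_in_E01[of "\<Sum>l<K. monom (- A l) l"] by (simp add: poly_sum poly_monom)
    from finite_order_add[OF T UE this] show ?thesis
      unfolding W0 using finite_order_poly[OF T, of "\<lambda>l. - A l" K] by (simp add: sum_negf)
  qed
  let ?I = "integral {a..b} (\<lambda>k. c k * laplace T (e k))"
  have cl: "continuous_on S (laplace T)" for S
    by (rule holomorphic_on_imp_continuous_on[OF laplace_holomorphic[OF T]])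
  have intL: "(\<lambda>k. c k * laplace T (e k)) integrable_on {a..b}"
    by (intro integrable_continuous_real continuous_on_mult continuous_on_subset[OF c]
       continuous_on_compose2[OF cl[of UNIV]] ce) auto
  have IE: "norm (?I - (\<Sum>l<K. A l * T (\<lambda>t. of_real t ^ l))) \<le> C * ((b - a) * (M * ?E K))" for K
  proof -
    let ?r = "\<lambda>k. laplace T (e k) - (\<Sum>l<K. e k ^ l / fact l * T (\<lambda>t. of_real t ^ l))"
    have "(\<Sum>l<K. A l * T (\<lambda>t. of_real t ^ l))
        = integral {a..b} (\<lambda>k. \<Sum>l<K. c k * (e k ^ l / fact l) * T (\<lambda>t. of_real t ^ l))"
      by (rule sumint[symmetric])
    then have "?I - (\<Sum>l<K. A l * T (\<lambda>t. of_real t ^ l)) = integral {a..b} (\<lambda>k. c k * laplace T (e k)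
        - (\<Sum>l<K. c k * (e k ^ l / fact l) * T (\<lambda>t. of_real t ^ l)))"
      by (simp only: Henstock_Kurzweil_Integration.integral_diff[OF intL
          integrable_sum[OF finite_lessThan integrable_on_mult_left[OF intA]]])
    also have "\<dots> = integral {a..b} (\<lambda>k. c k * ?r k)"
      by (simp only: right_diff_distrib sum_distrib_left mult.assoc)
    finally have "?I - (\<Sum>l<K. A l * T (\<lambda>t. of_real t ^ l)) = integral {a..b} (\<lambda>k. c k * ?r k)" .
    moreover have "norm (integral {a..b} (\<lambda>k. c k * ?r k)) \<le> M * (C * ?E K) * (b - a)"
    proof (rule integral_bound[OF \<open>a \<le> b\<close>])
      show "continuous_on {a..b} (\<lambda>k. c k * ?r k)"
        by (intro continuous_on_mult continuous_on_diff continuous_on_sum continuous_on_divide continuous_on_power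
            continuous_on_subset[OF c] continuous_on_compose2[OF cl[of UNIV]] ce continuous_intros) auto
      show "norm (c k * ?r k) \<le> M * (C * ?E K)" if "k \<in> {a..b}" for k
        using mult_mono[OF M[OF that] laplace_remainder[OF T e[OF that], of K] M0 norm_ge_zero]
        by (simp add: norm_mult)
    qed
    ultimately show ?thesis by (simp add: algebra_simps)
  qed
  have triangle: "norm (u - v) \<le> 2 * B"
    if "w = u - s" "norm w \<le> B" "norm (v - s) \<le> B" for u v w s :: complex and B :: real
    using that norm_triangle_ineq4[of w "v - s"] by simp
  have "norm (T ?U - ?I) \<le> 2 * (C * ((b - a) * (M * ?E K)))" for K
    by (rule triangle[OF TW[of K] WE[of K] IE[of K]])
  moreover have "(\<lambda>K. 2 * (C * ((b - a) * (M * ?E K)))) \<longlonglongrightarrow> 2 * (C * ((b - a) * (M * ((1 + R) ^ N * 0))))"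
    by (intro tendsto_intros exp_rem_tendsto_0)
  ultimately have "norm (T ?U - ?I) \<le> 0"
    by (intro LIMSEQ_le_const[of "\<lambda>K. 2 * (C * ((b - a) * (M * ?E K)))"]) auto
  then show ?thesis by (simp add: e_def)
qed

text \<open>
  All products of the Fourier transform of \<open>g 0\<close> with powers of \<open>k\<close> are integrable.
  Therefore the truncated inversion integrals converge to \<open>g 0\<close> with all derivatives, and
  \<open>T\<close> may be applied under the integral.
\<close>

lemma finite_order_fourier:
  assumes T: "finite_order T N C" and g: "test_chain g"
  shows "T (g 0) = 1 / (2 * of_real pi) *
    (LINT k|lborel. hat (g 0) (\<i> * of_real k) * laplace T (- \<i> * of_real k))"
proof -
  let ?i = "\<lambda>k. \<i> * complex_of_real k"
  have decay: "\<exists>K\<ge>0. \<forall>k. \<bar>k\<bar> ^ m * norm (hat (g 0) (?i k)) \<le> K / (1 + k\<^sup>2)" for m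
  proof -
    obtain K L where K: "K \<ge> 0" "\<And>a. norm a ^ m * norm (hat (g 0) a) \<le> K * max 1 (exp (Re a))"
      and L: "L \<ge> 0" "\<And>a. norm a ^ (m + 2) * norm (hat (g 0) a) \<le> L * max 1 (exp (Re a))"
      using hat_decay[OF g, of m] hat_decay[OF g, of "m + 2"] by blast
    have "\<bar>k\<bar> ^ m * norm (hat (g 0) (?i k)) \<le> (K + L) / (1 + k\<^sup>2)" for k
    proof -
      have "\<bar>k\<bar> ^ m * norm (hat (g 0) (?i k)) \<le> K" using K(2)[of "?i k"] by (simp add: norm_mult)
      moreover have "k\<^sup>2 * (\<bar>k\<bar> ^ m * norm (hat (g 0) (?i k))) \<le> L"
      proof -
        have "\<bar>k\<bar> ^ (m + 2) * norm (hat (g 0) (?i k)) \<le> L"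
          using L(2)[of "?i k"] by (simp add: norm_mult del: power_Suc)
        moreover have "\<bar>k\<bar> ^ (m + 2) = k\<^sup>2 * \<bar>k\<bar> ^ m"
          unfolding power_add by (simp add: mult.commute)
        ultimately show ?thesis by (simp only: mult.assoc)
      qed
      ultimately have "(1 + k\<^sup>2) * (\<bar>k\<bar> ^ m * norm (hat (g 0) (?i k))) \<le> K + L"
        by (simp add: distrib_right)
      moreover have "1 + k\<^sup>2 > 0" by (simp add: add_pos_nonneg)
      ultimately show ?thesis by (simp add: field_simps)
    qed
    then show ?thesis using K(1) L(1) by (meson add_nonneg_nonneg)
  qed
  have hc: "continuous_on S (\<lambda>k. hat (g m) (?i k))" for m S
    by (rule continuous_on_compose2[OF hat_continuous[OF g, of UNIV]]) (auto intro!: continuous_intros)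
  have meas[measurable]: "(\<lambda>k. hat (g m) (?i k)) \<in> borel_measurable borel" for m
    by (rule borel_measurable_continuous_onI[OF hc])
  have hm: "hat (g m) (?i k) = (- ?i k) ^ m * hat (g 0) (?i k)" for m k
    by (rule hat_power[OF g, symmetric])
  have nhm: "norm (hat (g m) (?i k)) = \<bar>k\<bar> ^ m * norm (hat (g 0) (?i k))" for m k
    unfolding hm[of m] by (simp add: norm_mult norm_power)
  have inv: "(LINT k|lborel. hat (g m) (?i k) * exp (- \<i> * of_real k * of_real t)) = 2 * of_real pi * g m t"
    for m t
  proof -
    obtain K where K: "\<And>k. \<bar>k\<bar> ^ m * norm (hat (g 0) (?i k)) \<le> K / (1 + k\<^sup>2)" using decay by blast
    obtain B where "\<And>t. norm (g m t) \<le> B" using test_chain_bounded[OF g, of m] by blast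
    moreover have "norm (hat (g m) (?i k)) \<le> K / (1 + k\<^sup>2)" for k unfolding nhm[of m k] by (rule K)
    ultimately show ?thesis
      using g by (intro fourier_inversion test_chain_continuous meas) (auto simp: test_chain_def)
  qed
  obtain Kf where Kf: "\<And>m. Kf m \<ge> 0" "\<And>m k. \<bar>k\<bar> ^ m * norm (hat (g 0) (?i k)) \<le> Kf m / (1 + k\<^sup>2)"
    using decay by metis
  define M where "M = (\<Sum>m\<le>N. Kf m)"
  have M: "\<bar>k\<bar> ^ m * norm (hat (g 0) (?i k)) \<le> M / (1 + k\<^sup>2)" if "m \<le> N" for m k
  proof -
    have "Kf m \<le> M" unfolding M_def using Kf(1) that by (intro member_le_sum) auto
    then show ?thesis using Kf(2)[of k m] by (meson divide_right_mono order_trans add_nonneg_nonneg zero_le_one zero_le_power2)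
  qed
  define U where "U r t = integral {-r..r} (\<lambda>k. hat (g 0) (?i k) * exp (- \<i> * of_real k * of_real t))" for r t
  let ?G = "\<lambda>m k t. hat (g 0) (?i k) * ((- \<i> * of_real k) ^ m * exp (- \<i> * of_real k * complex_of_real t))"
  let ?D = "\<lambda>r m t. 2 * of_real pi * g m t + -1 * integral {-r..r} (\<lambda>k. ?G m k t)"
  have Uch: "deriv_chain UNIV (\<lambda>m t. integral {-r..r} (\<lambda>k. ?G m k t))" for r
  proof (rule deriv_chain_integral)
    show "deriv_chain UNIV (\<lambda>m t. ?G m k t)" for k by (intro deriv_chain_cmult exp_chain)
    show "continuous_on UNIV (\<lambda>(k, t). ?G m k t)" for m
      unfolding split_beta
      by (intro continuous_on_mult continuous_on_compose2[OF hc[of UNIV]] continuous_intros) auto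
  qed
  have gch: "deriv_chain UNIV g" using g by (simp add: test_chain_def)
  have Dch: "deriv_chain {0..1} (?D r)" for r
  proof (rule deriv_chain_subset)
    show "deriv_chain UNIV (?D r)"
      by (rule deriv_chain_add[OF deriv_chain_cmult[OF gch, of "2 * of_real pi"]
          deriv_chain_cmult[OF Uch[of r], of "-1"]])
  qed simp
  define W where "W r = (LINT k|lborel. M * (1 / (1 + k\<^sup>2))) - integral {-r..r} (\<lambda>k. M * (1 / (1 + k\<^sup>2)))" for r
  have DW: "norm (?D r m t) \<le> W r" if "m \<le> N" for r m t
  proof -
    let ?F = "\<lambda>k. hat (g m) (?i k) * exp (- \<i> * of_real k * of_real t)"
    have F: "norm (?F k) \<le> M * (1 / (1 + k\<^sup>2))" for k
      using M[OF that(1), of k] by (simp add: norm_mult nhm[of m k])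
    have "integrable lborel ?F"
      by (rule integrable_over_one_plus_square[where C = M]) (measurable, use F in simp)
    from integral_outside_Icc_le[OF this integrable_majorant F, of "-r" r]
    have "norm ((LINT k|lborel. ?F k) - integral {-r..r} ?F) \<le> W r" by (simp only: W_def)
    moreover have "integral {-r..r} (\<lambda>k. ?G m k t) = integral {-r..r} ?F"
      by (intro Henstock_Kurzweil_Integration.integral_cong) (simp add: hm[of m])
    ultimately show ?thesis by (simp only: inv) simp
  qed
  have Wlim: "(W \<longlongrightarrow> 0) at_top"
    using tendsto_diff[OF tendsto_const[of "LINT k|lborel. M * (1 / (1 + k\<^sup>2))"]
      integral_symmetric_interval_tendsto[OF integrable_majorant[of M]]] by (simp add: W_def[abs_def])
  have UE: "U r \<in> E01" for r
    using deriv_chain_in_E01[OF deriv_chain_subset[OF Uch[of r]]] by (simp add: U_def[abs_def])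
  have gE: "g 0 \<in> E01" by (rule deriv_chain_in_E01[OF deriv_chain_subset[OF gch]]) simp
  have TU: "norm (2 * of_real pi * T (g 0) - T (U r)) \<le> C * W r" if "r \<ge> 0" for r
  proof -
    have 1: "(\<lambda>t. 2 * of_real pi * g 0 t) \<in> E01" "(\<lambda>t. -1 * U r t) \<in> E01"
      using deriv_chain_in_E01[OF deriv_chain_subset[OF deriv_chain_cmult[OF gch, of "2 * of_real pi"]]]
        deriv_chain_in_E01[OF deriv_chain_subset[OF deriv_chain_cmult[OF Uch[of r], of "-1"]]]
      by (simp_all add: U_def[abs_def])
    have "?D r 0 = (\<lambda>t. 2 * of_real pi * g 0 t + -1 * U r t)" by (simp add: U_def)
    then have "T (?D r 0) = 2 * of_real pi * T (g 0) - T (U r)"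
      using finite_order_add[OF T 1] finite_order_scale[OF T gE, of "2 * of_real pi"]
        finite_order_scale[OF T UE[of r], of "-1"] by simp
    moreover have "norm (T (?D r 0)) \<le> C * W r"
      by (rule finite_order_bound[OF T Dch]) (rule DW)
    ultimately show ?thesis by simp
  qed
  have "((\<lambda>r. C * W r) \<longlongrightarrow> 0) at_top" using tendsto_mult_right_zero[OF Wlim] by simp
  moreover have "\<forall>\<^sub>F r in at_top. norm (2 * of_real pi * T (g 0) - T (U r)) \<le> C * W r"
    using eventually_ge_at_top[of "0::real"] by (rule eventually_mono) (rule TU)
  ultimately have "((\<lambda>r. 2 * of_real pi * T (g 0) - T (U r)) \<longlongrightarrow> 0) at_top"
    by (rule Lim_null_comparison[rotated])
  from tendsto_diff[OF tendsto_const[of "2 * of_real pi * T (g 0)"] this]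
  have lim1: "((\<lambda>r. T (U r)) \<longlongrightarrow> 2 * of_real pi * T (g 0)) at_top" by simp
  let ?H = "\<lambda>k. hat (g 0) (?i k) * laplace T (- \<i> * of_real k)"
  have Hc: "continuous_on S ?H" for S
    by (intro continuous_on_mult hc continuous_on_compose2[OF holomorphic_on_imp_continuous_on[OF
        laplace_holomorphic[OF T, of UNIV]]] continuous_intros) auto
  have [measurable]: "?H \<in> borel_measurable borel" by (rule borel_measurable_continuous_onI[OF Hc])
  obtain B where B: "\<And>k. norm (?H k) \<le> B / (1 + k\<^sup>2)"
  proof -
    have "norm (?H k) \<le> (C * 2 ^ N * (Kf 0 + Kf N)) / (1 + k\<^sup>2)" for k
    proof -
      have "(1 + \<bar>k\<bar>) ^ N \<le> 2 ^ N * (1 + \<bar>k\<bar> ^ N)"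
      proof -
        have "(1 + \<bar>k\<bar>) ^ N \<le> (2 * max 1 \<bar>k\<bar>) ^ N" by (intro power_mono) auto
        also have "\<dots> = 2 ^ N * max 1 \<bar>k\<bar> ^ N" by (simp add: power_mult_distrib)
        also have "max 1 \<bar>k\<bar> ^ N \<le> 1 + \<bar>k\<bar> ^ N" by (auto simp: max_def)
        finally show ?thesis by simp
      qed
      then have "norm (laplace T (- \<i> * of_real k)) \<le> C * (2 ^ N * (1 + \<bar>k\<bar> ^ N))"
        using laplace_bound[OF T, of "- \<i> * of_real k"] mult_left_mono[OF _ finite_order_nonneg[OF T]]
        by (fastforce simp: norm_mult intro: order_trans)
      then have "norm (?H k) \<le> norm (hat (g 0) (?i k)) * (C * (2 ^ N * (1 + \<bar>k\<bar> ^ N)))"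
        unfolding norm_mult by (intro mult_left_mono) auto
      also have "\<dots> = C * 2 ^ N * (\<bar>k\<bar> ^ 0 * norm (hat (g 0) (?i k)) + \<bar>k\<bar> ^ N * norm (hat (g 0) (?i k)))"
        by (simp add: algebra_simps)
      also have "\<dots> \<le> C * 2 ^ N * (Kf 0 / (1 + k\<^sup>2) + Kf N / (1 + k\<^sup>2))"
        by (intro mult_left_mono add_mono Kf(2)) (use finite_order_nonneg[OF T] in auto)
      finally show ?thesis by (simp add: add_divide_distrib distrib_left)
    qed
    then show thesis by (rule that)
  qed
  have intH: "integrable lborel ?H" by (rule integrable_over_one_plus_square[OF _ B]) measurable
  have "T (U r) = integral {-r..r} ?H" if "r \<ge> 0" for r
    unfolding U_def[abs_def] by (rule finite_order_exp_integral[OF T hc]) (use that in simp)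
  then have "\<forall>\<^sub>F r in at_top. integral {-r..r} ?H = T (U r)"
    using eventually_mono[OF eventually_ge_at_top[of "0::real"]] by (simp add: eq_commute)
  with integral_symmetric_interval_tendsto[OF intH]
  have lim2: "((\<lambda>r. T (U r)) \<longlongrightarrow> (LINT k|lborel. ?H k)) at_top" by (rule Lim_transform_eventually)
  from tendsto_unique[OF _ lim1 lim2] show ?thesis by (simp add: eq_divide_eq mult.commute)
qed

section \<open>Convex polygons\<close>

text \<open>
  The signed distance from the line through side \<open>j\<close>, positive on the left of the side.
\<close>

definition side_height :: "nat \<Rightarrow> (nat \<Rightarrow> complex) \<Rightarrow> nat \<Rightarrow> complex \<Rightarrow> real"
  where "side_height n z j w = Im (cis (- side_angle n z j) * (w - z j))"

lemma side_height_add: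
  "side_height n z j (w + d) = side_height n z j w + Im (cis (- side_angle n z j) * d)"
  by (simp add: side_height_def algebra_simps)

lemma side_height_diff:
  "side_height n z j w - side_height n z j w' = Im (cis (- side_angle n z j) * (w - w'))"
  by (simp add: side_height_def algebra_simps)

lemma side_height_inner:
  "side_height n z j w = inner (\<i> * cis (side_angle n z j)) w - inner (\<i> * cis (side_angle n z j)) (z j)"
  by (simp add: side_height_def inner_complex_def algebra_simps)

lemma Im_mult_of_real: "Im (a * (of_real s * b)) = s * Im (a * b)"
  by (simp add: algebra_simps)

text \<open>
  Cramer's rule for expanding \<open>x\<close> in the directions \<open>k\<close> and \<open>p\<close>.
\<close>

lemma cross_identity:
  fixes p k x :: complex
  shows "of_real (Im (cnj p * k)) * x = of_real (Im (cnj p * x)) * k - of_real (Im (cnj k * x)) * p"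
  by (simp add: complex_eq_iff algebra_simps)

context
  fixes n :: nat and z :: "nat \<Rightarrow> complex"
  assumes poly: "convex_polygon_ccw n z"
begin

private abbreviation (input) u :: "nat \<Rightarrow> complex" where "u j \<equiv> cis (side_angle n z j)"
private abbreviation (input) h :: "nat \<Rightarrow> complex \<Rightarrow> real" where "h j \<equiv> side_height n z j"
private abbreviation (input) v :: "nat \<Rightarrow> complex" where "v j \<equiv> side_vec n z j"
private abbreviation (input) nxt :: "nat \<Rightarrow> nat" where "nxt i \<equiv> Suc i mod n"
private abbreviation (input) prv :: "nat \<Rightarrow> nat" where "prv i \<equiv> (i + n - 1) mod n"

lemma n_ge_3: "n \<ge> 3" using poly by (simp add: convex_polygon_ccw_def)

lemma nxt_less: "nxt i < n" and prv_less: "prv i < n" using n_ge_3 by simp_all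

lemma nxt_prv: "i < n \<Longrightarrow> nxt (prv i) = i"
  using n_ge_3 by (simp add: mod_Suc_eq)

lemma nxt_neq: "i < n \<Longrightarrow> nxt i \<noteq> i"
  using n_ge_3 by (cases "Suc i = n") auto

lemma nxt_neq_prv: "i < n \<Longrightarrow> nxt i \<noteq> prv i"
  using n_ge_3 by (cases "Suc i = n"; cases "i = 0") (auto simp: mod_if)

lemma cross_pos:
  "i < n \<Longrightarrow> j < n \<Longrightarrow> j \<noteq> i \<Longrightarrow> j \<noteq> nxt i \<Longrightarrow> Im (cnj (v i) * (z j - z i)) > 0"
  using poly by (simp add: convex_polygon_ccw_def)

lemma side_vec_nonzero: "i < n \<Longrightarrow> v i \<noteq> 0"
proof -
  assume i: "i < n"
  have "prv i \<noteq> i" using nxt_neq[OF prv_less[of i]] nxt_prv[OF i] by metis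
  then have "Im (cnj (v i) * (z (prv i) - z i)) > 0"
    using cross_pos[OF i prv_less] nxt_neq_prv[OF i] by metis
  then show ?thesis by auto
qed

lemma side_vec_polar: "i < n \<Longrightarrow> v i = of_real (norm (v i)) * u i"
  using side_vec_nonzero[of i] by (simp add: side_angle_def cis_Arg sgn_eq)

lemma height_start: "h i (z i) = 0" by (simp add: side_height_def)

lemma height_along: "h j (w + of_real s * u j) = h j w"
  unfolding side_height_add by (simp add: mult.left_commute cis_mult)

lemma height_end: "i < n \<Longrightarrow> h i (z (nxt i)) = 0"
  using height_along[of i "z i" "norm (v i)"] side_vec_polar[of i]
  by (simp add: height_start) (simp add: side_vec_def)

lemma Im_cnj_side_vec: "i < n \<Longrightarrow> Im (cnj (v i) * x) = norm (v i) * Im (cis (- side_angle n z i) * x)"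
  by (subst side_vec_polar) (simp_all add: cis_cnj mult.assoc)

lemma height_other:
  assumes "i < n" "j < n" "j \<noteq> i" "j \<noteq> nxt i" shows "h i (z j) > 0"
  using cross_pos[OF assms] side_vec_nonzero[OF assms(1)]
  unfolding Im_cnj_side_vec[OF assms(1)] side_height_def
  by (simp add: zero_less_mult_iff del: times_complex.sel cis.simps)

lemma height_vertex_nonneg: "i < n \<Longrightarrow> j < n \<Longrightarrow> h i (z j) \<ge> 0"
  using height_other[of i j] height_start[of i] height_end[of i] by (cases "j = i"; cases "j = nxt i") auto

text \<open>
  The sine of the exterior angle at the vertex \<open>z i\<close>.
\<close>

definition turn :: "nat \<Rightarrow> real" where "turn i = Im (cnj (u (prv i)) * u i)"

lemma turn_pos: assumes i: "i < n" shows "turn i > 0"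
proof -
  have "h (prv i) (z (nxt i)) > 0"
  proof (rule height_other[OF prv_less nxt_less])
    show "nxt i \<noteq> prv i" by (rule nxt_neq_prv[OF i])
    show "nxt i \<noteq> nxt (prv i)" using nxt_neq[OF i] nxt_prv[OF i] by simp
  qed
  moreover have "h (prv i) (z (nxt i)) = h (prv i) (z i + v i)" by (simp add: side_vec_def)
  moreover have "h (prv i) (z i) = 0" using height_end[OF prv_less[of i]] nxt_prv[OF i] by simp
  ultimately have "Im (cis (- side_angle n z (prv i)) * v i) > 0"
    by (simp add: side_height_add del: cis.simps)
  also have "cis (- side_angle n z (prv i)) * v i = of_real (norm (v i)) * (cnj (u (prv i)) * u i)"
    by (subst side_vec_polar[OF i]) (simp add: cis_cnj mult.left_commute)
  finally show ?thesis
    unfolding turn_def using side_vec_nonzero[OF i] by (simp add: zero_less_mult_iff)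
qed

lemma decompose_at_corner:
  "of_real (turn i) * (w - z i) = of_real (h (prv i) w - h (prv i) (z i)) * u i - of_real (h i w) * u (prv i)"
  using cross_identity[of "u (prv i)" "u i" "w - z i"]
  unfolding turn_def side_height_diff by (simp add: cis_cnj side_height_def)

lemma convex_heights_ge: "convex {w. \<forall>i<n. c i \<le> h i w}"
proof -
  have "{w. \<forall>i<n. c i \<le> h i w}
      = (\<Inter>i\<in>{..<n}. {w. inner (\<i> * u i) w \<ge> c i + inner (\<i> * u i) (z i)})"
    by (auto simp: side_height_inner le_diff_eq)
  then show ?thesis by (auto intro: convex_INT convex_halfspace_ge)
qed

text \<open>
  Suppose that a point \<open>w\<close> on the left of all sides is separated from the hull by a linear
  functional that is smaller at \<open>w\<close>. At a vertex where the functional is minimal on the polygon,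
  it does not decrease along the two edges leaving the vertex. But \<open>w\<close> lies in the cone spanned
  by these edges.
\<close>

lemma convex_hull_heights: "convex hull (z ` {..<n}) = {w. \<forall>i<n. 0 \<le> h i w}"
proof
  show "convex hull (z ` {..<n}) \<subseteq> {w. \<forall>i<n. 0 \<le> h i w}"
    by (rule hull_minimal) (use height_vertex_nonneg convex_heights_ge[of "\<lambda>_. 0"] in auto)
  show "{w. \<forall>i<n. 0 \<le> h i w} \<subseteq> convex hull (z ` {..<n})"
  proof (rule subsetI, rule ccontr)
    fix w assume w: "w \<in> {w. \<forall>i<n. 0 \<le> h i w}" and out: "w \<notin> convex hull (z ` {..<n})"
    have "closed (convex hull (z ` {..<n}))"
      by (intro compact_imp_closed compact_convex_hull finite_imp_compact) simp
    then obtain d b where d: "inner d w < b" "\<And>x. x \<in> convex hull (z ` {..<n}) \<Longrightarrow> inner d x > b"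
      using separating_hyperplane_closed_point[OF convex_convex_hull _ out] by blast
    obtain k where k: "k < n" "\<And>j. j < n \<Longrightarrow> inner d (z k) \<le> inner d (z j)"
      using ex_is_arg_min_if_finite[of "{..<n}" "\<lambda>j. inner d (z j)"] n_ge_3
      by (fastforce simp: is_arg_min_linorder)
    have zp: "h (prv k) (z k) = 0" using height_end[OF prv_less[of k]] nxt_prv[OF k(1)] by simp
    have dir: "inner d (v j) = norm (v j) * inner d (u j)" if "j < n" for j
      by (subst side_vec_polar[OF that]) (simp add: scaleR_conv_of_real[symmetric])
    have "inner d (v k) \<ge> 0" using k(2)[OF nxt_less[of k]] by (simp add: side_vec_def inner_diff_right)
    then have 1: "inner d (u k) \<ge> 0"
      using side_vec_nonzero[OF k(1)] by (simp add: dir[OF k(1)] zero_le_mult_iff)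
    have "inner d (v (prv k)) \<le> 0"
      using k(2)[OF prv_less[of k]] nxt_prv[OF k(1)] by (simp add: side_vec_def inner_diff_right)
    then have 2: "inner d (u (prv k)) \<le> 0"
      using side_vec_nonzero[OF prv_less[of k]] unfolding dir[OF prv_less] by (simp add: mult_le_0_iff)
    have "turn k * inner d (w - z k) = inner d (of_real (turn k) * (w - z k))"
      by (simp add: scaleR_conv_of_real[symmetric])
    also have "\<dots> = inner d (of_real (h (prv k) w) * u k - of_real (h k w) * u (prv k))"
      unfolding decompose_at_corner zp diff_zero ..
    also have "\<dots> = h (prv k) w * inner d (u k) - h k w * inner d (u (prv k))"
      by (simp only: inner_diff_right scaleR_conv_of_real[symmetric] inner_scaleR_right)
    also have "\<dots> \<ge> 0"
    proof -
      have "h (prv k) w \<ge> 0" "h k w \<ge> 0" using w k(1) prv_less[of k] by blast+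
      then show ?thesis using mult_nonneg_nonneg[OF _ 1] mult_nonneg_nonpos[OF _ 2] by (meson diff_ge_0_iff_ge order_trans)
    qed
    finally have "inner d (w - z k) \<ge> 0" using turn_pos[OF k(1)] by (simp add: zero_le_mult_iff)
    moreover have "inner d (z k) > b" using d(2) k(1) by (simp add: hull_inc)
    ultimately show False using d(1) by (simp add: inner_diff_right)
  qed
qed

lemma dir_nonzero: "\<i> * u i \<noteq> 0" by simp

lemma polygon_interior_heights: "polygon_interior n z = {w. \<forall>i<n. 0 < h i w}" (is "_ = ?R")
proof
  have "w \<in> ?R" if w: "w \<in> polygon_interior n z" for w
  proof (intro CollectI allI impI)
    fix i assume "i < n"
    have "convex hull (z ` {..<n}) \<subseteq> {w. inner (\<i> * u i) w \<ge> inner (\<i> * u i) (z i)}"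
      using \<open>i < n\<close> unfolding convex_hull_heights by (auto simp: side_height_inner)
    then have "w \<in> interior {w. inner (\<i> * u i) w \<ge> inner (\<i> * u i) (z i)}"
      using w interior_mono unfolding polygon_interior_def by blast
    then show "0 < h i w"
      unfolding interior_halfspace_ge[OF dir_nonzero] by (simp add: side_height_inner)
  qed
  then show "polygon_interior n z \<subseteq> ?R" by blast
  have "?R = (\<Inter>i\<in>{..<n}. {w. inner (\<i> * u i) w > inner (\<i> * u i) (z i)})"
    by (auto simp: side_height_inner)
  then have "open ?R" by (auto intro: open_INT open_halfspace_gt)
  moreover have "?R \<subseteq> convex hull (z ` {..<n})" unfolding convex_hull_heights by auto
  ultimately show "?R \<subseteq> polygon_interior n z"
    unfolding polygon_interior_def by (intro interior_maximal)
qed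

lemma open_polygon_interior: "open (polygon_interior n z)"
  by (simp add: polygon_interior_def)

text \<open>
  The distance to the frontier is at least \<open>e\<close> if and only if the disc of radius \<open>e\<close>
  stays inside the polygon, and this is a condition on each of the bounding lines separately.
\<close>

lemma inner_polygon_heights:
  assumes "e > 0"
  shows "inner_polygon (polygon_interior n z) e = {w. \<forall>i<n. e \<le> h i w}"
proof (intro equalityI subsetI CollectI allI impI)
  let ?O = "polygon_interior n z"
  fix w i assume w: "w \<in> inner_polygon ?O e" and i: "i < n"
  from w have wO: "w \<in> ?O" and wd: "infdist w (frontier ?O) \<ge> e" by (auto simp: inner_polygon_def)
  have "ball w e \<inter> frontier ?O = {}"
  proof -
    have "dist w x \<ge> e" if "x \<in> frontier ?O" for x using infdist_le[OF that, of w] wd by simp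
    then show ?thesis by fastforce
  qed
  moreover have "ball w e \<inter> ?O \<noteq> {}" using wO assms centre_in_ball by blast
  ultimately have sub: "ball w e \<subseteq> ?O"
    using connected_Int_frontier[OF connected_ball, of w e ?O] by blast
  show "e \<le> h i w"
  proof (rule ccontr)
    assume "\<not> e \<le> h i w"
    moreover have "h i w > 0" using wO i unfolding polygon_interior_heights by auto
    ultimately have "w + - (of_real (h i w) * (\<i> * u i)) \<in> ball w e"
      by (simp add: dist_norm norm_mult)
    then have "h i (w + - (of_real (h i w) * (\<i> * u i))) > 0"
      using sub i unfolding polygon_interior_heights by blast
    moreover have eq: "cis (- side_angle n z i) * - (of_real (h i w) * (\<i> * u i)) = - (of_real (h i w) * \<i>)"
      by (simp add: mult.left_commute cis_mult)
    ultimately show False unfolding side_height_add eq by simp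
  qed
next
  let ?O = "polygon_interior n z"
  fix w assume "w \<in> {w. \<forall>i<n. e \<le> h i w}"
  then have w: "\<And>i. i < n \<Longrightarrow> e \<le> h i w" by simp
  have wO: "w \<in> ?O" using w assms unfolding polygon_interior_heights by force
  have "z 0 \<notin> ?O" using n_ge_3 height_start[of 0] unfolding polygon_interior_heights by force
  then have ne: "frontier ?O \<noteq> {}" using wO frontier_eq_empty by blast
  have "infdist w (frontier ?O) \<ge> e"
    unfolding infdist_notempty[OF ne]
  proof (rule cINF_greatest[OF ne])
    fix x assume "x \<in> frontier ?O"
    then have "x \<notin> ?O" using open_polygon_interior by (simp add: frontier_def interior_open)
    then obtain j where j: "j < n" "h j x \<le> 0" unfolding polygon_interior_heights by force
    have "e \<le> h j w - h j x" using w[OF j(1)] j(2) by simp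
    also have "\<dots> \<le> norm (cis (- side_angle n z j) * (w - x))"
      unfolding side_height_diff using abs_Im_le_cmod abs_le_D1 by blast
    finally show "e \<le> dist w x" by (simp add: norm_mult dist_norm)
  qed
  then show "w \<in> inner_polygon ?O e" using wO by (simp add: inner_polygon_def)
qed

text \<open>
  The velocity of the \<open>i\<close>-th vertex of the inner polygon: it moves away from both lines meeting
  at \<open>z i\<close> at unit speed.
\<close>

definition corner_shift :: "nat \<Rightarrow> complex"
  where "corner_shift i = (u i - u (prv i)) / of_real (turn i)"

lemma corner_shift_height:
  assumes "i < n"
  shows "Im (cis (- side_angle n z i) * corner_shift i) = 1"
    "Im (cis (- side_angle n z (prv i)) * corner_shift i) = 1"
proof -
  have "Im (cis (- side_angle n z i) * (u i - u (prv i))) = turn i"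
    by (simp add: turn_def right_diff_distrib cis_mult cis_cnj[symmetric])
  moreover have "Im (cis (- side_angle n z (prv i)) * (u i - u (prv i))) = turn i"
    by (simp add: turn_def right_diff_distrib cis_mult cis_cnj[symmetric])
  ultimately show "Im (cis (- side_angle n z i) * corner_shift i) = 1"
    "Im (cis (- side_angle n z (prv i)) * corner_shift i) = 1"
    using turn_pos[OF assms] by (simp_all add: corner_shift_def times_divide_eq_right Im_divide_of_real del: times_complex.sel cis.simps)
qed

lemma corner_in_inner_polygon:
  assumes "i < n"
  shows "\<exists>e0>0. \<forall>e. 0 < e \<and> e < e0 \<longrightarrow> (\<forall>j<n. e \<le> h j (z i + of_real e * corner_shift i))"
proof -
  have "\<forall>\<^sub>F e in at_right 0. \<forall>j\<in>{..<n}. e \<le> h j (z i + of_real e * corner_shift i)"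
  proof (rule eventually_ball_finite)
    show "\<forall>j\<in>{..<n}. \<forall>\<^sub>F e in at_right 0. e \<le> h j (z i + of_real e * corner_shift i)"
    proof
      fix j assume "j \<in> {..<n}"
      then have j: "j < n" by simp
      have lin: "h j (z i + of_real e * corner_shift i)
          = h j (z i) + e * Im (cis (- side_angle n z j) * corner_shift i)" for e
        unfolding side_height_add Im_mult_of_real ..
      show "\<forall>\<^sub>F e in at_right 0. e \<le> h j (z i + of_real e * corner_shift i)"
      proof (cases "j = i \<or> j = prv i")
        case True
        have "h (prv i) (z i) = 0" using height_end[OF prv_less[of i]] nxt_prv[OF assms] by simp
        then have "e \<le> h j (z i + of_real e * corner_shift i)" for e
          unfolding lin using True corner_shift_height[OF assms] height_start[of i] by auto
        then show ?thesis by (intro always_eventually allI)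
      next
        case False
        have "i \<noteq> nxt j"
        proof
          assume "i = nxt j"
          then have "j = prv i" using j n_ge_3 by (cases "Suc j = n") auto
          then show False using False by simp
        qed
        then have pos: "h j (z i) > 0" using height_other[OF j assms] False by auto
        have "((\<lambda>e. h j (z i) + e * Im (cis (- side_angle n z j) * corner_shift i) - e)
            \<longlongrightarrow> h j (z i) + 0 * Im (cis (- side_angle n z j) * corner_shift i) - 0) (at_right 0)"
          by (intro tendsto_intros)
        then have "\<forall>\<^sub>F e in at_right 0. 0 < h j (z i) + e * Im (cis (- side_angle n z j) * corner_shift i) - e"
          using pos by (intro order_tendstoD(1)) auto
        then show ?thesis unfolding lin by (rule eventually_mono) simp
      qed
    qed
  qed simp
  then show ?thesis unfolding eventually_at_right_field by auto
qed

lemma prv_nxt: "i < n \<Longrightarrow> prv (nxt i) = i"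
  using n_ge_3 by (cases "Suc i = n") auto

lemma real_multiple_of_direction:
  assumes "Im (cis (- side_angle n z i) * x) = 0"
  shows "x = of_real (Re (cis (- side_angle n z i) * x)) * u i"
proof -
  have "cis (- side_angle n z i) * x = of_real (Re (cis (- side_angle n z i) * x))"
    by (rule complex_eqI) (simp, use assms in simp)
  then have "u i * (cis (- side_angle n z i) * x) = u i * of_real (Re (cis (- side_angle n z i) * x))"
    by (rule arg_cong)
  moreover have "u i * (cis (- side_angle n z i) * x) = x"
    by (simp add: mult.assoc[symmetric] cis_mult)
  ultimately show ?thesis by (simp only: mult.commute)
qed

text \<open>
  The segment from \<open>A\<close> to \<open>B\<close> is cut out by the line at height \<open>e\<close>,
  which supports the inner polygon. Conversely, an edge with the direction of side \<open>i\<close> and the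
  inner polygon on its left has minimal height, so it is part of that segment. Being a face that contains an
  inner point of the segment, it contains its end points.
\<close>

lemma inner_side_unique:
  assumes i: "i < n" and e: "e > 0" and m: "m > 0"
    and A: "\<And>j. j < n \<Longrightarrow> e \<le> h j A" and B: "\<And>j. j < n \<Longrightarrow> e \<le> h j B"
    and hA: "h i A = e" "h (prv i) A = e" and hB: "h (nxt i) B = e"
    and AB: "B = A + of_real m * v i"
  shows "is_inner_side n z i e a b \<longleftrightarrow> a = A \<and> b = B"
proof -
  define P where "P = {w. \<forall>j<n. e \<le> h j w}"
  have inner: "inner_polygon (polygon_interior n z) e = P"
    unfolding P_def by (rule inner_polygon_heights[OF e])
  have is_side: "is_inner_side n z i e a b \<longleftrightarrow> closed_segment a b edge_of P \<and>
      (\<exists>c>0. b - a = of_real c * v i) \<and> (\<forall>w\<in>P. h i a \<le> h i w)" for a b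
  proof -
    have "Im (cnj (v i) * (w - a)) \<ge> 0 \<longleftrightarrow> h i a \<le> h i w" for w
      unfolding Im_cnj_side_vec[OF i] side_height_diff[symmetric]
      using side_vec_nonzero[OF i] by (simp add: zero_le_mult_iff)
    then show ?thesis unfolding is_inner_side_def inner Let_def by simp
  qed
  have conv: "convex P" unfolding P_def by (rule convex_heights_ge)
  have AP: "A \<in> P" and BP: "B \<in> P" using A B by (auto simp: P_def)
  define l where "l = m * norm (v i)"
  have l: "l > 0" using m side_vec_nonzero[OF i] by (simp add: l_def)
  have ABu: "B = A + of_real l * u i"
    unfolding AB l_def by (subst side_vec_polar[OF i]) (simp add: mult.assoc)
  have hAB: "h i (A + of_real s * u i) = e" for s by (simp add: height_along hA)
  have ne: "A \<noteq> B" using l unfolding ABu by simp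
  have seg: "closed_segment A B = P \<inter> {w. h i w = e}"
  proof
    have "closed_segment A B \<subseteq> P" by (rule closed_segment_subset[OF AP BP conv])
    moreover have "h i w = e" if w: "w \<in> closed_segment A B" for w
    proof -
      obtain t where "w = (1 - t) *\<^sub>R A + t *\<^sub>R B" using w by (auto simp: closed_segment_def)
      then have "w = A + of_real (t * l) * u i"
        unfolding ABu by (simp add: scaleR_conv_of_real algebra_simps)
      then show ?thesis using hAB[of "t * l"] by (simp only:)
    qed
    ultimately show "closed_segment A B \<subseteq> P \<inter> {w. h i w = e}" by blast
    show "P \<inter> {w. h i w = e} \<subseteq> closed_segment A B"
    proof
      fix w assume "w \<in> P \<inter> {w. h i w = e}"
      then have w: "\<And>j. j < n \<Longrightarrow> e \<le> h j w" "h i w = e" by (auto simp: P_def)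
      define s where "s = Re (cis (- side_angle n z i) * (w - A))"
      have "Im (cis (- side_angle n z i) * (w - A)) = 0"
        unfolding side_height_diff[symmetric] using w(2) hA(1) by simp
      from real_multiple_of_direction[OF this] have wA: "w - A = of_real s * u i" by (simp only: s_def)
      have "0 \<le> h (prv i) w - h (prv i) A" using w(1)[OF prv_less[of i]] hA(2) by simp
      also have "\<dots> = s * turn i"
        unfolding side_height_diff wA Im_mult_of_real turn_def by (simp add: cis_cnj)
      finally have s0: "s \<ge> 0" using turn_pos[OF i] by (simp add: zero_le_mult_iff)
      have wB: "w - B = of_real (s - l) * u i" using wA unfolding ABu by (simp add: algebra_simps)
      have "0 \<le> h (nxt i) w - h (nxt i) B" using w(1)[OF nxt_less[of i]] hB by simp
      also have "\<dots> = (s - l) * - turn (nxt i)"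
        unfolding side_height_diff wB Im_mult_of_real turn_def prv_nxt[OF i]
        by (simp add: cis_cnj[symmetric])
      finally have sl: "s \<le> l" using turn_pos[OF nxt_less[of i]] by (simp add: zero_le_mult_iff mult_le_0_iff)
      have "w = (1 - s / l) *\<^sub>R A + (s / l) *\<^sub>R B"
        using wA l unfolding ABu by (simp add: scaleR_conv_of_real algebra_simps)
      then show "w \<in> closed_segment A B"
        using s0 sl l by (auto simp: closed_segment_def intro!: exI[of _ "s / l"])
    qed
  qed
  have face: "closed_segment A B face_of P"
  proof -
    have eq: "h i w = e \<longleftrightarrow> inner (\<i> * u i) w = e + inner (\<i> * u i) (z i)" for w
      by (auto simp: side_height_inner)
    have "P \<inter> {w. inner (\<i> * u i) w = e + inner (\<i> * u i) (z i)} face_of P"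
      by (rule face_of_Int_supporting_hyperplane_ge[OF conv])
        (use i in \<open>auto simp: P_def side_height_inner algebra_simps\<close>)
    then show ?thesis unfolding seg eq .
  qed
  show ?thesis
  proof
    assume "a = A \<and> b = B"
    moreover have "aff_dim (closed_segment A B) = 1"
      using ne by (simp add: segment_convex_hull aff_dim_convex_hull aff_dim_2)
    moreover have "\<exists>c>0. B - A = of_real c * v i" using m AB by auto
    ultimately show "is_inner_side n z i e a b"
      unfolding is_side edge_of_def using face A i hA(1) by (auto simp: P_def)
  next
    assume "is_inner_side n z i e a b"
    then have f: "closed_segment a b face_of P" and c: "\<exists>c>0. b - a = of_real c * v i"
      and low: "\<And>w. w \<in> P \<Longrightarrow> h i a \<le> h i w"
      unfolding is_side edge_of_def by blast+
    obtain c where c: "c > 0" "b - a = of_real c * v i" using c by blast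
    have b: "b = a + of_real (c * norm (v i)) * u i"
      using c(2) side_vec_polar[OF i] by (simp add: algebra_simps)
    have sub: "closed_segment a b \<subseteq> P" using f by (rule face_of_imp_subset)
    have aP: "a \<in> P" "b \<in> P" using sub by auto
    have ha: "h i a = e" using low[OF AP] aP(1) i hA(1) by (auto simp: P_def intro: antisym)
    then have hb: "h i b = e" unfolding b height_along .
    have ab_seg: "a \<in> closed_segment A B" "b \<in> closed_segment A B"
      unfolding seg using aP ha hb by auto
    have "a \<noteq> b" using c side_vec_nonzero[OF i] by auto
    have mid: "midpoint a b \<in> open_segment A B"
    proof -
      have "midpoint a b \<in> open_segment a b" using \<open>a \<noteq> b\<close> by simp
      moreover have "open_segment a b \<subseteq> open_segment A B"
        using ab_seg ne \<open>a \<noteq> b\<close> by (simp add: subset_open_segment)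
      ultimately show ?thesis by blast
    qed
    have "A \<in> closed_segment a b \<and> B \<in> closed_segment a b"
      using f AP BP mid unfolding face_of_def by (meson midpoint_in_closed_segment)
    then have "closed_segment A B \<subseteq> closed_segment a b" by (simp add: subset_closed_segment)
    moreover have "closed_segment a b \<subseteq> closed_segment A B"
      using ab_seg by (simp add: subset_closed_segment)
    ultimately have "{a, b} = {A, B}" by (metis closed_segment_eq subset_antisym)
    moreover have "\<not> (a = B \<and> b = A)"
    proof
      assume "a = B \<and> b = A"
      then have "of_real c * v i = - (of_real m * v i)" using c(2) AB by simp
      then have "of_real (c + m) * v i = 0" by (simp add: distrib_right)
      then show False using c(1) m side_vec_nonzero[OF i] by (simp del: of_real_add)
    qed
    ultimately show "a = A \<and> b = B" by (auto simp: doubleton_eq_iff)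
  qed
qed

text \<open>
  Both end points of the inner side move with constant velocity, and the difference of the velocities is a
  real multiple \<open>\<kappa>\<close> of the side, because both move away from its line at unit speed.
\<close>

lemma inner_side_param_formula:
  assumes i: "i < n"
  shows "\<exists>\<kappa> e0. e0 > 0 \<and> (\<forall>e. 0 < e \<and> e < e0 \<longrightarrow> 1 / 2 \<le> 1 + e * \<kappa> \<and>
    (\<forall>j<n. e \<le> h j (z i + of_real e * corner_shift i)) \<and>
    (\<forall>j<n. e \<le> h j (z i + of_real e * corner_shift i + of_real (1 + e * \<kappa>) * v i)) \<and>
    (\<forall>\<tau>. inner_side_param n z i e \<tau> =
      z i + of_real e * corner_shift i + of_real \<tau> * (of_real (1 + e * \<kappa>) * v i)))"
proof -
  let ?d = "corner_shift (nxt i) - corner_shift i"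
  define \<kappa> where "\<kappa> = Re (cis (- side_angle n z i) * ?d) / norm (v i)"
  have "Im (cis (- side_angle n z i) * ?d) = 0"
    using corner_shift_height(1)[OF i] corner_shift_height(2)[OF nxt_less[of i]]
    unfolding prv_nxt[OF i] right_diff_distrib by simp
  then have "?d = of_real (Re (cis (- side_angle n z i) * ?d)) * u i"
    by (rule real_multiple_of_direction)
  also have "Re (cis (- side_angle n z i) * ?d) = \<kappa> * norm (v i)"
    unfolding \<kappa>_def using side_vec_nonzero[OF i] by simp
  also have "of_real (\<kappa> * norm (v i)) * u i = of_real \<kappa> * (of_real (norm (v i)) * u i)"
    by (simp add: mult.assoc)
  also have "of_real (norm (v i)) * u i = v i" by (rule side_vec_polar[OF i, symmetric])
  finally have d: "?d = of_real \<kappa> * v i" .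
  obtain e1 where e1: "e1 > 0" "\<And>e. 0 < e \<Longrightarrow> e < e1 \<Longrightarrow> \<forall>j<n. e \<le> h j (z i + of_real e * corner_shift i)"
    using corner_in_inner_polygon[OF i] by blast
  obtain e2 where e2: "e2 > 0" "\<And>e. 0 < e \<Longrightarrow> e < e2 \<Longrightarrow>
      \<forall>j<n. e \<le> h j (z (nxt i) + of_real e * corner_shift (nxt i))"
    using corner_in_inner_polygon[OF nxt_less[of i]] by blast
  \<comment> \<open>The last entry of the minimum keeps \<open>1 + e\<kappa>\<close> above \<open>1 / 2\<close>.\<close>
  define e0 where "e0 = min (min e1 e2) (1 / (2 * (1 + \<bar>\<kappa>\<bar>)))"
  have "e0 > 0" using e1(1) e2(1) by (auto simp: e0_def)
  have main: "1 / 2 \<le> 1 + e * \<kappa> \<and>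
    (\<forall>j<n. e \<le> h j (z i + of_real e * corner_shift i)) \<and>
    (\<forall>j<n. e \<le> h j (z i + of_real e * corner_shift i + of_real (1 + e * \<kappa>) * v i)) \<and>
    (\<forall>\<tau>. inner_side_param n z i e \<tau> =
      z i + of_real e * corner_shift i + of_real \<tau> * (of_real (1 + e * \<kappa>) * v i))"
    if e: "0 < e" "e < e0" for e
  proof -
    let ?A = "z i + of_real e * corner_shift i" and ?B = "z (nxt i) + of_real e * corner_shift (nxt i)"
    let ?m = "1 + e * \<kappa>"
    have "e * \<bar>\<kappa>\<bar> \<le> 1 / (2 * (1 + \<bar>\<kappa>\<bar>)) * \<bar>\<kappa>\<bar>"
      using e by (intro mult_right_mono) (auto simp: e0_def)
    also have "\<dots> \<le> 1 / 2" by (simp add: field_simps)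
    finally have "\<bar>e * \<kappa>\<bar> \<le> 1 / 2" using e by (simp add: abs_mult)
    then have m: "1 / 2 \<le> ?m" by linarith
    have AB: "?B = ?A + of_real ?m * v i"
    proof -
      have "?B = ?A + v i + of_real e * ?d" by (simp add: side_vec_def algebra_simps)
      then show ?thesis unfolding d by (simp add: algebra_simps)
    qed
    have A: "\<forall>j<n. e \<le> h j ?A" and B: "\<forall>j<n. e \<le> h j ?B"
      using e1(2)[of e] e2(2)[of e] e by (auto simp: e0_def)
    have zp: "h (prv i) (z i) = 0" using height_end[OF prv_less[of i]] nxt_prv[OF i] by simp
    have "is_inner_side n z i e a b \<longleftrightarrow> a = ?A \<and> b = ?B" for a b
    proof (rule inner_side_unique[OF i e(1)])
      show "0 < ?m" using m by linarith
      show "h i ?A = e" "h (prv i) ?A = e" "h (nxt i) ?B = e"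
        unfolding side_height_add Im_mult_of_real height_start zp
          corner_shift_height[OF i] corner_shift_height(1)[OF nxt_less[of i]] by simp_all
    qed (use A B AB in auto)
    then have "(\<lambda>(a, b). is_inner_side n z i e a b) = (\<lambda>p. p = (?A, ?B))" by auto
    then have "(THE (a, b). is_inner_side n z i e a b) = (?A, ?B)" by simp
    then have "inner_side_param n z i e \<tau> = of_real \<tau> * ?B + of_real (1 - \<tau>) * ?A" for \<tau>
      by (simp add: inner_side_param_def)
    then have "inner_side_param n z i e \<tau> = ?A + of_real \<tau> * (of_real ?m * v i)" for \<tau>
      unfolding AB by (simp add: algebra_simps)
    with m A B show ?thesis unfolding AB by blast
  qed
  show ?thesis using \<open>e0 > 0\<close> main by blast
qed

text \<open>
  Two sides of the same direction would have to lie on the same line, and each would be the successor of the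
  other.
\<close>

lemma side_directions_distinct:
  assumes "i < n" "j < n" "i \<noteq> j"
  shows "u i \<noteq> u j"
proof
  assume eq: "u i = u j"
  then have "cis (- side_angle n z i) = cis (- side_angle n z j)" by (simp add: cis_cnj[symmetric])
  then have "h i (z j) = - h j (z i)" by (simp add: side_height_def algebra_simps)
  then have 0: "h i (z j) = 0" "h j (z i) = 0"
    using height_vertex_nonneg[of i j] height_vertex_nonneg[of j i] assms by auto
  have "j = nxt i" using height_other[OF assms(1,2)] 0 assms(3) by fastforce
  moreover have "i = nxt j" using height_other[OF assms(2,1)] 0 assms(3) by fastforce
  ultimately show False using prv_nxt[OF assms(1)] nxt_neq_prv[OF assms(1)] prv_nxt[OF assms(2)] by metis
qed

end

section \<open>Plane waves\<close>

text \<open>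
  The exponent of \<open>exp (\<i>kd - \<i>\<beta>\<^sup>2 cnj d / k)\<close> at \<open>k = \<beta> exp
  w\<close>.
\<close>

definition phase :: "real \<Rightarrow> complex \<Rightarrow> complex \<Rightarrow> complex"
  where "phase \<beta> w d = \<i> * of_real \<beta> * (exp w * d - exp (- w) * cnj d)"

lemma phase_add: "phase \<beta> w (c + d) = phase \<beta> w c + phase \<beta> w d"
  by (simp add: phase_def algebra_simps)

lemma phase_diff: "phase \<beta> w (c - d) = phase \<beta> w c - phase \<beta> w d"
  by (simp add: phase_def algebra_simps)

lemma phase_of_real: "phase \<beta> w (of_real s * d) = of_real s * phase \<beta> w d"
  by (simp add: phase_def algebra_simps)

text \<open>
  The phase is real-linear, but not complex-linear in \<open>d\<close>.
\<close>

lemma phase_decompose: "phase \<beta> w d = of_real (Re d) * phase \<beta> w 1 + of_real (Im d) * phase \<beta> w \<i>"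
proof -
  have "phase \<beta> w (of_real (Re d) * 1 + of_real (Im d) * \<i>)
      = of_real (Re d) * phase \<beta> w 1 + of_real (Im d) * phase \<beta> w \<i>"
    by (simp only: phase_add phase_of_real)
  moreover have "of_real (Re d) * 1 + of_real (Im d) * \<i> = d" by (simp add: complex_eq_iff)
  ultimately show ?thesis by simp
qed

lemma phase_ray:
  "phase \<beta> (Complex x \<theta>) d =
    Complex (- (2 * \<beta> * cosh x * Im (cis \<theta> * d))) (2 * \<beta> * sinh x * Re (cis \<theta> * d))"
proof -
  have e: "exp (Complex x \<theta>) = of_real (exp x) * cis \<theta>" for x \<theta> by (simp add: exp_eq_polar)
  have "- Complex x \<theta> = Complex (- x) (- \<theta>)" by (simp add: complex_eq_iff)
  then have "phase \<beta> (Complex x \<theta>) d =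
      \<i> * of_real \<beta> * (of_real (exp x) * cis \<theta> * d - of_real (exp (- x)) * cis (- \<theta>) * cnj d)"
    by (simp only: phase_def e)
  also have "\<dots> = \<i> * of_real \<beta> * (of_real (exp x) * (cis \<theta> * d) - of_real (exp (- x)) * cnj (cis \<theta> * d))"
    by (simp only: complex_cnj_mult cis_cnj mult.assoc)
  also have "\<dots> = Complex (- (2 * \<beta> * cosh x * Im (cis \<theta> * d))) (2 * \<beta> * sinh x * Re (cis \<theta> * d))"
  proof -
    have "\<i> * of_real \<beta> * (of_real (exp x) * p - of_real (exp (- x)) * cnj p)
        = Complex (- (2 * \<beta> * cosh x * Im p)) (2 * \<beta> * sinh x * Re p)" for p
      by (simp add: complex_eq_iff cosh_def sinh_def algebra_simps)
    then show ?thesis .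
  qed
  finally show ?thesis .
qed

lemma norm_exp_phase: "norm (exp (phase \<beta> (Complex x \<theta>) d)) = exp (- (2 * \<beta> * cosh x * Im (cis \<theta> * d)))"
  unfolding phase_ray norm_exp_eq_Re by simp

lemma norm_phase_bounds:
  assumes "\<beta> \<ge> 0"
  shows norm_phase_le: "norm (phase \<beta> (Complex x \<theta>) d) \<le> 2 * \<beta> * cosh x * norm d"
    and norm_phase_ge: "2 * \<beta> * \<bar>sinh x\<bar> * norm d \<le> norm (phase \<beta> (Complex x \<theta>) d)"
proof -
  let ?p = "cis \<theta> * d" and ?S = "(2 * \<beta> * sinh x)\<^sup>2" and ?C = "(2 * \<beta> * cosh x)\<^sup>2"
  have "(sinh x)\<^sup>2 \<le> (cosh x)\<^sup>2" using cosh_square_eq[of x] by simp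
  then have SC: "?S \<le> ?C" by (simp add: power_mult_distrib mult_left_mono)
  have ph: "(norm (phase \<beta> (Complex x \<theta>) d))\<^sup>2 = ?C * (Im ?p)\<^sup>2 + ?S * (Re ?p)\<^sup>2"
    unfolding phase_ray cmod_power2 complex.sel power2_minus power_mult_distrib ..
  have d: "(norm d)\<^sup>2 = (Im ?p)\<^sup>2 + (Re ?p)\<^sup>2"
    unfolding add.commute[of "(Im ?p)\<^sup>2"] cmod_power2[symmetric] by (simp add: norm_mult)
  show "norm (phase \<beta> (Complex x \<theta>) d) \<le> 2 * \<beta> * cosh x * norm d"
  proof (rule power2_le_imp_le)
    show "(norm (phase \<beta> (Complex x \<theta>) d))\<^sup>2 \<le> (2 * \<beta> * cosh x * norm d)\<^sup>2"
      unfolding power_mult_distrib[of _ "norm d"] ph d distrib_left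
      by (intro add_mono mult_right_mono SC order_refl) simp_all
  qed (use assms in simp)
  show "2 * \<beta> * \<bar>sinh x\<bar> * norm d \<le> norm (phase \<beta> (Complex x \<theta>) d)"
  proof (rule power2_le_imp_le)
    have "(2 * \<beta> * \<bar>sinh x\<bar>)\<^sup>2 = ?S" by (simp add: power_mult_distrib)
    then show "(2 * \<beta> * \<bar>sinh x\<bar> * norm d)\<^sup>2 \<le> (norm (phase \<beta> (Complex x \<theta>) d))\<^sup>2"
      unfolding power_mult_distrib[of _ "norm d"] ph d distrib_left
      by (simp only:) (intro add_mono mult_right_mono SC order_refl; simp)
  qed simp
qed

lemma cosh_ge_quadratic: "1 + x\<^sup>2 \<le> 4 * cosh (x::real)"
proof -
  have "1 + \<bar>x\<bar> + \<bar>x\<bar>\<^sup>2 / 2 \<le> exp \<bar>x\<bar>" by (rule exp_lower_Taylor_quadratic) simp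
  also have "\<dots> \<le> 2 * cosh x" by (cases "x \<ge> 0") (simp_all add: cosh_def)
  finally show ?thesis by simp
qed

lemma power_le_exp: "t \<ge> 0 \<Longrightarrow> t ^ M \<le> fact M * exp (t::real)"
proof -
  assume t: "t \<ge> 0"
  have "norm (exp_rem (Suc M) (of_real t :: complex)) \<le> exp_rem (Suc M) t"
    by (rule norm_exp_rem_le) (use t in simp)
  then have "(\<Sum>k<Suc M. t ^ k / fact k) \<le> exp t"
    using order_trans[OF norm_ge_zero] by (fastforce simp: exp_rem_def)
  moreover have "t ^ M / fact M \<le> (\<Sum>k<Suc M. t ^ k / fact k)"
    using t by (intro member_le_sum) auto
  ultimately have "t ^ M / fact M \<le> exp t" by linarith
  then show ?thesis by (simp add: field_simps)
qed

lemma cosh_power_exp_decay: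
  assumes "c > 0"
  shows "\<exists>K. \<forall>x. cosh x ^ N * exp (- (c * cosh x)) \<le> K / (1 + (x::real)\<^sup>2)"
proof -
  \<comment> \<open>The additional power of \<open>cosh x\<close> pays for the denominator \<open>1 + x\<^sup>2 \<le> 4 cosh x\<close>.\<close>
  define K where "K = 4 * (fact (N + 1) / c ^ (N + 1))"
  have "cosh x ^ N * exp (- (c * cosh x)) \<le> K / (1 + x\<^sup>2)" for x :: real
  proof -
    have ch: "cosh x > 0" by (simp add: cosh_real_pos)
    have pos: "1 + x\<^sup>2 > 0" by (simp add: add_pos_nonneg)
    have "(c * cosh x) ^ (N + 1) \<le> fact (N + 1) * exp (c * cosh x)"
      by (rule power_le_exp) (use assms ch in simp)
    then have *: "cosh x ^ (N + 1) * exp (- (c * cosh x)) \<le> fact (N + 1) / c ^ (N + 1)"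
      using assms by (simp add: power_mult_distrib exp_minus field_simps)
    have "(1 + x\<^sup>2) * (cosh x ^ N * exp (- (c * cosh x))) \<le> 4 * cosh x * (cosh x ^ N * exp (- (c * cosh x)))"
      by (rule mult_right_mono[OF cosh_ge_quadratic]) (use ch in simp)
    also have "\<dots> = 4 * (cosh x ^ (N + 1) * exp (- (c * cosh x)))" by simp
    also have "\<dots> \<le> K" unfolding K_def using * by simp
    finally show ?thesis using pos by (simp add: field_simps)
  qed
  then show ?thesis by blast
qed

text \<open>
  For \<open>\<bar>k\<bar> = \<beta> exp x\<close> polynomial growth in \<open>\<bar>k\<bar>\<close> and
  \<open>1 / \<bar>k\<bar>\<close> means polynomial growth in \<open>cosh x\<close>.
\<close>

definition temperate :: "(real \<Rightarrow> complex) \<Rightarrow> bool"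
  where "temperate P \<longleftrightarrow> P \<in> borel_measurable borel \<and> (\<exists>C N. C \<ge> 0 \<and> (\<forall>x. norm (P x) \<le> C * cosh x ^ N))"

lemma continuous_on_Complex: "continuous_on S (\<lambda>x. Complex x \<theta>)"
  unfolding Complex_eq by (intro continuous_intros)

lemma continuous_on_phase [continuous_intros]:
  "continuous_on S f \<Longrightarrow> continuous_on S g \<Longrightarrow> continuous_on S (\<lambda>x. phase \<beta> (f x) (g x))"
  unfolding phase_def by (intro continuous_intros)

lemma phase_measurable: "(\<lambda>x. phase \<beta> (Complex x \<theta>) d) \<in> borel_measurable borel"
  by (intro borel_measurable_continuous_onI continuous_intros continuous_on_Complex)

lemma temperate_phase:
  assumes P: "temperate P" and "\<beta> \<ge> 0"
  shows "temperate (\<lambda>x. P x * phase \<beta> (Complex x \<theta>) d)"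
proof -
  obtain C N where C: "C \<ge> 0" "\<And>x. norm (P x) \<le> C * cosh x ^ N" using P unfolding temperate_def by blast
  have "norm (P x * phase \<beta> (Complex x \<theta>) d) \<le> (C * (2 * \<beta> * norm d)) * cosh x ^ Suc N" for x
    using mult_mono[OF C(2)[of x] norm_phase_le[OF \<open>\<beta> \<ge> 0\<close>, of x \<theta> d]] C(1)
    by (simp add: norm_mult algebra_simps cosh_real_nonneg)
  moreover have "C * (2 * \<beta> * norm d) \<ge> 0" using C(1) assms(2) by simp
  moreover have "(\<lambda>x. P x * phase \<beta> (Complex x \<theta>) d) \<in> borel_measurable borel"
    using P phase_measurable unfolding temperate_def by (intro borel_measurable_times) auto
  ultimately show ?thesis unfolding temperate_def by blast
qed

lemma temperate_exp_bound:
  assumes "temperate P" "c > 0"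
  shows "\<exists>K. \<forall>x. norm (P x) * cosh x ^ M * exp (- (c * cosh x)) \<le> K / (1 + x\<^sup>2)"
proof -
  obtain C N where C: "C \<ge> 0" "\<And>x. norm (P x) \<le> C * cosh x ^ N"
    using assms(1) unfolding temperate_def by blast
  obtain K where K: "\<And>x. cosh x ^ (N + M) * exp (- (c * cosh x)) \<le> K / (1 + (x::real)\<^sup>2)"
    using cosh_power_exp_decay[OF assms(2)] by blast
  have "norm (P x) * cosh x ^ M * exp (- (c * cosh x)) \<le> C * K / (1 + x\<^sup>2)" for x
  proof -
    have "norm (P x) * cosh x ^ M * exp (- (c * cosh x)) \<le> C * cosh x ^ N * cosh x ^ M * exp (- (c * cosh x))"
      by (intro mult_right_mono C(2)) (simp_all add: cosh_real_nonneg)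
    also have "\<dots> = C * (cosh x ^ (N + M) * exp (- (c * cosh x)))" by (simp add: power_add)
    also have "\<dots> \<le> C * (K / (1 + x\<^sup>2))" by (rule mult_left_mono[OF K C(1)])
    finally show ?thesis by simp
  qed
  then show ?thesis by blast
qed

section \<open>Superpositions of plane waves\<close>

definition wave_integral :: "real \<Rightarrow> real \<Rightarrow> (real \<Rightarrow> complex) \<Rightarrow> complex \<Rightarrow> complex"
  where "wave_integral \<beta> \<theta> P d = (LINT x|lborel. P x * exp (phase \<beta> (Complex x \<theta>) d))"

lemma wave_measurable: "temperate P \<Longrightarrow> (\<lambda>x. P x * exp (phase \<beta> (Complex x \<theta>) d)) \<in> borel_measurable borel"
  unfolding temperate_def
  by (intro borel_measurable_times borel_measurable_continuous_onI[of "\<lambda>x. exp (phase \<beta> (Complex x \<theta>) d)"]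
      continuous_intros continuous_on_Complex) auto

lemma wave_integrable:
  assumes "temperate P" "\<beta> > 0" "Im (cis \<theta> * d) > 0"
  shows "integrable lborel (\<lambda>x. P x * exp (phase \<beta> (Complex x \<theta>) d))"
proof -
  obtain K where K: "\<And>x. norm (P x) * cosh x ^ 0 * exp (- (2 * \<beta> * Im (cis \<theta> * d) * cosh x)) \<le> K / (1 + x\<^sup>2)"
    using temperate_exp_bound[OF assms(1), of "2 * \<beta> * Im (cis \<theta> * d)" 0] assms(2,3) by auto
  show ?thesis
  proof (rule integrable_over_one_plus_square[OF wave_measurable[OF assms(1)]])
    show "norm (P x * exp (phase \<beta> (Complex x \<theta>) d)) \<le> K / (1 + x\<^sup>2)" for x
      using K[of x] unfolding norm_mult norm_exp_phase by (simp add: mult_ac del: times_complex.sel cis.simps)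
  qed
qed

lemma exp_second_order: "norm (exp l - 1 - l) \<le> (norm l)\<^sup>2 * exp (norm (l::complex))"
proof -
  have "norm (exp l - 1 - l) \<le> exp \<bar>Re l\<bar> * (norm l)\<^sup>2"
    using Taylor_exp[of l 1] by (simp add: power2_eq_square diff_diff_eq)
  also have "\<dots> \<le> exp (norm l) * (norm l)\<^sup>2"
    by (intro mult_right_mono) (simp_all add: abs_Re_le_cmod)
  finally show ?thesis by (simp add: mult.commute)
qed

text \<open>
  A displacement \<open>d\<close> changes the exponent linearly, so the Taylor remainder of the exponential is
  quadratic in \<open>d\<close>. If \<open>d\<close> is smaller than half the distance \<open>y\<close> from
  the bounding line, the remainder uses up at most half of the exponential decay, and the other half absorbs
  the factor \<open>cosh\<^sup>2 x\<close>.
\<close>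

lemma wave_integral_has_derivative:
  assumes P: "temperate P" and b: "\<beta> > 0" and pos: "Im (cis \<theta> * c) > 0"
  shows "(wave_integral \<beta> \<theta> P has_derivative
    (\<lambda>d. of_real (Re d) * wave_integral \<beta> \<theta> (\<lambda>x. P x * phase \<beta> (Complex x \<theta>) 1) c
       + of_real (Im d) * wave_integral \<beta> \<theta> (\<lambda>x. P x * phase \<beta> (Complex x \<theta>) \<i>) c)) (at c)"
    (is "(_ has_derivative ?D) _")
proof -
  define y where "y = Im (cis \<theta> * c)"
  have y: "y > 0" using pos by (simp add: y_def)
  let ?w = "\<lambda>x. Complex x \<theta>"
  let ?e = "\<lambda>x. exp (phase \<beta> (?w x) c)"
  obtain K where K: "\<And>x. norm (P x) * cosh x ^ 2 * exp (- (\<beta> * y * cosh x)) \<le> K / (1 + x\<^sup>2)"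
    using temperate_exp_bound[OF P, of "\<beta> * y" 2] b y by auto
  have K0: "K \<ge> 0"
  proof -
    have "0 \<le> norm (P 0) * cosh 0 ^ 2 * exp (- (\<beta> * y * cosh 0))" by simp
    also have "\<dots> \<le> K / (1 + 0\<^sup>2)" by (rule K)
    finally show ?thesis by simp
  qed
  have P': "temperate (\<lambda>x. P x * phase \<beta> (?w x) d)" for d using temperate_phase[OF P] b by simp
  have D_eq: "?D d = (LINT x|lborel. P x * phase \<beta> (?w x) d * ?e x)" for d
  proof -
    have "(\<lambda>x. P x * phase \<beta> (?w x) d * ?e x) = (\<lambda>x. of_real (Re d) * (P x * phase \<beta> (?w x) 1 * ?e x)
        + of_real (Im d) * (P x * phase \<beta> (?w x) \<i> * ?e x))"
      by (subst phase_decompose) (simp add: algebra_simps)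
    then show ?thesis
      using wave_integrable[OF P'[of 1] b pos] wave_integrable[OF P'[of \<i>] b pos]
      by (simp add: wave_integral_def)
  qed
  define M where "M = (2 * \<beta>)\<^sup>2 * (K * pi)"
  have est: "norm (wave_integral \<beta> \<theta> P (c + d) - wave_integral \<beta> \<theta> P c - ?D d) \<le> M * (norm d)\<^sup>2"
    if d: "norm d < y / 2" for d
  proof -
    have "\<bar>Im (cis \<theta> * d)\<bar> \<le> norm (cis \<theta> * d)" by (rule abs_Im_le_cmod)
    then have Imd: "\<bar>Im (cis \<theta> * d)\<bar> < y / 2" using d by (simp add: norm_mult)
    have "Im (cis \<theta> * (c + d)) = y + Im (cis \<theta> * d)" unfolding y_def distrib_left by simp
    then have pos': "Im (cis \<theta> * (c + d)) > 0" using Imd y by linarith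
    let ?r = "\<lambda>x. P x * exp (phase \<beta> (?w x) (c + d)) - P x * ?e x - P x * phase \<beta> (?w x) d * ?e x"
    have int: "integrable lborel ?r"
      by (intro Bochner_Integration.integrable_diff wave_integrable P P' b pos pos')
    have eq: "wave_integral \<beta> \<theta> P (c + d) - wave_integral \<beta> \<theta> P c - ?D d = (LINT x|lborel. ?r x)"
      unfolding D_eq unfolding wave_integral_def
      using wave_integrable[OF P b pos'] wave_integrable[OF P b pos] wave_integrable[OF P' b pos]
      by simp
    have "norm (LINT x|lborel. ?r x) \<le> (LINT x|lborel. norm (?r x))" by (rule integral_norm_bound)
    also have "\<dots> \<le> (LINT x|lborel. (2 * \<beta>)\<^sup>2 * K * (norm d)\<^sup>2 * (1 / (1 + x\<^sup>2)))"
    proof (rule Bochner_Integration.integral_mono)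
      show "integrable lborel (\<lambda>x. (2 * \<beta>)\<^sup>2 * K * (norm d)\<^sup>2 * (1 / (1 + x\<^sup>2)))"
        by (rule integrable_majorant)
      show "norm (?r x) \<le> (2 * \<beta>)\<^sup>2 * K * (norm d)\<^sup>2 * (1 / (1 + x\<^sup>2))" for x
      proof -
        let ?l = "phase \<beta> (?w x) d"
        have l: "norm ?l \<le> 2 * \<beta> * cosh x * norm d" using norm_phase_le b by simp
        have "2 * \<beta> * cosh x * norm d \<le> 2 * \<beta> * cosh x * (y / 2)"
          using d b by (intro mult_left_mono) (simp_all add: cosh_real_nonneg)
        then have l2: "norm ?l \<le> \<beta> * y * cosh x" using l by (simp add: mult_ac)
        have "?r x = P x * ?e x * (exp ?l - 1 - ?l)" by (simp add: phase_add exp_add algebra_simps)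
        then have "norm (?r x) = norm (P x) * exp (- (2 * \<beta> * cosh x * y)) * norm (exp ?l - 1 - ?l)"
          by (simp only: norm_mult norm_exp_phase y_def)
        also have "\<dots> \<le> norm (P x) * exp (- (2 * \<beta> * cosh x * y)) * ((2 * \<beta> * cosh x * norm d)\<^sup>2 * exp (\<beta> * y * cosh x))"
          using order_trans[OF exp_second_order mult_mono[OF power_mono[OF l norm_ge_zero] _]] l2
          by (intro mult_left_mono) simp_all
        also have "\<dots> = (2 * \<beta>)\<^sup>2 * (norm d)\<^sup>2 * (norm (P x) * cosh x ^ 2 * (exp (- (2 * \<beta> * cosh x * y)) * exp (\<beta> * y * cosh x)))"
          by (simp add: power_mult_distrib mult_ac)
        also have "exp (- (2 * \<beta> * cosh x * y)) * exp (\<beta> * y * cosh x) = exp (- (\<beta> * y * cosh x))"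
          by (simp add: exp_add[symmetric] mult_ac)
        also have "(2 * \<beta>)\<^sup>2 * (norm d)\<^sup>2 * (norm (P x) * cosh x ^ 2 * exp (- (\<beta> * y * cosh x)))
            \<le> (2 * \<beta>)\<^sup>2 * (norm d)\<^sup>2 * (K / (1 + x\<^sup>2))"
          by (intro mult_left_mono K) simp
        finally show ?thesis by (simp add: mult_ac)
      qed
    qed (use int in simp)
    also have "\<dots> = M * (norm d)\<^sup>2"
      unfolding integral_mult_right_zero integral_inverse_one_plus_square M_def by simp
    finally show ?thesis unfolding eq .
  qed
  show ?thesis
  proof (rule has_derivativeI_sandwich[where e = "y / 2" and H = "\<lambda>d. M * norm (d - c)"])
    show "bounded_linear ?D"
      by (intro bounded_linear_add bounded_linear_mult_const bounded_linear_compose[OF bounded_linear_of_real]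
          bounded_linear_Re bounded_linear_Im)
    show "((\<lambda>d. M * norm (d - c)) \<longlongrightarrow> 0) (at c)" by (auto intro!: tendsto_eq_intros)
    fix d assume "d \<noteq> c" "dist d c < y / 2"
    then have "norm (wave_integral \<beta> \<theta> P d - wave_integral \<beta> \<theta> P c - ?D (d - c)) \<le> M * (norm (d - c))\<^sup>2"
      using est[of "d - c"] by (simp add: dist_norm)
    then show "norm (wave_integral \<beta> \<theta> P d - wave_integral \<beta> \<theta> P c - ?D (d - c)) / norm (d - c) \<le> M * norm (d - c)"
      using \<open>d \<noteq> c\<close> by (simp add: power2_eq_square pos_divide_le_eq mult.assoc)
  qed (use y in simp)
qed

lemma partials_of_has_derivative:
  assumes "(f has_derivative (\<lambda>d. of_real (Re d) * X + of_real (Im d) * Y)) (at z)"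
  shows "partial_x f z = X" "partial_y f z = Y"
proof -
  have 1: "((\<lambda>t::real. z + of_real t) has_derivative (\<lambda>t. of_real t)) (at 0)"
    by (auto intro!: derivative_eq_intros)
  have "((\<lambda>t::real. f (z + of_real t)) has_derivative
      (\<lambda>t. of_real (Re (of_real t)) * X + of_real (Im (of_real t)) * Y)) (at 0)"
    by (rule has_derivative_compose[OF 1]) (use assms in simp)
  then show "partial_x f z = X"
    unfolding partial_x_def by (intro vector_derivative_at) (simp add: has_vector_derivative_def scaleR_conv_of_real)
  have 2: "((\<lambda>t::real. z + \<i> * of_real t) has_derivative (\<lambda>t. \<i> * of_real t)) (at 0)"
    by (auto intro!: derivative_eq_intros)
  have "((\<lambda>t::real. f (z + \<i> * of_real t)) has_derivative
      (\<lambda>t. of_real (Re (\<i> * of_real t)) * X + of_real (Im (\<i> * of_real t)) * Y)) (at 0)"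
    by (rule has_derivative_compose[OF 2]) (use assms in simp)
  then show "partial_y f z = Y"
    unfolding partial_y_def by (intro vector_derivative_at) (simp add: has_vector_derivative_def scaleR_conv_of_real)
qed

definition superposition ::
    "real \<Rightarrow> nat \<Rightarrow> (nat \<Rightarrow> real) \<Rightarrow> (nat \<Rightarrow> complex) \<Rightarrow> (nat \<Rightarrow> real \<Rightarrow> complex) \<Rightarrow> complex \<Rightarrow> complex"
  where "superposition \<beta> n \<theta> p P w = (\<Sum>j<n. wave_integral \<beta> (\<theta> j) (P j) (w - p j))"

context
  fixes \<beta> :: real and n :: nat and \<theta> :: "nat \<Rightarrow> real" and p :: "nat \<Rightarrow> complex" and S :: "complex set"
  assumes b: "\<beta> > 0" and S: "open S"
    and pos: "\<And>w j. w \<in> S \<Longrightarrow> j < n \<Longrightarrow> Im (cis (\<theta> j) * (w - p j)) > 0"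
begin

text \<open>
  The density of the derivative in the direction \<open>d\<close>.
\<close>

definition amplify :: "complex \<Rightarrow> (nat \<Rightarrow> real \<Rightarrow> complex) \<Rightarrow> nat \<Rightarrow> real \<Rightarrow> complex"
  where "amplify d P j x = P j x * phase \<beta> (Complex x (\<theta> j)) d"

lemma temperate_amplify: "temperate (P j) \<Longrightarrow> temperate (amplify d P j)"
  using temperate_phase[of "P j" \<beta> "\<theta> j" d] b by (simp add: amplify_def[abs_def])

lemma superposition_has_derivative:
  assumes P: "\<And>j. j < n \<Longrightarrow> temperate (P j)" and w: "w \<in> S"
    and f: "\<And>w. w \<in> S \<Longrightarrow> f w = superposition \<beta> n \<theta> p P w"
  shows "(f has_derivative (\<lambda>d. of_real (Re d) * superposition \<beta> n \<theta> p (amplify 1 P) w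
    + of_real (Im d) * superposition \<beta> n \<theta> p (amplify \<i> P) w)) (at w)"
proof -
  have "((\<lambda>w. wave_integral \<beta> (\<theta> j) (P j) (w - p j)) has_derivative
      (\<lambda>d. of_real (Re d) * wave_integral \<beta> (\<theta> j) (amplify 1 P j) (w - p j)
         + of_real (Im d) * wave_integral \<beta> (\<theta> j) (amplify \<i> P j) (w - p j))) (at w)" if j: "j < n" for j
  proof -
    have "((\<lambda>w. w - p j) has_derivative (\<lambda>d. d)) (at w)" by (auto intro!: derivative_eq_intros)
    from has_derivative_compose[OF this wave_integral_has_derivative[OF P[OF j] b pos[OF w j]]]
    show ?thesis by (simp add: amplify_def[abs_def])
  qed
  then have "((\<lambda>w. superposition \<beta> n \<theta> p P w) has_derivative
      (\<lambda>d. \<Sum>j<n. of_real (Re d) * wave_integral \<beta> (\<theta> j) (amplify 1 P j) (w - p j)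
         + of_real (Im d) * wave_integral \<beta> (\<theta> j) (amplify \<i> P j) (w - p j))) (at w)"
    unfolding superposition_def by (intro has_derivative_sum) simp
  then have "((\<lambda>w. superposition \<beta> n \<theta> p P w) has_derivative
      (\<lambda>d. of_real (Re d) * superposition \<beta> n \<theta> p (amplify 1 P) w
    + of_real (Im d) * superposition \<beta> n \<theta> p (amplify \<i> P) w)) (at w)"
    by (simp add: superposition_def sum.distrib sum_distrib_left)
  then show ?thesis
    by (rule has_derivative_transform_within_open[OF _ S w]) (simp add: f)
qed

lemma superposition_partials:
  assumes P: "\<And>j. j < n \<Longrightarrow> temperate (P j)"
    and f: "\<And>w. w \<in> S \<Longrightarrow> f w = superposition \<beta> n \<theta> p P w" and w: "w \<in> S"
  shows "partial_x f w = superposition \<beta> n \<theta> p (amplify 1 P) w"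
    "partial_y f w = superposition \<beta> n \<theta> p (amplify \<i> P) w"
  using partials_of_has_derivative[OF superposition_has_derivative[OF P w f]] by simp_all

text \<open>
  The partial derivatives are superpositions with temperate densities again, so the claim follows by induction
  for all such densities at once.
\<close>

lemma superposition_Ck_on:
  assumes "\<And>j. j < n \<Longrightarrow> temperate (P j)"
    and "\<And>w. w \<in> S \<Longrightarrow> f w = superposition \<beta> n \<theta> p P w"
  shows "Ck_on k S f"
  using assms
proof (induction k arbitrary: f P)
  case (0 f P)
  have "f differentiable at w" if "w \<in> S" for w
    using superposition_has_derivative[OF 0(1) that 0(2)] differentiableI by blast
  then show ?case by (simp add: continuous_at_imp_continuous_on differentiable_imp_continuous_within)
next
  case (Suc k f P)
  have "f differentiable at w" if "w \<in> S" for w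
    using superposition_has_derivative[OF Suc.prems(1) that Suc.prems(2)] differentiableI by blast
  then have "f differentiable_on S"
    by (simp add: differentiable_at_imp_differentiable_on)
  moreover have "Ck_on k S (partial_x f)"
    by (rule Suc.IH[of "amplify 1 P"]) (use Suc.prems temperate_amplify superposition_partials(1) in auto)
  moreover have "Ck_on k S (partial_y f)"
    by (rule Suc.IH[of "amplify \<i> P"]) (use Suc.prems temperate_amplify superposition_partials(2) in auto)
  ultimately show ?case by simp
qed

lemma superposition_laplacian:
  assumes P: "\<And>j. j < n \<Longrightarrow> temperate (P j)"
    and f: "\<And>w. w \<in> S \<Longrightarrow> f w = superposition \<beta> n \<theta> p P w" and w: "w \<in> S"
  shows "laplacian f w = 4 * of_real (\<beta>\<^sup>2) * f w"
proof -
  have A: "\<And>j. j < n \<Longrightarrow> temperate (amplify d P j)" for d using P temperate_amplify by blast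
  have AA: "temperate (amplify d (amplify d P) j)" if "j < n" for d j
    using A[OF that] temperate_amplify by blast
  have x: "partial_x (partial_x f) w = superposition \<beta> n \<theta> p (amplify 1 (amplify 1 P)) w"
  proof (rule superposition_partials(1)[OF _ _ w])
    show "temperate (amplify 1 P j)" if "j < n" for j by (rule A[OF that])
  qed (rule superposition_partials(1)[OF P f])
  have y: "partial_y (partial_y f) w = superposition \<beta> n \<theta> p (amplify \<i> (amplify \<i> P)) w"
  proof (rule superposition_partials(2)[OF _ _ w])
    show "temperate (amplify \<i> P j)" if "j < n" for j by (rule A[OF that])
  qed (rule superposition_partials(2)[OF P f])
  have sq: "phase \<beta> v 1 * phase \<beta> v 1 + phase \<beta> v \<i> * phase \<beta> v \<i> = 4 * of_real (\<beta>\<^sup>2)" for v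
  proof -
    have "exp v * exp (- v) = 1" by (simp add: exp_add[symmetric])
    moreover have "phase \<beta> v 1 * phase \<beta> v 1 + phase \<beta> v \<i> * phase \<beta> v \<i>
        = 4 * of_real (\<beta>\<^sup>2) * (exp v * exp (- v))"
      by (simp add: phase_def algebra_simps power2_eq_square)
    ultimately show ?thesis by simp
  qed
  have "wave_integral \<beta> (\<theta> j) (amplify 1 (amplify 1 P) j) (w - p j)
      + wave_integral \<beta> (\<theta> j) (amplify \<i> (amplify \<i> P) j) (w - p j)
      = 4 * of_real (\<beta>\<^sup>2) * wave_integral \<beta> (\<theta> j) (P j) (w - p j)" if j: "j < n" for j
  proof -
    let ?e = "\<lambda>x. exp (phase \<beta> (Complex x (\<theta> j)) (w - p j))"
    have "wave_integral \<beta> (\<theta> j) (amplify 1 (amplify 1 P) j) (w - p j)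
      + wave_integral \<beta> (\<theta> j) (amplify \<i> (amplify \<i> P) j) (w - p j)
      = (LINT x|lborel. amplify 1 (amplify 1 P) j x * ?e x + amplify \<i> (amplify \<i> P) j x * ?e x)"
      unfolding wave_integral_def
      by (rule Bochner_Integration.integral_add[symmetric]) (intro wave_integrable AA j b pos w)+
    also have "\<dots> = (LINT x|lborel. 4 * of_real (\<beta>\<^sup>2) * (P j x * ?e x))"
    proof (intro Bochner_Integration.integral_cong refl)
      fix x
      have "amplify 1 (amplify 1 P) j x * ?e x + amplify \<i> (amplify \<i> P) j x * ?e x
        = (phase \<beta> (Complex x (\<theta> j)) 1 * phase \<beta> (Complex x (\<theta> j)) 1
          + phase \<beta> (Complex x (\<theta> j)) \<i> * phase \<beta> (Complex x (\<theta> j)) \<i>) * (P j x * ?e x)"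
        by (simp add: amplify_def algebra_simps)
      then show "amplify 1 (amplify 1 P) j x * ?e x + amplify \<i> (amplify \<i> P) j x * ?e x
        = 4 * of_real (\<beta>\<^sup>2) * (P j x * ?e x)" unfolding sq .
    qed
    finally show ?thesis by (simp add: wave_integral_def)
  qed
  then show ?thesis
    unfolding laplacian_def x y f[OF w] superposition_def
    by (simp add: sum.distrib[symmetric] sum_distrib_left)
qed

end

section \<open>Rotation of the contour\<close>

text \<open>
  By means of a primitive \<open>F\<close> of \<open>H\<close>, the difference of the integrals over \<open>[-
  r, r]\<close> is expressed by increments of \<open>F\<close> along vertical segments of fixed length at
  \<open>r\<close> and \<open>- r\<close>, where \<open>H\<close> is small.
\<close>

lemma rotate_contour:
  assumes H: "H holomorphic_on UNIV"
    and bound: "\<And>x t. t \<in> closed_segment \<theta>1 \<theta>2 \<Longrightarrow> norm (H (Complex x t)) \<le> C / (1 + x\<^sup>2)"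
  shows "(LINT x|lborel. H (Complex x \<theta>1)) = (LINT x|lborel. H (Complex x \<theta>2))"
proof -
  obtain F where F: "\<And>w. (F has_field_derivative H w) (at w)"
    using holomorphic_convex_primitive'[OF convex_UNIV open_UNIV H] by auto
  have Hc: "continuous_on S (\<lambda>x. H (Complex x t))" for S t
    by (rule continuous_on_compose2[OF holomorphic_on_imp_continuous_on[OF H] continuous_on_Complex]) simp
  have int: "integrable lborel (\<lambda>x. H (Complex x t))" if "t \<in> closed_segment \<theta>1 \<theta>2" for t
    by (rule integrable_over_one_plus_square[OF borel_measurable_continuous_onI[OF Hc] bound[OF that]])
  have ftc: "integral {-r..r} (\<lambda>x. H (Complex x t)) = F (Complex r t) - F (Complex (- r) t)" if "r \<ge> 0" for r t
  proof (rule integral_unique, rule fundamental_theorem_of_calculus)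
    fix x assume "x \<in> {-r..r}"
    have "((\<lambda>y. y + \<i> * of_real t) has_field_derivative 1) (at (complex_of_real x))"
      by (auto intro!: derivative_eq_intros)
    from DERIV_chain2[OF F this]
    have "((\<lambda>y. F (y + \<i> * of_real t)) has_field_derivative H (Complex x t)) (at (of_real x))"
      by (simp add: Complex_eq)
    from has_vector_derivative_real_field[OF this]
    show "((\<lambda>x. F (Complex x t)) has_vector_derivative H (Complex x t)) (at x within {-r..r})"
      by (simp add: Complex_eq)
  qed (use that in simp)
  have vert: "norm (F (Complex r \<theta>1) - F (Complex r \<theta>2)) \<le> C / (1 + r\<^sup>2) * \<bar>\<theta>1 - \<theta>2\<bar>" for r
  proof -
    have "norm (F (Complex r \<theta>1) - F (Complex r \<theta>2)) \<le> C / (1 + r\<^sup>2) * norm (Complex r \<theta>1 - Complex r \<theta>2)"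
    proof (rule field_differentiable_bound)
      show "(F has_field_derivative H w) (at w within closed_segment (Complex r \<theta>1) (Complex r \<theta>2))" for w
        using F by (rule has_field_derivative_at_within)
      fix w assume "w \<in> closed_segment (Complex r \<theta>1) (Complex r \<theta>2)"
      then obtain s where s: "0 \<le> s" "s \<le> 1" "w = (1 - s) *\<^sub>R Complex r \<theta>1 + s *\<^sub>R Complex r \<theta>2"
        by (auto simp: closed_segment_def)
      have "w = Complex r ((1 - s) * \<theta>1 + s * \<theta>2)" unfolding s(3) by (simp add: complex_eq_iff algebra_simps)
      moreover have "(1 - s) * \<theta>1 + s * \<theta>2 \<in> closed_segment \<theta>1 \<theta>2" using s(1,2) by (auto simp: closed_segment_def)
      ultimately show "norm (H w) \<le> C / (1 + r\<^sup>2)" using bound by simp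
    qed auto
    moreover have "norm (Complex r \<theta>1 - Complex r \<theta>2) = \<bar>\<theta>1 - \<theta>2\<bar>" by (simp add: cmod_def)
    ultimately show ?thesis by simp
  qed
  have "((\<lambda>r. C / (1 + r\<^sup>2) * \<bar>\<theta>1 - \<theta>2\<bar> * 2) \<longlongrightarrow> 0 * \<bar>\<theta>1 - \<theta>2\<bar> * 2) at_top"
    by (intro tendsto_intros real_tendsto_divide_at_top[OF tendsto_const]
        filterlim_tendsto_add_at_top[OF tendsto_const] filterlim_pow_at_top filterlim_ident) simp
  then have "((\<lambda>r. C / (1 + r\<^sup>2) * \<bar>\<theta>1 - \<theta>2\<bar> * 2) \<longlongrightarrow> 0) at_top" by simp
  moreover have "\<forall>\<^sub>F r in at_top. norm (integral {-r..r} (\<lambda>x. H (Complex x \<theta>1)) - integral {-r..r} (\<lambda>x. H (Complex x \<theta>2)))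
      \<le> C / (1 + r\<^sup>2) * \<bar>\<theta>1 - \<theta>2\<bar> * 2"
    using eventually_ge_at_top[of "0::real"]
  proof eventually_elim
    case (elim r)
    have "norm ((F (Complex r \<theta>1) - F (Complex r \<theta>2)) - (F (Complex (- r) \<theta>1) - F (Complex (- r) \<theta>2)))
        \<le> norm (F (Complex r \<theta>1) - F (Complex r \<theta>2)) + norm (F (Complex (- r) \<theta>1) - F (Complex (- r) \<theta>2))"
      by (rule norm_triangle_ineq4)
    also have "\<dots> \<le> C / (1 + r\<^sup>2) * \<bar>\<theta>1 - \<theta>2\<bar> + C / (1 + (- r)\<^sup>2) * \<bar>\<theta>1 - \<theta>2\<bar>"
      by (intro add_mono vert)
    also have "\<dots> = C / (1 + r\<^sup>2) * \<bar>\<theta>1 - \<theta>2\<bar> * 2" by simp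
    also have "(F (Complex r \<theta>1) - F (Complex r \<theta>2)) - (F (Complex (- r) \<theta>1) - F (Complex (- r) \<theta>2))
        = (F (Complex r \<theta>1) - F (Complex (- r) \<theta>1)) - (F (Complex r \<theta>2) - F (Complex (- r) \<theta>2))"
      by simp
    finally show ?case unfolding ftc[OF elim] .
  qed
  ultimately have "((\<lambda>r. integral {-r..r} (\<lambda>x. H (Complex x \<theta>1)) - integral {-r..r} (\<lambda>x. H (Complex x \<theta>2))) \<longlongrightarrow> 0) at_top"
    by (rule Lim_null_comparison[rotated])
  moreover have "((\<lambda>r. integral {-r..r} (\<lambda>x. H (Complex x \<theta>1)) - integral {-r..r} (\<lambda>x. H (Complex x \<theta>2)))
      \<longlongrightarrow> (LINT x|lborel. H (Complex x \<theta>1)) - (LINT x|lborel. H (Complex x \<theta>2))) at_top"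
    by (intro tendsto_diff integral_symmetric_interval_tendsto int) simp_all
  ultimately have "(LINT x|lborel. H (Complex x \<theta>1)) - (LINT x|lborel. H (Complex x \<theta>2)) = 0"
    by (intro tendsto_unique[OF _ _, of at_top]) (auto simp: trivial_limit_at_top_linorder)
  then show ?thesis by simp
qed

text \<open>
  Inside an angle less than \<open>\<pi>\<close> every direction is a non-negative combination of the two
  bordering directions.
\<close>

lemma sector_nonneg:
  assumes t: "t \<in> closed_segment \<theta>1 \<theta>2" and less: "\<bar>\<theta>1 - \<theta>2\<bar> < pi"
    and "Im (cis \<theta>1 * d) \<ge> 0" "Im (cis \<theta>2 * d) \<ge> 0"
  shows "Im (cis t * d) \<ge> 0"
proof -
  have main: "Im (cis t * d) \<ge> 0"
    if "\<theta>1 < \<theta>2" "\<theta>1 \<le> t" "t \<le> \<theta>2" "\<theta>2 - \<theta>1 < pi" "Im (cis \<theta>1 * d) \<ge> 0" "Im (cis \<theta>2 * d) \<ge> 0" for \<theta>1 \<theta>2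
  proof -
    have "sin (\<theta>2 - \<theta>1) * Im (cis t * d) = sin (\<theta>2 - t) * Im (cis \<theta>1 * d) + sin (t - \<theta>1) * Im (cis \<theta>2 * d)"
    proof -
      have "sin (\<theta>2 - \<theta>1) * cos t = sin (\<theta>2 - t) * cos \<theta>1 + sin (t - \<theta>1) * cos \<theta>2"
        "sin (\<theta>2 - \<theta>1) * sin t = sin (\<theta>2 - t) * sin \<theta>1 + sin (t - \<theta>1) * sin \<theta>2"
        by (simp_all add: sin_diff algebra_simps)
      moreover have "sin (\<theta>2 - \<theta>1) * Im (cis t * d)
          = (sin (\<theta>2 - \<theta>1) * cos t) * Im d + (sin (\<theta>2 - \<theta>1) * sin t) * Re d" by (simp add: algebra_simps)
      ultimately show ?thesis by (simp add: algebra_simps)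
    qed
    also have "\<dots> \<ge> 0"
      using that by (intro add_nonneg_nonneg mult_nonneg_nonneg sin_ge_zero) auto
    finally show ?thesis
      using sin_gt_zero[of "\<theta>2 - \<theta>1"] that by (simp add: zero_le_mult_iff del: times_complex.sel)
  qed
  consider "\<theta>1 < \<theta>2" | "\<theta>2 < \<theta>1" | "\<theta>1 = \<theta>2" by linarith
  then show ?thesis
  proof cases
    case 1
    then have "\<theta>1 \<le> t" "t \<le> \<theta>2" using t by (auto simp: closed_segment_eq_real_ivl)
    then show ?thesis using main[OF 1] less assms(3,4) by linarith
  next
    case 2
    then have "\<theta>2 \<le> t" "t \<le> \<theta>1" using t by (auto simp: closed_segment_eq_real_ivl)
    then show ?thesis using main[OF 2] less assms(3,4) by linarith
  next
    case 3
    then show ?thesis using t assms(3) by simp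
  qed
qed

section \<open>The spectral functions in logarithmic coordinates\<close>

text \<open>
  In the coordinate \<open>k = \<beta> exp (x + \<i>\<theta>)\<close> the measure \<open>dk / k\<close> is
  \<open>dx\<close>.
\<close>

lemma ray_integral_log:
  assumes b: "\<beta> > 0" and H: "integrable lborel H" "H \<in> borel_measurable borel"
    and G: "\<And>x. G (of_real \<beta> * exp (Complex x \<theta>)) = H x"
  shows "ray_integral \<theta> (\<lambda>k. G k / k) = (LINT x|lborel. H x)"
proof -
  let ?g = "\<lambda>x. \<beta> * exp x"
  let ?f = "\<lambda>t. indicator {0<..} t *\<^sub>R (H (ln (t / \<beta>)) / of_real t)"
  have e: "of_real (?g x) * cis \<theta> = of_real \<beta> * exp (Complex x \<theta>)" for x
    by (simp add: exp_eq_polar)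
  have range: "range ?g = {0<..}"
  proof (intro equalityI subsetI)
    fix t :: real assume "t \<in> {0<..}"
    then have "t = ?g (ln (t / \<beta>))" using b by simp
    then show "t \<in> range ?g" by blast
  qed (use b in auto)
  have f: "?f (?g x) = H x / of_real (?g x)" for x
    using b by simp
  have sc: "\<bar>?g x\<bar> *\<^sub>R ?f (?g x) = H x" for x
    unfolding f using b by (simp add: scaleR_conv_of_real)
  have "ray_integral \<theta> (\<lambda>k. G k / k) = (LINT t:{0<..}|lborel. ?f t)"
    unfolding ray_integral_def set_lebesgue_integral_def
  proof (intro Bochner_Integration.integral_cong refl)
    fix t :: real
    show "indicator {0<..} t *\<^sub>R (G (of_real t * cis \<theta>) / (of_real t * cis \<theta>) * cis \<theta>) = indicator {0<..} t *\<^sub>R ?f t"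
    proof (cases "t > 0")
      case True
      then obtain x where x: "t = ?g x" using range by (metis greaterThan_iff imageE)
      have "G (of_real t * cis \<theta>) = H x" unfolding x e by (rule G)
      moreover have "?f t = H x / of_real t" unfolding x by (rule f)
      ultimately show ?thesis by simp
    qed simp
  qed
  also have "\<dots> = (LINT t:range ?g|lborel. ?f t)" unfolding range ..
  also have "\<dots> = (LINT x|lborel. \<bar>?g x\<bar> *\<^sub>R ?f (?g x))"
  proof (rule lborel_integral_substitution)
    show "(?g has_field_derivative ?g x) (at x)" for x by (auto intro!: derivative_eq_intros)
    show "inj ?g" using b by (auto intro!: injI)
    show "range ?g \<in> sets borel" unfolding range by simp
    show "?f \<in> borel_measurable borel" using H(2) by measurable
    show "integrable lborel (\<lambda>x. \<bar>?g x\<bar> *\<^sub>R ?f (?g x))" unfolding sc by (rule H(1))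
  qed
  also have "\<dots> = (LINT x|lborel. H x)" unfolding sc ..
  finally show ?thesis .
qed

lemma exp_kernel_log:
  assumes "\<beta> > 0"
  shows "exp_kernel \<beta> (of_real \<beta> * exp w) d = exp (- phase \<beta> w d)"
    "exp (\<i> * (of_real \<beta> * exp w) * d - \<i> * of_real (\<beta>\<^sup>2) * cnj d / (of_real \<beta> * exp w)) = exp (phase \<beta> w d)"
proof -
  have "\<i> * of_real (\<beta>\<^sup>2) * cnj d / (of_real \<beta> * exp w) = \<i> * of_real \<beta> * (exp (- w) * cnj d)"
    using assms by (simp add: power2_eq_square exp_minus field_simps)
  then show "exp_kernel \<beta> (of_real \<beta> * exp w) d = exp (- phase \<beta> w d)"
    "exp (\<i> * (of_real \<beta> * exp w) * d - \<i> * of_real (\<beta>\<^sup>2) * cnj d / (of_real \<beta> * exp w)) = exp (phase \<beta> w d)"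
    unfolding exp_kernel_def phase_def by (simp_all add: algebra_simps)
qed

text \<open>
  The spectral function of a side \<open>v\<close> whose starting point has been moved to the origin, in the
  coordinate \<open>w\<close>. Here \<open>T\<close> stands for the Dirichlet datum and \<open>U\<close> for
  the Neumann datum.
\<close>

definition strength ::
    "real \<Rightarrow> complex \<Rightarrow> ((real \<Rightarrow> complex) \<Rightarrow> complex) \<Rightarrow> ((real \<Rightarrow> complex) \<Rightarrow> complex) \<Rightarrow> complex \<Rightarrow> complex"
  where "strength \<beta> v T U w = \<i> * of_real (norm v) *
    (laplace U (- phase \<beta> w v) + of_real \<beta> * (exp w * sgn v + exp (- w) * cnj (sgn v)) * laplace T (- phase \<beta> w v))"

lemma spectral_fun_log:
  assumes b: "\<beta> > 0" and q: "finite_order (q j) N C" and dq: "finite_order (dq j) N' C'"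
    and v: "side_vec n z j \<noteq> 0"
  shows "spectral_fun \<beta> n z q dq j (of_real \<beta> * exp w)
    = exp (- phase \<beta> w (z j)) * strength \<beta> (side_vec n z j) (q j) (dq j) w"
proof -
  let ?v = "side_vec n z j" and ?c = "exp (- phase \<beta> w (z j))"
  have u: "cis (side_angle n z j) = sgn ?v" using v by (simp add: side_angle_def cis_Arg)
  have "side_param n z j t = z j + of_real t * ?v" for t
    by (simp add: side_param_def side_vec_def algebra_simps)
  then have e: "(\<lambda>t. exp_kernel \<beta> (of_real \<beta> * exp w) (side_param n z j t)) = (\<lambda>t. ?c * exp (- phase \<beta> w ?v * of_real t))"
    by (simp add: exp_kernel_log[OF b] phase_add phase_of_real exp_diff exp_minus field_simps)
  have inv: "1 / sgn ?v = cnj (sgn ?v)"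
    unfolding u[symmetric] by (simp add: cis_cnj divide_inverse cis_inverse)
  have "of_real (\<beta>\<^sup>2) / (of_real \<beta> * exp w * sgn ?v) = of_real \<beta> * (exp (- w) * (1 / sgn ?v))"
    using b by (simp add: power2_eq_square exp_minus field_simps)
  then have k: "of_real \<beta> * exp w * sgn ?v + of_real (\<beta>\<^sup>2) / (of_real \<beta> * exp w * sgn ?v)
      = of_real \<beta> * (exp w * sgn ?v + exp (- w) * cnj (sgn ?v))"
    unfolding inv by (simp add: distrib_left)
  show ?thesis
    unfolding spectral_fun_def Let_def u e k strength_def laplace_def
      finite_order_scale[OF q exp_in_E01] finite_order_scale[OF dq exp_in_E01]
    by (simp add: algebra_simps)
qed

lemma strength_holomorphic:
  assumes "finite_order T N C" "finite_order U N' C'"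
  shows "strength \<beta> v T U holomorphic_on S"
proof -
  have ph: "(\<lambda>w. - phase \<beta> w v) holomorphic_on S" unfolding phase_def by (intro holomorphic_intros)
  have L: "(\<lambda>w. laplace R (- phase \<beta> w v)) holomorphic_on S" if "finite_order R M B" for R M B
    using holomorphic_on_compose[OF ph laplace_holomorphic[OF that]] by (simp add: o_def)
  show ?thesis
    unfolding strength_def[abs_def] by (intro holomorphic_intros L[OF assms(1)] L[OF assms(2)])
qed

lemma laplace_phase_bound:
  assumes T: "finite_order T N C" and b: "\<beta> \<ge> 0"
  shows "norm (laplace T (- phase \<beta> (Complex x \<theta>) v))
    \<le> C * (1 + 2 * \<beta> * norm v) ^ N * cosh x ^ N * max 1 (exp (- Re (phase \<beta> (Complex x \<theta>) v)))"
proof -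
  let ?a = "- phase \<beta> (Complex x \<theta>) v"
  have "1 + norm ?a \<le> 1 + 2 * \<beta> * cosh x * norm v" using norm_phase_le[OF b] by simp
  also have "\<dots> \<le> (1 + 2 * \<beta> * norm v) * cosh x" using cosh_real_ge_1[of x] by (simp add: algebra_simps)
  finally have "(1 + norm ?a) ^ N \<le> ((1 + 2 * \<beta> * norm v) * cosh x) ^ N" by (intro power_mono) auto
  then have "(1 + norm ?a) ^ N * max 1 (exp (Re ?a)) \<le> ((1 + 2 * \<beta> * norm v) * cosh x) ^ N * max 1 (exp (Re ?a))"
    by (intro mult_right_mono) auto
  from order_trans[OF laplace_bound[OF T, of ?a] mult_left_mono[OF this finite_order_nonneg[OF T]]]
  show ?thesis by (simp add: power_mult_distrib mult.assoc)
qed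

lemma strength_bound:
  assumes T: "finite_order T N C" and U: "finite_order U N' C'" and b: "\<beta> \<ge> 0"
  shows "\<exists>K M. K \<ge> 0 \<and> (\<forall>x \<theta>. norm (strength \<beta> v T U (Complex x \<theta>))
    \<le> K * cosh x ^ M * max 1 (exp (- Re (phase \<beta> (Complex x \<theta>) v))))"
proof -
  define c where "c = 1 + 2 * \<beta> * norm v"
  define M where "M = N + N' + 1"
  define K where "K = norm v * (C' * c ^ N' + 2 * \<beta> * (C * c ^ N))"
  have C: "C \<ge> 0" "C' \<ge> 0" using finite_order_nonneg T U by blast+
  have c0: "c \<ge> 0" using b by (simp add: c_def)
  have "norm (strength \<beta> v T U (Complex x \<theta>)) \<le> K * cosh x ^ M * max 1 (exp (- Re (phase \<beta> (Complex x \<theta>) v)))" for x \<theta>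
  proof -
    let ?w = "Complex x \<theta>" and ?m = "max 1 (exp (- Re (phase \<beta> (Complex x \<theta>) v)))"
    have ch: "cosh x \<ge> 1" by (rule cosh_real_ge_1)
    have "norm (exp ?w * sgn v + exp (- ?w) * cnj (sgn v)) \<le> exp x * 1 + exp (- x) * 1"
      by (intro order_trans[OF norm_triangle_ineq] add_mono) (simp_all add: norm_mult norm_sgn)
    then have 1: "norm (of_real \<beta> * (exp ?w * sgn v + exp (- ?w) * cnj (sgn v))) \<le> 2 * \<beta> * cosh x"
      using mult_left_mono[of _ _ \<beta>] b by (simp add: norm_mult cosh_def)
    have U1: "norm (laplace U (- phase \<beta> ?w v)) \<le> C' * c ^ N' * cosh x ^ M * ?m"
    proof -
      have "C' * c ^ N' * cosh x ^ N' * ?m \<le> C' * c ^ N' * cosh x ^ M * ?m"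
        using C c0 ch by (intro mult_right_mono mult_left_mono power_increasing) (auto simp: M_def)
      then show ?thesis using laplace_phase_bound[OF U b, of x \<theta> v] by (simp add: c_def)
    qed
    have T1: "norm (of_real \<beta> * (exp ?w * sgn v + exp (- ?w) * cnj (sgn v)) * laplace T (- phase \<beta> ?w v))
        \<le> 2 * \<beta> * (C * c ^ N) * cosh x ^ M * ?m"
    proof -
      have "norm (of_real \<beta> * (exp ?w * sgn v + exp (- ?w) * cnj (sgn v)) * laplace T (- phase \<beta> ?w v))
        \<le> 2 * \<beta> * cosh x * (C * c ^ N * cosh x ^ N * ?m)"
        unfolding norm_mult[of _ "laplace T _"]
        using 1 laplace_phase_bound[OF T b, of x \<theta> v] b ch by (intro mult_mono) (auto simp: c_def)
      also have "\<dots> = 2 * \<beta> * (C * c ^ N) * cosh x ^ Suc N * ?m" by (simp add: mult_ac)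
      also have "\<dots> \<le> 2 * \<beta> * (C * c ^ N) * cosh x ^ M * ?m"
        using C c0 ch b by (intro mult_right_mono mult_left_mono power_increasing) (auto simp: M_def)
      finally show ?thesis .
    qed
    have "norm (strength \<beta> v T U ?w) = norm v * norm (laplace U (- phase \<beta> ?w v)
        + of_real \<beta> * (exp ?w * sgn v + exp (- ?w) * cnj (sgn v)) * laplace T (- phase \<beta> ?w v))"
      by (simp add: strength_def norm_mult)
    also have "\<dots> \<le> norm v * (C' * c ^ N' * cosh x ^ M * ?m + 2 * \<beta> * (C * c ^ N) * cosh x ^ M * ?m)"
      by (intro mult_left_mono order_trans[OF norm_triangle_ineq] add_mono U1 T1) simp
    also have "\<dots> = K * cosh x ^ M * ?m" by (simp add: K_def algebra_simps)
    finally show ?thesis .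
  qed
  moreover have "K \<ge> 0" using C c0 b by (simp add: K_def)
  ultimately show ?thesis by blast
qed

text \<open>
  The phase is at least of the size of \<open>sinh x\<close> on every ray, so the rapid decay of the transform
  is uniform in the angle.
\<close>

lemma hat_phase_bound:
  assumes g: "test_chain g" and b: "\<beta> > 0" and \<delta>: "\<delta> > 0"
  shows "\<exists>K\<ge>0. \<forall>x \<theta> d. norm d \<ge> \<delta> \<longrightarrow> cosh x ^ M * norm (hat (g 0) (phase \<beta> (Complex x \<theta>) d))
    \<le> K * max 1 (exp (Re (phase \<beta> (Complex x \<theta>) d)))"
proof -
  obtain K0 KM where K0: "K0 \<ge> 0" "\<And>a. norm a ^ 0 * norm (hat (g 0) a) \<le> K0 * max 1 (exp (Re a))"
    and KM: "KM \<ge> 0" "\<And>a. norm a ^ M * norm (hat (g 0) a) \<le> KM * max 1 (exp (Re a))"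
    using hat_decay[OF g, of 0] hat_decay[OF g, of M] by blast
  define c where "c = (2 * \<beta> * \<delta>) ^ M"
  have c: "c > 0" using b \<delta> by (simp add: c_def)
  define K where "K = 2 ^ M * (K0 + KM / c)"
  have "cosh x ^ M * norm (hat (g 0) (phase \<beta> (Complex x \<theta>) d)) \<le> K * max 1 (exp (Re (phase \<beta> (Complex x \<theta>) d)))"
    if d: "norm d \<ge> \<delta>" for x \<theta> d
  proof -
    let ?a = "phase \<beta> (Complex x \<theta>) d" and ?s = "\<bar>sinh x\<bar>"
    let ?m = "max 1 (exp (Re ?a))" and ?h = "norm (hat (g 0) ?a)"
    have "(cosh x)\<^sup>2 \<le> (1 + ?s)\<^sup>2" unfolding cosh_square_eq by (simp add: power2_sum)
    then have "cosh x \<le> 1 + ?s" by (rule power2_le_imp_le) simp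
    then have "cosh x ^ M \<le> (2 * max 1 ?s) ^ M"
      by (intro power_mono) (auto simp: cosh_real_nonneg max_def)
    also have "\<dots> = 2 ^ M * max 1 ?s ^ M" by (simp add: power_mult_distrib)
    also have "\<dots> \<le> 2 ^ M * (1 + ?s ^ M)" by (intro mult_left_mono) (auto simp: max_def)
    finally have 1: "cosh x ^ M * ?h \<le> 2 ^ M * (1 + ?s ^ M) * ?h" by (intro mult_right_mono) auto
    have "2 * \<beta> * \<delta> * ?s \<le> 2 * \<beta> * ?s * norm d"
      using mult_left_mono[OF d, of "2 * \<beta> * ?s"] b by (simp add: mult_ac)
    from order_trans[OF this norm_phase_ge[OF less_imp_le[OF b]]]
    have "2 * \<beta> * \<delta> * ?s \<le> norm ?a" .
    then have "(2 * \<beta> * \<delta> * ?s) ^ M \<le> norm ?a ^ M" using b \<delta> by (intro power_mono) auto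
    then have "c * ?s ^ M * ?h \<le> norm ?a ^ M * ?h"
      unfolding c_def by (intro mult_right_mono) (simp_all add: power_mult_distrib)
    then have "c * (?s ^ M * ?h) \<le> KM * ?m" using KM(2)[of ?a] by simp
    then have "?s ^ M * ?h \<le> KM / c * ?m" using c by (simp add: field_simps)
    moreover have "?h \<le> K0 * ?m" using K0(2)[of ?a] by simp
    ultimately have "(1 + ?s ^ M) * ?h \<le> (K0 + KM / c) * ?m" by (simp only: distrib_right mult_1_left add_mono)
    then have "2 ^ M * ((1 + ?s ^ M) * ?h) \<le> 2 ^ M * ((K0 + KM / c) * ?m)" by (intro mult_left_mono) auto
    with 1 show ?thesis unfolding K_def by (simp only: mult.assoc order_trans)
  qed
  moreover have "K \<ge> 0" using K0 KM c by (simp add: K_def)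
  ultimately show ?thesis by blast
qed

text \<open>
  The contribution of the side from \<open>p\<close> to \<open>p + v\<close>, tested with
  \<open>\<phi>\<close> on the segment from \<open>a\<close> to \<open>a + d\<close>.
\<close>

definition trace_density ::
    "real \<Rightarrow> complex \<Rightarrow> complex \<Rightarrow> ((real \<Rightarrow> complex) \<Rightarrow> complex) \<Rightarrow> ((real \<Rightarrow> complex) \<Rightarrow> complex) \<Rightarrow>
     (real \<Rightarrow> complex) \<Rightarrow> complex \<Rightarrow> complex \<Rightarrow> complex \<Rightarrow> complex"
  where "trace_density \<beta> p v T U \<phi> a d w =
    exp (phase \<beta> w (a - p)) * strength \<beta> v T U w * hat \<phi> (phase \<beta> w d)"

text \<open>
  The exponential factors of \<open>strength\<close> and \<open>hat\<close> and the wave from \<open>p\<close>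
  to \<open>a\<close> combine to the modulus of a wave from an end point of the side to an end point of the
  segment, which is at most \<open>1\<close> by hypothesis. What is left is a power of \<open>cosh x\<close>,
  and this is compensated by the decay of \<open>hat\<close>.
\<close>

lemma trace_density_bound:
  assumes T: "finite_order T N C" and U: "finite_order U N' C'" and b: "\<beta> > 0"
    and g: "test_chain g" and \<delta>: "\<delta> > 0"
  shows "\<exists>K. \<forall>x \<theta> a d. norm d \<ge> \<delta> \<longrightarrow>
    (\<forall>s\<in>{a, a + d}. \<forall>r\<in>{p, p + v}. Im (cis \<theta> * (s - r)) \<ge> 0) \<longrightarrow>
    norm (trace_density \<beta> p v T U (g 0) a d (Complex x \<theta>)) \<le> K / (1 + x\<^sup>2)"
proof -
  obtain K M where K: "K \<ge> 0" "\<And>x \<theta>. norm (strength \<beta> v T U (Complex x \<theta>))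
      \<le> K * cosh x ^ M * max 1 (exp (- Re (phase \<beta> (Complex x \<theta>) v)))"
    using strength_bound[OF T U, of \<beta> v] b by auto
  obtain L where L: "L \<ge> 0" "\<And>x \<theta> d. norm d \<ge> \<delta> \<Longrightarrow> cosh x ^ Suc M * norm (hat (g 0) (phase \<beta> (Complex x \<theta>) d))
      \<le> L * max 1 (exp (Re (phase \<beta> (Complex x \<theta>) d)))"
    using hat_phase_bound[OF g b \<delta>, of "Suc M"] by blast
  have "norm (trace_density \<beta> p v T U (g 0) a d (Complex x \<theta>)) \<le> 4 * (K * L) / (1 + x\<^sup>2)"
    if d: "norm d \<ge> \<delta>" and pos: "\<forall>s\<in>{a, a + d}. \<forall>r\<in>{p, p + v}. Im (cis \<theta> * (s - r)) \<ge> 0" for x \<theta> a d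
  proof -
    let ?w = "Complex x \<theta>"
    let ?E = "\<lambda>d. exp (Re (phase \<beta> ?w d))"
    let ?mv = "max 1 (exp (- Re (phase \<beta> ?w v)))" and ?md = "max 1 (?E d)"
    have E: "?E (s - r) \<le> 1" if "s \<in> {a, a + d}" "r \<in> {p, p + v}" for s r
    proof -
      have "0 \<le> 2 * \<beta> * cosh x * Im (cis \<theta> * (s - r))"
        using pos that b cosh_real_nonneg[of x] by (intro mult_nonneg_nonneg) auto
      then show ?thesis unfolding phase_ray by simp
    qed
    have max: "?E (a - p) * ?mv * ?md \<le> 1"
    proof -
      have eq: "?E (a - p) * (?E d * exp (- Re (phase \<beta> ?w v))) = ?E (a + d - (p + v))"
        "?E (a - p) * exp (- Re (phase \<beta> ?w v)) = ?E (a - (p + v))"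
        "?E (a - p) * ?E d = ?E (a + d - p)"
        by (simp_all add: phase_add phase_diff exp_add[symmetric])
      have prod: "P * max 1 A * max 1 B \<le> 1"
        if "P \<le> 1" "P * (B * A) \<le> 1" "P * A \<le> 1" "P * B \<le> 1" for P A B :: real
        using that by (simp add: max_def mult_ac)
      show ?thesis
        by (rule prod; (unfold eq)?; rule E; simp)
    qed
    have "cosh x * norm (trace_density \<beta> p v T U (g 0) a d ?w)
        = ?E (a - p) * norm (strength \<beta> v T U ?w) * (cosh x * norm (hat (g 0) (phase \<beta> ?w d)))"
      by (simp add: trace_density_def norm_mult)
    also have "\<dots> \<le> ?E (a - p) * (K * cosh x ^ M * ?mv) * (cosh x * norm (hat (g 0) (phase \<beta> ?w d)))"
      by (intro mult_right_mono mult_left_mono K(2)) (auto simp: cosh_real_nonneg)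
    also have "\<dots> = ?E (a - p) * (K * ?mv) * (cosh x ^ Suc M * norm (hat (g 0) (phase \<beta> ?w d)))"
      by (simp add: mult_ac)
    also have "\<dots> \<le> ?E (a - p) * (K * ?mv) * (L * ?md)"
      using K(1) by (intro mult_left_mono L(2)[OF d]) auto
    also have "\<dots> = K * L * (?E (a - p) * ?mv * ?md)" by (simp add: mult_ac)
    also have "\<dots> \<le> K * L * 1" using K(1) L(1) by (intro mult_left_mono max) auto
    finally have "cosh x * norm (trace_density \<beta> p v T U (g 0) a d ?w) \<le> K * L" by simp
    moreover have "(1 + x\<^sup>2) * norm (trace_density \<beta> p v T U (g 0) a d ?w)
        \<le> 4 * cosh x * norm (trace_density \<beta> p v T U (g 0) a d ?w)"
      by (rule mult_right_mono[OF cosh_ge_quadratic]) simp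
    moreover have "1 + x\<^sup>2 > 0" by (simp add: add_pos_nonneg)
    ultimately show ?thesis by (simp add: pos_le_divide_eq mult_ac)
  qed
  then show ?thesis by blast
qed

section \<open>Traces of superpositions of plane waves\<close>

lemma wave_integral_continuous:
  assumes "temperate P" "\<beta> > 0" "Im (cis \<theta> * c) > 0"
  shows "isCont (wave_integral \<beta> \<theta> P) c"
  using wave_integral_has_derivative[OF assms] by (rule has_derivative_continuous)

text \<open>
  Fubini's theorem applies because all points of the segment have distance at least \<open>e\<close> from the
  bounding line, which gives exponential decay independent of the point.
\<close>

lemma wave_integral_trace:
  assumes P: "temperate P" and b: "\<beta> > 0" and g: "test_chain g" and e: "e > 0"
    and pos: "\<And>t. t \<in> {0..1} \<Longrightarrow> e \<le> Im (cis \<theta> * (a + of_real t * d))"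
  shows "integrable lborel (\<lambda>t. wave_integral \<beta> \<theta> P (a + of_real t * d) * g 0 t)"
    and "(LINT t|lborel. wave_integral \<beta> \<theta> P (a + of_real t * d) * g 0 t) =
      (LINT x|lborel. P x * exp (phase \<beta> (Complex x \<theta>) a) * hat (g 0) (phase \<beta> (Complex x \<theta>) d))"
proof -
  have out: "g 0 t = 0" if "t \<notin> {0<..<1}" for t using g that by (simp add: test_chain_def)
  have gc: "continuous_on S (g 0)" for S by (rule test_chain_continuous[OF g])
  have cw: "continuous_on {0..1} (\<lambda>t. wave_integral \<beta> \<theta> P (a + of_real t * d))"
  proof (rule continuous_at_imp_continuous_on, rule ballI)
    fix t :: real assume "t \<in> {0..1}"
    then have "Im (cis \<theta> * (a + of_real t * d)) > 0" using pos e by force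
    from wave_integral_continuous[OF P b this]
    show "isCont (\<lambda>t. wave_integral \<beta> \<theta> P (a + of_real t * d)) t"
      by (rule isCont_o2[rotated]) (intro continuous_intros)
  qed
  show "integrable lborel (\<lambda>t. wave_integral \<beta> \<theta> P (a + of_real t * d) * g 0 t)"
    by (rule lborel_integral_eq_unit_interval(1)) (auto intro!: continuous_on_mult cw gc simp: out)
  let ?w = "\<lambda>x. Complex x \<theta>"
  let ?f = "\<lambda>t x. g 0 t * (P x * exp (phase \<beta> (?w x) (a + of_real t * d)))"
  obtain K where K: "\<And>x. norm (P x) * cosh x ^ 0 * exp (- (2 * \<beta> * e * cosh x)) \<le> K / (1 + x\<^sup>2)"
    using temperate_exp_bound[OF P, of "2 * \<beta> * e" 0] b e by auto
  have bound: "norm (?f t x) \<le> norm (g 0 t) * (K * (1 / (1 + x\<^sup>2)))" for t x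
  proof (cases "t \<in> {0<..<1}")
    case True
    then have "e \<le> Im (cis \<theta> * (a + of_real t * d))" using pos by simp
    then have "2 * \<beta> * cosh x * e \<le> 2 * \<beta> * cosh x * Im (cis \<theta> * (a + of_real t * d))"
      using b by (intro mult_left_mono) (auto simp: cosh_real_nonneg)
    then have "norm (exp (phase \<beta> (?w x) (a + of_real t * d))) \<le> exp (- (2 * \<beta> * e * cosh x))"
      unfolding norm_exp_phase by (simp add: mult_ac del: times_complex.sel cis.simps)
    then have "norm (P x) * norm (exp (phase \<beta> (?w x) (a + of_real t * d))) \<le> K / (1 + x\<^sup>2)"
      using order_trans[OF mult_left_mono[OF _ norm_ge_zero] K[of x, simplified]] by simp
    then show ?thesis unfolding norm_mult by (intro mult_left_mono) auto
  next
    case False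
    then show ?thesis using out by simp
  qed
  have "(LINT t|lborel. wave_integral \<beta> \<theta> P (a + of_real t * d) * g 0 t) = (LINT t|lborel. LINT x|lborel. ?f t x)"
    by (simp add: wave_integral_def mult.commute)
  also have "\<dots> = (LINT x|lborel. LINT t|lborel. ?f t x)"
  proof (rule Fubini_lborel_product_bound[OF _ bound])
    have "(\<lambda>p. exp (phase \<beta> (?w (snd p)) (a + of_real (fst p) * d))) \<in> borel_measurable borel"
      by (intro borel_measurable_continuous_onI continuous_intros continuous_on_compose2[OF continuous_on_Complex[of UNIV]]) auto
    moreover have "(\<lambda>p. g 0 (fst p)) \<in> borel_measurable (borel :: (real \<times> real) measure)"
      by (intro borel_measurable_continuous_onI continuous_on_compose2[OF gc[of UNIV]] continuous_intros) auto
    moreover have "(\<lambda>p. P (snd p)) \<in> borel_measurable (borel :: (real \<times> real) measure)"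
      using P unfolding temperate_def
      by (auto intro: measurable_compose[OF borel_measurable_continuous_onI[OF continuous_on_snd[OF continuous_on_id]]])
    ultimately have "(\<lambda>p. ?f (fst p) (snd p)) \<in> borel_measurable borel" by (intro borel_measurable_times)
    then show "(\<lambda>(t, x). ?f t x) \<in> borel_measurable (lborel \<Otimes>\<^sub>M lborel)"
      by (simp add: lborel_prod split_beta)
    show "integrable lborel (\<lambda>t. norm (g 0 t))"
      by (intro integrable_norm lborel_integral_eq_unit_interval(1) gc) (auto intro!: out)
    show "integrable lborel (\<lambda>x. K * (1 / (1 + x\<^sup>2)))"
      by (rule integrable_majorant)
  qed
  also have "\<dots> = (LINT x|lborel. P x * exp (phase \<beta> (?w x) a) * hat (g 0) (phase \<beta> (?w x) d))"
  proof (intro Bochner_Integration.integral_cong refl)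
    fix x
    have "?f t x = P x * exp (phase \<beta> (?w x) a) * (g 0 t * exp (phase \<beta> (?w x) d * of_real t))" for t
      unfolding phase_add phase_of_real exp_add by (simp add: mult_ac)
    then show "(LINT t|lborel. ?f t x) = P x * exp (phase \<beta> (?w x) a) * hat (g 0) (phase \<beta> (?w x) d)"
      by (simp only: hat_def integral_mult_right_zero)
  qed
  finally show "(LINT t|lborel. wave_integral \<beta> \<theta> P (a + of_real t * d) * g 0 t) =
      (LINT x|lborel. P x * exp (phase \<beta> (Complex x \<theta>) a) * hat (g 0) (phase \<beta> (Complex x \<theta>) d))" .
qed

text \<open>
  The density is a function of \<open>k\<close>, so the angle of a ray matters only modulo
  \<open>2\<pi>\<close>.
\<close>

lemma trace_density_cong:
  assumes "exp w = exp w'"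
  shows "trace_density \<beta> p v T U \<phi> a d w = trace_density \<beta> p v T U \<phi> a d w'"
proof -
  have "exp (- w) = exp (- w')" using assms by (simp add: exp_minus)
  then have "phase \<beta> w = phase \<beta> w'" using assms by (simp add: phase_def fun_eq_iff)
  then show ?thesis using assms \<open>exp (- w) = exp (- w')\<close> by (simp add: trace_density_def strength_def)
qed

lemma trace_density_holomorphic:
  assumes T: "finite_order T N C" and U: "finite_order U N' C'" and g: "test_chain g"
  shows "trace_density \<beta> p v T U (g 0) a d holomorphic_on S"
proof -
  have ph: "(\<lambda>w. phase \<beta> w c) holomorphic_on S" for c unfolding phase_def by (intro holomorphic_intros)
  have "(\<lambda>w. hat (g 0) (phase \<beta> w d)) holomorphic_on S"
    using holomorphic_on_compose[OF ph hat_holomorphic[OF g]] by (simp add: o_def)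
  then show ?thesis
    unfolding trace_density_def[abs_def]
    by (intro holomorphic_intros ph strength_holomorphic[OF T U])
qed

lemma trace_density_measurable:
  assumes "finite_order T N C" "finite_order U N' C'" "test_chain g"
  shows "(\<lambda>x. trace_density \<beta> p v T U (g 0) a d (Complex x \<theta>)) \<in> borel_measurable borel"
  by (intro borel_measurable_continuous_onI continuous_on_compose2[OF holomorphic_on_imp_continuous_on[OF
      trace_density_holomorphic[OF assms, of _ _ _ _ _ UNIV]] continuous_on_Complex]) simp

lemma trace_density_tendsto:
  assumes T: "finite_order T N C" and U: "finite_order U N' C'" and g: "test_chain g"
  shows "((\<lambda>e. trace_density \<beta> p v T U (g 0) (a + of_real e * c) (of_real (1 + e * \<kappa>) * d) w)
    \<longlongrightarrow> trace_density \<beta> p v T U (g 0) a d w) (at_right 0)"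
proof -
  have "((\<lambda>e. phase \<beta> w (a + of_real e * c - p)) \<longlongrightarrow> phase \<beta> w (a + of_real 0 * c - p)) (at_right 0)"
    "((\<lambda>e. phase \<beta> w (of_real (1 + e * \<kappa>) * d)) \<longlongrightarrow> phase \<beta> w (of_real (1 + 0 * \<kappa>) * d)) (at_right 0)"
    unfolding phase_def by (intro tendsto_intros)+
  moreover have "isCont (hat (g 0)) y" for y
    using hat_continuous[OF g, of UNIV] by (simp add: continuous_on_eq_continuous_at)
  ultimately show ?thesis
    unfolding trace_density_def
    by (intro tendsto_mult tendsto_exp tendsto_const isCont_tendsto_compose[where g = "hat (g 0)"]) simp_all
qed

text \<open>
  The two cases are the ray of the side and the opposite one. On the latter \<open>x\<close> is reflected,
  which makes the arguments of the Laplace transforms agree.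
\<close>

lemma strength_on_side:
  assumes v: "v \<noteq> 0"
  shows "cis \<theta> * v = of_real (norm v) \<Longrightarrow> strength \<beta> v T U (Complex x \<theta>) = \<i> * of_real (norm v) *
      (laplace U (- \<i> * of_real (2 * \<beta> * norm v * sinh x))
        + of_real (2 * \<beta> * cosh x) * laplace T (- \<i> * of_real (2 * \<beta> * norm v * sinh x)))"
    and "cis \<theta> * v = - of_real (norm v) \<Longrightarrow> strength \<beta> v T U (Complex (- x) \<theta>) = \<i> * of_real (norm v) *
      (laplace U (- \<i> * of_real (2 * \<beta> * norm v * sinh x))
        - of_real (2 * \<beta> * cosh x) * laplace T (- \<i> * of_real (2 * \<beta> * norm v * sinh x)))"
proof -
  have e: "exp (Complex x \<theta>) * sgn v + exp (- Complex x \<theta>) * cnj (sgn v)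
      = of_real (exp x) * (cis \<theta> * v / of_real (norm v)) + of_real (exp (- x)) * cnj (cis \<theta> * v / of_real (norm v))"
    for x
  proof -
    have "- Complex x \<theta> = Complex (- x) (- \<theta>)" by (simp add: complex_eq_iff)
    then show ?thesis by (simp add: exp_eq_polar sgn_eq cis_cnj mult.assoc)
  qed
  { assume c: "cis \<theta> * v = of_real (norm v)"
    have "- phase \<beta> (Complex x \<theta>) v = - \<i> * of_real (2 * \<beta> * norm v * sinh x)"
      unfolding phase_ray c by (simp add: complex_eq_iff mult_ac)
    moreover have "of_real \<beta> * (exp (Complex x \<theta>) * sgn v + exp (- Complex x \<theta>) * cnj (sgn v)) = of_real (2 * \<beta> * cosh x)"
      unfolding e c using v by (simp add: cosh_def algebra_simps)
    ultimately show "strength \<beta> v T U (Complex x \<theta>) = \<i> * of_real (norm v) *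
      (laplace U (- \<i> * of_real (2 * \<beta> * norm v * sinh x))
        + of_real (2 * \<beta> * cosh x) * laplace T (- \<i> * of_real (2 * \<beta> * norm v * sinh x)))"
      unfolding strength_def by simp }
  { assume c: "cis \<theta> * v = - of_real (norm v)"
    have "- phase \<beta> (Complex (- x) \<theta>) v = - \<i> * of_real (2 * \<beta> * norm v * sinh x)"
      unfolding phase_ray c by (simp add: complex_eq_iff mult_ac)
    moreover have "of_real \<beta> * (exp (Complex (- x) \<theta>) * sgn v + exp (- Complex (- x) \<theta>) * cnj (sgn v))
        = - of_real (2 * \<beta> * cosh x)"
      unfolding e c using v by (simp add: cosh_def algebra_simps)
    ultimately show "strength \<beta> v T U (Complex (- x) \<theta>) = \<i> * of_real (norm v) *
      (laplace U (- \<i> * of_real (2 * \<beta> * norm v * sinh x))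
        - of_real (2 * \<beta> * cosh x) * laplace T (- \<i> * of_real (2 * \<beta> * norm v * sinh x)))"
      unfolding strength_def by simp }
qed

text \<open>
  After reflection of the second integral the terms with \<open>U\<close> cancel and those with
  \<open>T\<close> add up. The factor \<open>2\<beta>\<bar>v\<bar> cosh x\<close> in front of \<open>T\<close>
  is the derivative of the argument \<open>2\<beta>\<bar>v\<bar> sinh x\<close> of the transforms, so that a
  substitution leads to Fourier inversion.
\<close>

lemma trace_jump:
  assumes T: "finite_order T N C" and U: "finite_order U N' C'" and g: "test_chain g"
    and b: "\<beta> > 0" and v: "v \<noteq> 0"
    and \<theta>: "cis \<theta> * v = of_real (norm v)" and \<theta>': "cis \<theta>' * v = - of_real (norm v)"
  shows "(LINT x|lborel. trace_density \<beta> p v T U (g 0) p v (Complex x \<theta>))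
    - (LINT x|lborel. trace_density \<beta> p v T U (g 0) p v (Complex x \<theta>')) = 4 * of_real pi * \<i> * T (g 0)"
proof -
  let ?D = "trace_density \<beta> p v T U (g 0) p v"
  let ?k = "\<lambda>x. 2 * \<beta> * norm v * sinh x" and ?h = "\<lambda>x. 2 * \<beta> * norm v * cosh x"
  let ?f = "\<lambda>k. hat (g 0) (\<i> * of_real k) * laplace T (- \<i> * of_real k)"
  have int: "integrable lborel (\<lambda>x. ?D (Complex x t))" if t: "Im (cis t * v) = 0" for t
  proof -
    obtain K where K: "\<And>x \<theta> a d. norm d \<ge> norm v \<Longrightarrow>
        (\<forall>s\<in>{a, a + d}. \<forall>r\<in>{p, p + v}. Im (cis \<theta> * (s - r)) \<ge> 0) \<Longrightarrow>
        norm (trace_density \<beta> p v T U (g 0) a d (Complex x \<theta>)) \<le> K / (1 + x\<^sup>2)"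
      using trace_density_bound[OF T U b g, of "norm v" p v] v by auto
    show ?thesis
      by (rule integrable_over_one_plus_square[OF trace_density_measurable[OF T U g] K]) (use t in \<open>auto simp: algebra_simps\<close>)
  qed
  have 1: "integrable lborel (\<lambda>x. ?D (Complex x \<theta>))" by (rule int) (simp only: \<theta> Im_complex_of_real)
  have "integrable lborel (\<lambda>x. ?D (Complex x \<theta>'))"
    by (rule int) (simp only: \<theta>' Im_complex_of_real uminus_complex.sel minus_zero)
  then have 2: "integrable lborel (\<lambda>x. ?D (Complex (- x) \<theta>'))"
    using lborel_integrable_real_affine_iff[of "-1" "\<lambda>x. ?D (Complex x \<theta>')" 0] by simp
  have reflect: "(LINT x|lborel. ?D (Complex x \<theta>')) = (LINT x|lborel. ?D (Complex (- x) \<theta>'))"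
    using lborel_integral_real_affine[of "-1" "\<lambda>x. ?D (Complex x \<theta>')" 0] by simp
  have diff: "?D (Complex x \<theta>) - ?D (Complex (- x) \<theta>') = 2 * \<i> * (\<bar>?h x\<bar> *\<^sub>R ?f (?k x))" for x
  proof -
    have "phase \<beta> (Complex x \<theta>) v = \<i> * of_real (?k x)" "phase \<beta> (Complex (- x) \<theta>') v = \<i> * of_real (?k x)"
      unfolding phase_ray \<theta> \<theta>' by (simp_all add: complex_eq_iff mult_ac)
    moreover have "phase \<beta> w 0 = 0" for w by (simp add: phase_def)
    moreover have "\<bar>?h x\<bar> = ?h x" using b by (simp add: cosh_real_nonneg)
    ultimately show ?thesis
      unfolding trace_density_def strength_on_side(1)[OF v \<theta>] strength_on_side(2)[OF v \<theta>']
      by (simp add: scaleR_conv_of_real algebra_simps)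
  qed
  have int_f: "integrable lborel (\<lambda>x. \<bar>?h x\<bar> *\<^sub>R ?f (?k x))"
  proof -
    have "integrable lborel (\<lambda>x. 1 / (2 * \<i>) * (?D (Complex x \<theta>) - ?D (Complex (- x) \<theta>')))"
      by (intro integrable_mult_right Bochner_Integration.integrable_diff 1 2)
    then show ?thesis unfolding diff by simp
  qed
  have range: "range ?k = UNIV"
  proof (intro equalityI subset_UNIV subsetI)
    fix y :: real
    have "y = ?k (arsinh (y / (2 * \<beta> * norm v)))" using b v by simp
    then show "y \<in> range ?k" by blast
  qed
  have "(LINT x|lborel. ?D (Complex x \<theta>)) - (LINT x|lborel. ?D (Complex x \<theta>'))
      = (LINT x|lborel. ?D (Complex x \<theta>) - ?D (Complex (- x) \<theta>'))"
    unfolding reflect by (rule Bochner_Integration.integral_diff[symmetric, OF 1 2])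
  also have "\<dots> = 2 * \<i> * (LINT x|lborel. \<bar>?h x\<bar> *\<^sub>R ?f (?k x))"
    unfolding diff by (rule integral_mult_right_zero)
  also have "(LINT x|lborel. \<bar>?h x\<bar> *\<^sub>R ?f (?k x)) = (LINT k:range ?k|lborel. ?f k)"
  proof (rule lborel_integral_substitution[symmetric, where f = "?f" and g = "?k" and h = "?h"])
    show "integrable lborel (\<lambda>x. \<bar>?h x\<bar> *\<^sub>R ?f (?k x))" by (rule int_f)
    show "(?k has_field_derivative ?h x) (at x)" for x by (auto intro!: derivative_eq_intros)
    show "inj ?k" using b v by (auto intro!: injI)
    show "range ?k \<in> sets borel" unfolding range by simp
    have "continuous_on UNIV ?f"
      by (intro continuous_on_mult continuous_on_compose2[OF hat_continuous[OF g, of UNIV]]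
          continuous_on_compose2[OF holomorphic_on_imp_continuous_on[OF laplace_holomorphic[OF T, of UNIV]]]
          continuous_intros) auto
    then show "?f \<in> borel_measurable borel" by (rule borel_measurable_continuous_onI)
  qed
  also note range
  also have "2 * \<i> * (LINT k:UNIV|lborel. ?f k) = 4 * of_real pi * \<i> * T (g 0)"
    using finite_order_fourier[OF T g] by (simp add: set_lebesgue_integral_def)
  finally show ?thesis .
qed

section \<open>The boundary value problem\<close>

context
  fixes \<beta> :: real and n :: nat and z :: "nat \<Rightarrow> complex"
    and q dq :: "nat \<Rightarrow> (real \<Rightarrow> complex) \<Rightarrow> complex" and Q :: "complex \<Rightarrow> complex"
  assumes b: "\<beta> > 0" and poly: "convex_polygon_ccw n z"
    and q: "\<And>j. j < n \<Longrightarrow> q j \<in> E01_dual" and dq: "\<And>j. j < n \<Longrightarrow> dq j \<in> E01_dual"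
    and Q: "\<And>w. w \<in> polygon_interior n z \<Longrightarrow> Q w = 1 / (4 * of_real pi * \<i>) *
      (\<Sum>i<n. ray_integral (- side_angle n z i)
        (\<lambda>k. exp (\<i> * k * w - \<i> * of_real (\<beta>\<^sup>2) * cnj w / k) * spectral_fun \<beta> n z q dq i k / k))"
begin

private abbreviation (input) \<alpha> :: "nat \<Rightarrow> real" where "\<alpha> j \<equiv> side_angle n z j"
private abbreviation (input) side :: "nat \<Rightarrow> complex" where "side j \<equiv> side_vec n z j"
private abbreviation (input) \<sigma> :: "nat \<Rightarrow> complex \<Rightarrow> complex" where "\<sigma> j \<equiv> strength \<beta> (side j) (q j) (dq j)"
private abbreviation (input) ray :: "nat \<Rightarrow> real \<Rightarrow> complex" where "ray j x \<equiv> Complex x (- \<alpha> j)"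

lemma finite_orders:
  assumes "j < n"
  obtains N C N' C' where "finite_order (q j) N C" "finite_order (dq j) N' C'"
proof -
  obtain N C where "finite_order (q j) N C" using E01_dual_finite_order[OF q[OF assms]] .
  moreover obtain N' C' where "finite_order (dq j) N' C'" using E01_dual_finite_order[OF dq[OF assms]] .
  ultimately show thesis by (rule that)
qed

lemma side_on_ray: "j < n \<Longrightarrow> cis (- \<alpha> j) * side j = of_real (norm (side j))"
  by (subst side_vec_polar[OF poly]) (simp_all add: mult.left_commute cis_mult)

lemma temperate_strength:
  assumes j: "j < n" shows "temperate (\<lambda>x. \<sigma> j (ray j x))"
proof -
  obtain N C N' C' where fo: "finite_order (q j) N C" "finite_order (dq j) N' C'"
    using finite_orders[OF j] .
  obtain K M where K: "K \<ge> 0" "\<And>x. norm (\<sigma> j (ray j x))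
      \<le> K * cosh x ^ M * max 1 (exp (- Re (phase \<beta> (ray j x) (side j))))"
    using strength_bound[OF fo, of \<beta> "side j"] b by auto
  have "norm (\<sigma> j (ray j x)) \<le> K * cosh x ^ M" for x
    using K(2)[of x] unfolding phase_ray side_on_ray[OF j] by simp
  moreover have "(\<lambda>x. \<sigma> j (ray j x)) \<in> borel_measurable borel"
    by (intro borel_measurable_continuous_onI continuous_on_compose2[OF holomorphic_on_imp_continuous_on[OF
        strength_holomorphic[OF fo, of _ _ UNIV]] continuous_on_Complex]) simp
  ultimately show ?thesis using K(1) unfolding temperate_def by blast
qed

lemma spectral_fun_on_plane:
  "j < n \<Longrightarrow> spectral_fun \<beta> n z q dq j (of_real \<beta> * exp w) = exp (- phase \<beta> w (z j)) * \<sigma> j w"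
  using finite_orders spectral_fun_log[OF b _ _ side_vec_nonzero[OF poly]] by metis

lemma solution_is_superposition:
  assumes w: "w \<in> polygon_interior n z"
  shows "Q w = superposition \<beta> n (\<lambda>j. - \<alpha> j) z
    (\<lambda>j x. 1 / (4 * of_real pi * \<i>) * \<sigma> j (ray j x)) w"
proof -
  have "ray_integral (- \<alpha> j)
        (\<lambda>k. exp (\<i> * k * w - \<i> * of_real (\<beta>\<^sup>2) * cnj w / k) * spectral_fun \<beta> n z q dq j k / k)
      = wave_integral \<beta> (- \<alpha> j) (\<lambda>x. \<sigma> j (ray j x)) (w - z j)" if j: "j < n" for j
    unfolding wave_integral_def
  proof (rule ray_integral_log[OF b])
    have "Im (cis (- \<alpha> j) * (w - z j)) > 0"
      using w j unfolding polygon_interior_heights[OF poly] side_height_def by blast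
    then show "integrable lborel (\<lambda>x. \<sigma> j (ray j x) * exp (phase \<beta> (ray j x) (w - z j)))"
      by (rule wave_integrable[OF temperate_strength[OF j] b])
    show "(\<lambda>x. \<sigma> j (ray j x) * exp (phase \<beta> (ray j x) (w - z j))) \<in> borel_measurable borel"
      by (rule wave_measurable[OF temperate_strength[OF j]])
    show "exp (\<i> * (of_real \<beta> * exp (ray j x)) * w - \<i> * of_real (\<beta>\<^sup>2) * cnj w / (of_real \<beta> * exp (ray j x)))
        * spectral_fun \<beta> n z q dq j (of_real \<beta> * exp (ray j x))
      = \<sigma> j (ray j x) * exp (phase \<beta> (ray j x) (w - z j))" for x
      unfolding exp_kernel_log(2)[OF b] spectral_fun_on_plane[OF j]
      by (simp add: phase_diff exp_diff exp_minus field_simps)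
  qed
  then have "Q w = 1 / (4 * of_real pi * \<i>) *
      (\<Sum>j<n. wave_integral \<beta> (- \<alpha> j) (\<lambda>x. \<sigma> j (ray j x)) (w - z j))"
    unfolding Q[OF w] by simp
  then show ?thesis
    by (simp only: superposition_def wave_integral_def sum_distrib_left mult.assoc integral_mult_right_zero)
qed

lemma solution_smooth: "Cinf_on (polygon_interior n z) Q"
  and solution_equation: "w \<in> polygon_interior n z \<Longrightarrow> - laplacian Q w + 4 * of_real (\<beta>\<^sup>2) * Q w = 0"
proof -
  have P: "temperate (\<lambda>x. 1 / (4 * of_real pi * \<i>) * \<sigma> j (ray j x))" if j: "j < n" for j
  proof -
    obtain C M where C: "C \<ge> 0" "\<And>x. norm (\<sigma> j (ray j x)) \<le> C * cosh x ^ M"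
      using temperate_strength[OF j] unfolding temperate_def by blast
    let ?c = "1 / (4 * of_real pi * \<i>) :: complex"
    have "norm (?c * \<sigma> j (ray j x)) \<le> (norm ?c * C) * cosh x ^ M" for x
      using mult_left_mono[OF C(2), of "norm ?c" x] by (simp only: norm_mult mult.assoc norm_ge_zero)
    moreover have "(\<lambda>x. ?c * \<sigma> j (ray j x)) \<in> borel_measurable borel"
      using temperate_strength[OF j] unfolding temperate_def by (intro borel_measurable_times) auto
    moreover have "norm ?c * C \<ge> 0" using C(1) by simp
    ultimately show ?thesis unfolding temperate_def by blast
  qed
  have pos: "Im (cis (- \<alpha> j) * (w - z j)) > 0" if "w \<in> polygon_interior n z" "j < n" for w j
    using that unfolding polygon_interior_heights[OF poly] side_height_def by blast
  note hyps = b open_polygon_interior[OF poly] pos P solution_is_superposition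
  show "Cinf_on (polygon_interior n z) Q"
    unfolding Cinf_on_def by (intro allI superposition_Ck_on[OF hyps])
  show "- laplacian Q w + 4 * of_real (\<beta>\<^sup>2) * Q w = 0" if "w \<in> polygon_interior n z"
    using superposition_laplacian[OF hyps that] by simp
qed

private abbreviation (input) density ::
    "(real \<Rightarrow> complex) \<Rightarrow> nat \<Rightarrow> complex \<Rightarrow> complex \<Rightarrow> complex \<Rightarrow> complex"
  where "density \<phi> j \<equiv> trace_density \<beta> (z j) (side j) (q j) (dq j) \<phi>"

lemma height_difference:
  assumes "j < n" "r \<in> {z j, z j + side j}"
  shows "Im (cis (- \<alpha> j) * (w - r)) = side_height n z j w"
proof -
  have "side_height n z j r = 0"
    using assms height_start[OF poly, of j] height_end[OF poly assms(1)] by (auto simp: side_vec_def)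
  then show ?thesis using side_height_diff[of n z j w r] by simp
qed

lemma side_endpoint:
  assumes "l < n" "r \<in> {z l, z l + side l}"
  shows "\<exists>k<n. r = z k"
proof -
  have "z l + side l = z (Suc l mod n)" by (simp add: side_vec_def)
  then show ?thesis using assms nxt_less[OF poly, of l] by blast
qed

text \<open>
  Waves with angle \<open>\<theta>\<close> that start on side \<open>j\<close> do not grow on their way to the
  segment from \<open>a\<close> to \<open>a + d\<close>; it suffices to look at end points.
\<close>

definition illuminated :: "real \<Rightarrow> nat \<Rightarrow> complex \<Rightarrow> complex \<Rightarrow> bool"
  where "illuminated \<theta> j a d \<longleftrightarrow>
    (\<forall>s\<in>{a, a + d}. \<forall>r\<in>{z j, z j + side j}. Im (cis \<theta> * (s - r)) \<ge> 0)"

lemma density_bound: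
  assumes i: "i < n" and j: "j < n" and g: "test_chain g"
  shows "\<exists>K. \<forall>x \<theta> a d. norm (side i) / 2 \<le> norm d \<longrightarrow> illuminated \<theta> j a d \<longrightarrow>
    norm (density (g 0) j a d (Complex x \<theta>)) \<le> K / (1 + x\<^sup>2)"
proof -
  obtain N C N' C' where fo: "finite_order (q j) N C" "finite_order (dq j) N' C'"
    using finite_orders[OF j] .
  have "norm (side i) / 2 > 0" using side_vec_nonzero[OF poly i] by simp
  from trace_density_bound[OF fo b g this, of "z j" "side j"] show ?thesis
    unfolding illuminated_def .
qed

lemma opposite_direction: "cis (pi - \<alpha> i) = - cis (- \<alpha> i)"
  by (simp add: complex_eq_iff)

lemma opposite_illuminated:
  assumes i: "i < n" and j: "j < n"
  shows "illuminated (pi - \<alpha> i) j (z i) (side i)"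
  unfolding illuminated_def
proof (intro ballI)
  fix s r assume s: "s \<in> {z i, z i + side i}" and r: "r \<in> {z j, z j + side j}"
  obtain l where l: "l < n" "r = z l" using side_endpoint[OF j r] by blast
  have "Im (cis (pi - \<alpha> i) * (s - r)) = Im (cis (- \<alpha> i) * (r - s))"
    unfolding opposite_direction by (simp add: algebra_simps)
  also have "\<dots> \<ge> 0"
    unfolding height_difference[OF i s] l(2) by (rule height_vertex_nonneg[OF poly i l(1)])
  finally show "Im (cis (pi - \<alpha> i) * (s - r)) \<ge> 0" .
qed

lemma inner_trace_formula:
  assumes e: "e > 0" and g: "test_chain g" "g 0 = zero_extension \<phi>"
    and A: "\<And>j. j < n \<Longrightarrow> e \<le> side_height n z j a" and B: "\<And>j. j < n \<Longrightarrow> e \<le> side_height n z j (a + d)"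
    and param: "\<And>\<tau>. inner_side_param n z i e \<tau> = a + of_real \<tau> * d"
  shows "inner_trace n z Q i e \<phi> = 1 / (4 * of_real pi * \<i>) *
    (\<Sum>j<n. LINT x|lborel. density (g 0) j a d (ray j x))"
proof -
  have h: "e \<le> side_height n z j (a + of_real t * d)" if j: "j < n" and t: "t \<in> {0..1}" for j t
  proof -
    have "side_height n z j (a + of_real t * d) = (1 - t) * side_height n z j a + t * side_height n z j (a + d)"
      unfolding side_height_add Im_mult_of_real by (simp add: algebra_simps del: times_complex.sel)
    also have "\<dots> \<ge> (1 - t) * e + t * e"
      using A[OF j] B[OF j] t by (intro add_mono mult_left_mono) auto
    finally show ?thesis by (simp add: algebra_simps)
  qed
  have pos: "e \<le> Im (cis (- \<alpha> j) * (a - z j + of_real t * d))" if "j < n" "t \<in> {0..1}" for j t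
    using h[OF that] by (simp add: side_height_def algebra_simps del: times_complex.sel cis.simps)
  note trace = wave_integral_trace[OF temperate_strength b g(1) e pos]
  let ?W = "\<lambda>j t. wave_integral \<beta> (- \<alpha> j) (\<lambda>x. \<sigma> j (ray j x)) (a - z j + of_real t * d) * g 0 t"
  have "inner_trace n z Q i e \<phi> = (LINT t|lborel. 1 / (4 * of_real pi * \<i>) * (\<Sum>j<n. ?W j t))"
    unfolding inner_trace_def set_lebesgue_integral_def
  proof (intro Bochner_Integration.integral_cong refl)
    fix t :: real
    show "indicator {0<..<1} t *\<^sub>R (Q (inner_side_param n z i e t) * \<phi> t)
        = 1 / (4 * of_real pi * \<i>) * (\<Sum>j<n. ?W j t)"
    proof (cases "t \<in> {0<..<1}")
      case True
      then have "a + of_real t * d \<in> polygon_interior n z"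
        unfolding polygon_interior_heights[OF poly] using h[of _ t] e by force
      from solution_is_superposition[OF this]
      have "Q (a + of_real t * d) = 1 / (4 * of_real pi * \<i>) *
          (\<Sum>j<n. wave_integral \<beta> (- \<alpha> j) (\<lambda>x. \<sigma> j (ray j x)) (a - z j + of_real t * d))"
        by (simp only: superposition_def wave_integral_def sum_distrib_left mult.assoc integral_mult_right_zero
            add_diff_eq diff_add_eq)
      then show ?thesis
        using True unfolding param g(2) by (simp add: zero_extension_def sum_distrib_right)
    next
      case False
      then have "g 0 t = 0" unfolding g(2) by (simp only: zero_extension_def if_False)
      then show ?thesis using False by (simp add: indicator_def)
    qed
  qed
  also have "\<dots> = 1 / (4 * of_real pi * \<i>) * (\<Sum>j<n. LINT t|lborel. ?W j t)"
    unfolding integral_mult_right_zero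
    by (subst Bochner_Integration.integral_sum) (auto intro: trace(1))
  also have "(\<Sum>j<n. LINT t|lborel. ?W j t) = (\<Sum>j<n. LINT x|lborel. density (g 0) j a d (ray j x))"
  proof (intro sum.cong refl)
    fix j assume "j \<in> {..<n}"
    then have "j < n" by simp
    from trace(2)[OF this this]
    show "(LINT t|lborel. ?W j t) = (LINT x|lborel. density (g 0) j a d (ray j x))"
      by (simp add: trace_density_def mult_ac)
  qed
  finally show ?thesis .
qed

text \<open>
  The inner side enters the majorant only through a lower bound for its length, which is at least half the
  length of side \<open>i\<close> for small \<open>e\<close>, and no wave grows on its way to the inner side.
\<close>

lemma inner_trace_tendsto:
  assumes i: "i < n" and g: "test_chain g" "g 0 = zero_extension \<phi>"
  shows "((\<lambda>e. inner_trace n z Q i e \<phi>) \<longlongrightarrow> 1 / (4 * of_real pi * \<i>) *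
    (\<Sum>j<n. LINT x|lborel. density (g 0) j (z i) (side i) (ray j x))) (at_right 0)"
proof -
  define c where "c = corner_shift n z i"
  obtain \<kappa> e0 where e0: "e0 > 0" and e: "\<And>e. 0 < e \<Longrightarrow> e < e0 \<Longrightarrow> 1 / 2 \<le> 1 + e * \<kappa> \<and>
    (\<forall>j<n. e \<le> side_height n z j (z i + of_real e * c)) \<and>
    (\<forall>j<n. e \<le> side_height n z j (z i + of_real e * c + of_real (1 + e * \<kappa>) * side i)) \<and>
    (\<forall>\<tau>. inner_side_param n z i e \<tau> = z i + of_real e * c + of_real \<tau> * (of_real (1 + e * \<kappa>) * side i))"
    using inner_side_param_formula[OF poly i] unfolding c_def by blast
  let ?D = "\<lambda>j e x. density (g 0) j (z i + of_real e * c) (of_real (1 + e * \<kappa>) * side i) (ray j x)"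
  have small: "\<forall>\<^sub>F e in at_right 0. 0 < e \<and> e < e0"
    unfolding eventually_at_right_field using e0 by blast
  have "((\<lambda>e. 1 / (4 * of_real pi * \<i>) * (\<Sum>j<n. LINT x|lborel. ?D j e x)) \<longlongrightarrow> 1 / (4 * of_real pi * \<i>) *
    (\<Sum>j<n. LINT x|lborel. density (g 0) j (z i) (side i) (ray j x))) (at_right 0)"
  proof (intro tendsto_mult tendsto_const tendsto_sum)
    fix j assume "j \<in> {..<n}"
    then have j: "j < n" by simp
    obtain N C N' C' where fo: "finite_order (q j) N C" "finite_order (dq j) N' C'"
      using finite_orders[OF j] .
    obtain K where K: "\<And>x \<theta> a d. norm (side i) / 2 \<le> norm d \<Longrightarrow> illuminated \<theta> j a d \<Longrightarrow>
        norm (density (g 0) j a d (Complex x \<theta>)) \<le> K / (1 + x\<^sup>2)"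
      using density_bound[OF i j g(1)] by blast
    show "((\<lambda>e. LINT x|lborel. ?D j e x) \<longlongrightarrow> (LINT x|lborel. density (g 0) j (z i) (side i) (ray j x))) (at_right 0)"
    proof (rule dominated_convergence_at_right_0[where w = "\<lambda>x. K * (1 / (1 + x\<^sup>2))"])
      show "integrable lborel (\<lambda>x. K * (1 / (1 + x\<^sup>2)))"
        by (rule integrable_majorant)
      show "((\<lambda>e. ?D j e x) \<longlongrightarrow> density (g 0) j (z i) (side i) (ray j x)) (at_right 0)" for x
        by (rule trace_density_tendsto[OF fo g(1)])
      show "\<forall>\<^sub>F e in at_right 0. \<forall>x. norm (?D j e x) \<le> K * (1 / (1 + x\<^sup>2))"
        using small
      proof eventually_elim
        case (elim e')
        have "1 / 2 * norm (side i) \<le> \<bar>1 + e' * \<kappa>\<bar> * norm (side i)"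
          using e[of e'] elim by (intro mult_right_mono) auto
        then have d: "norm (side i) / 2 \<le> norm (of_real (1 + e' * \<kappa>) * side i)"
          unfolding norm_mult norm_of_real by simp
        have "illuminated (- \<alpha> j) j (z i + of_real e' * c) (of_real (1 + e' * \<kappa>) * side i)"
          unfolding illuminated_def
        proof (intro ballI)
          fix s r assume sr: "s \<in> {z i + of_real e' * c, z i + of_real e' * c + of_real (1 + e' * \<kappa>) * side i}"
            "r \<in> {z j, z j + side j}"
          have "e' \<le> side_height n z j s" using e[of e'] elim sr(1) j by blast
          then show "Im (cis (- \<alpha> j) * (s - r)) \<ge> 0"
            unfolding height_difference[OF j sr(2)] using elim by linarith
        qed
        from K[OF d this] show ?case by simp
      qed
    qed (use trace_density_measurable[OF fo g(1)] in simp_all)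
  qed
  moreover have "\<forall>\<^sub>F e in at_right 0. 1 / (4 * of_real pi * \<i>) * (\<Sum>j<n. LINT x|lborel. ?D j e x)
      = inner_trace n z Q i e \<phi>"
    using small
  proof eventually_elim
    case (elim e')
    then show ?case using e[of e'] by (intro inner_trace_formula[OF _ g, symmetric]) blast+
  qed
  ultimately show ?thesis by (rule Lim_transform_eventually)
qed

text \<open>
  At the two borders of the sector the bound on the exponential expresses that side \<open>i\<close> lies to
  the left of side \<open>j\<close> and that side \<open>j\<close> lies to the left of side \<open>i\<close>.
\<close>

lemma rotate_to_side:
  assumes i: "i < n" and j: "j < n" and ij: "i \<noteq> j" and g: "test_chain g"
  shows "(LINT x|lborel. density (g 0) j (z i) (side i) (ray j x))
    = (LINT x|lborel. density (g 0) j (z i) (side i) (Complex x (pi - \<alpha> i)))"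
proof -
    \<comment> \<open>The angle to rotate by. It is not \<open>\<pi>\<close>, because otherwise sides \<open>i\<close> and \<open>j\<close> would have the same
    direction; this makes the sector small enough for \<open>sector_nonneg\<close>.\<close>
  define \<gamma> where "\<gamma> = Arg (cis (pi - \<alpha> i + \<alpha> j))"
  have cis_\<gamma>: "cis \<gamma> = cis (pi - \<alpha> i + \<alpha> j)" unfolding \<gamma>_def by (subst cis_Arg) (simp_all add: sgn_eq)
  have end_dir: "cis (- \<alpha> j + \<gamma>) = cis (pi - \<alpha> i)"
    unfolding cis_mult[symmetric] cis_\<gamma> by (simp add: cis_mult)
  have "\<gamma> \<noteq> pi"
  proof
    assume "\<gamma> = pi"
    then have "cis (- \<alpha> j + \<gamma>) = - cis (- \<alpha> j)" by (simp add: complex_eq_iff)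
    then have "cis (- \<alpha> j) = cis (- \<alpha> i)" unfolding end_dir opposite_direction by simp
    then have "cis (\<alpha> i) = cis (\<alpha> j)" by (metis cis_cnj complex_cnj_cancel_iff)
    then show False using side_directions_distinct[OF poly i j ij] by simp
  qed
  then have \<gamma>: "\<bar>\<gamma>\<bar> < pi" using Arg_bounded[of "cis (pi - \<alpha> i + \<alpha> j)"] unfolding \<gamma>_def by linarith
  obtain N C N' C' where fo: "finite_order (q j) N C" "finite_order (dq j) N' C'"
    using finite_orders[OF j] .
  obtain K where K: "\<And>x \<theta> a d. norm (side i) / 2 \<le> norm d \<Longrightarrow> illuminated \<theta> j a d \<Longrightarrow>
      norm (density (g 0) j a d (Complex x \<theta>)) \<le> K / (1 + x\<^sup>2)"
    using density_bound[OF i j g] by blast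
  have pos: "illuminated \<theta> j (z i) (side i)" if "\<theta> \<in> closed_segment (- \<alpha> j) (- \<alpha> j + \<gamma>)" for \<theta>
    unfolding illuminated_def
  proof (intro ballI sector_nonneg[OF that])
    fix s r assume s: "s \<in> {z i, z i + side i}" and r: "r \<in> {z j, z j + side j}"
    show "Im (cis (- \<alpha> j) * (s - r)) \<ge> 0"
      using height_difference[OF j r] height_vertex_nonneg[OF poly j] side_endpoint[OF i s] by force
    show "Im (cis (- \<alpha> j + \<gamma>) * (s - r)) \<ge> 0"
      using opposite_illuminated[OF i j] s r unfolding end_dir illuminated_def by blast
  qed (use \<gamma> in simp)
  have "(LINT x|lborel. density (g 0) j (z i) (side i) (ray j x))
    = (LINT x|lborel. density (g 0) j (z i) (side i) (Complex x (- \<alpha> j + \<gamma>)))"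
    by (rule rotate_contour[OF trace_density_holomorphic[OF fo g] K]) (simp_all add: pos)
  also have "\<dots> = (LINT x|lborel. density (g 0) j (z i) (side i) (Complex x (pi - \<alpha> i)))"
    by (intro Bochner_Integration.integral_cong refl trace_density_cong) (simp only: exp_eq_polar complex.sel end_dir)
  finally show ?thesis .
qed

text \<open>
  On the ray opposite to that of side \<open>i\<close> the densities of all sides add up to \<open>0\<close>
  by the global relation. Subtracting this sum leaves only side \<open>i\<close>, as for the other sides the
  integral over the opposite ray equals that over their own ray.
\<close>

lemma boundary_limit:
  assumes i: "i < n"
    and global: "\<And>k. k \<noteq> 0 \<Longrightarrow> (\<Sum>j<n. spectral_fun \<beta> n z q dq j k) = 0"
  shows "has_boundary_limit n z Q i (q i)"
  unfolding has_boundary_limit_def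
proof
  fix \<phi> assume "\<phi> \<in> S01"
  then obtain g where g: "test_chain g" "g 0 = zero_extension \<phi>" by (rule S01_test_chain)
  let ?\<theta> = "pi - \<alpha> i"
  let ?D = "\<lambda>j. density (g 0) j (z i) (side i)"
  have sum0: "(\<Sum>j<n. ?D j w) = 0" for w
  proof -
    have "0 = exp (phase \<beta> w (z i)) * hat (g 0) (phase \<beta> w (side i)) *
        (\<Sum>j<n. spectral_fun \<beta> n z q dq j (of_real \<beta> * exp w))"
      using global[of "of_real \<beta> * exp w"] b by simp
    also have "\<dots> = (\<Sum>j<n. ?D j w)"
      unfolding sum_distrib_left
      by (intro sum.cong refl)
        (simp add: spectral_fun_on_plane trace_density_def phase_diff exp_diff exp_minus field_simps)
    finally show ?thesis by simp
  qed
  have int: "integrable lborel (\<lambda>x. ?D j (Complex x ?\<theta>))" if j: "j < n" for j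
  proof -
    obtain N C N' C' where fo: "finite_order (q j) N C" "finite_order (dq j) N' C'"
      using finite_orders[OF j] .
    obtain K where K: "\<And>x \<theta> a d. norm (side i) / 2 \<le> norm d \<Longrightarrow> illuminated \<theta> j a d \<Longrightarrow>
        norm (density (g 0) j a d (Complex x \<theta>)) \<le> K / (1 + x\<^sup>2)"
      using density_bound[OF i j g(1)] by blast
    show ?thesis
      by (rule integrable_over_one_plus_square[OF trace_density_measurable[OF fo g(1)]
          K[OF _ opposite_illuminated[OF i j]]]) simp
  qed
  have "(\<Sum>j<n. LINT x|lborel. ?D j (Complex x ?\<theta>)) = (LINT x|lborel. (\<Sum>j<n. ?D j (Complex x ?\<theta>)))"
    by (rule Bochner_Integration.integral_sum[symmetric]) (use int in simp)
  then have total: "(\<Sum>j<n. LINT x|lborel. ?D j (Complex x ?\<theta>)) = 0" by (simp add: sum0)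
  have "(\<Sum>j<n. LINT x|lborel. ?D j (ray j x))
      = (\<Sum>j<n. LINT x|lborel. ?D j (ray j x)) - (\<Sum>j<n. LINT x|lborel. ?D j (Complex x ?\<theta>))"
    unfolding total by simp
  also have "\<dots> = (\<Sum>j<n. (LINT x|lborel. ?D j (ray j x)) - (LINT x|lborel. ?D j (Complex x ?\<theta>)))"
    by (rule sum_subtractf[symmetric])
  also have "\<dots> = (\<Sum>j\<in>{i}. (LINT x|lborel. ?D j (ray j x)) - (LINT x|lborel. ?D j (Complex x ?\<theta>)))"
    using i rotate_to_side[OF i _ _ g(1)] by (intro sum.mono_neutral_right) auto
  also have "\<dots> = 4 * of_real pi * \<i> * q i (g 0)"
  proof -
    obtain N C N' C' where fo: "finite_order (q i) N C" "finite_order (dq i) N' C'"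
      using finite_orders[OF i] .
    have "cis ?\<theta> * side i = - of_real (norm (side i))"
      unfolding opposite_direction using side_on_ray[OF i] by simp
    from trace_jump[OF fo g(1) b side_vec_nonzero[OF poly i] side_on_ray[OF i] this]
    show ?thesis by simp
  qed
  finally have "1 / (4 * of_real pi * \<i>) * (\<Sum>j<n. LINT x|lborel. ?D j (ray j x)) = restrict_S01 (q i) \<phi>"
    by (simp add: restrict_S01_def g(2))
  with inner_trace_tendsto[OF i g]
  show "((\<lambda>e. inner_trace n z Q i e \<phi>) \<longlongrightarrow> restrict_S01 (q i) \<phi>) (at_right 0)" by simp
qed

end

theorem theorem2:
  fixes \<beta> :: real and n :: nat and z :: "nat \<Rightarrow> complex" and \<Omega> :: "complex set"
    and q dq :: "nat \<Rightarrow> (real \<Rightarrow> complex) \<Rightarrow> complex" and Q :: "complex \<Rightarrow> complex"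
  assumes "\<beta> > 0"
    and "convex_polygon_ccw n z"
    and "\<Omega> = polygon_interior n z"
    and "\<forall>i<n. q i \<in> E01_dual"
    and "\<forall>i<n. dq i \<in> E01_dual"
    and "\<forall>w\<in>\<Omega>. Q w = 1 / (4 * of_real pi * \<i>) *
      (\<Sum>i<n. ray_integral (- side_angle n z i)
        (\<lambda>k. exp (\<i> * k * w - \<i> * of_real (\<beta>\<^sup>2) * cnj w / k) * spectral_fun \<beta> n z q dq i k / k))"
    and "\<forall>k. k \<noteq> 0 \<longrightarrow> (\<Sum>i<n. spectral_fun \<beta> n z q dq i k) = 0"
  shows "Cinf_on \<Omega> Q \<and>
    (\<forall>w\<in>\<Omega>. - laplacian Q w + 4 * of_real (\<beta>\<^sup>2) * Q w = 0) \<and>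
    (\<forall>i<n. has_boundary_limit n z Q i (q i))"
proof -
  have q: "q j \<in> E01_dual" "dq j \<in> E01_dual" if "j < n" for j using assms(4,5) that by blast+
  have Q: "Q w = 1 / (4 * of_real pi * \<i>) *
      (\<Sum>i<n. ray_integral (- side_angle n z i)
        (\<lambda>k. exp (\<i> * k * w - \<i> * of_real (\<beta>\<^sup>2) * cnj w / k) * spectral_fun \<beta> n z q dq i k / k))"
    if "w \<in> polygon_interior n z" for w
    using assms(3,6) that by blast
  note hyps = assms(1,2) q Q
  have "Cinf_on \<Omega> Q" unfolding assms(3) by (rule solution_smooth[OF hyps])
  moreover have "- laplacian Q w + 4 * of_real (\<beta>\<^sup>2) * Q w = 0" if "w \<in> \<Omega>" for w
    by (rule solution_equation[OF hyps]) (use assms(3) that in auto)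
  moreover have "has_boundary_limit n z Q i (q i)" if "i < n" for i
    by (rule boundary_limit[OF hyps that]) (use assms(7) in auto)
  ultimately show ?thesis by blast
qed

end
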